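(* Let $\Bbbk$ be a field and let \[\Bbbk\longrightarrow A\longrightarrow B\overset{\pi}{\longrightarrow}C\longrightarrow\Bbbk\] be a cleft exact sequence of cocommutative Hopf algebras over $\Bbbk$. Then $B$ is amenable if and only if both $A$ and $C$ are amenable.
   Context: A cleft exact sequence of Hopf algebras $\Bbbk\to A\to B\overset{\pi}{\to}C\to\Bbbk$ consists of an injective Hopf algebra map $A\to B$ (through which $A$ is identified with a Hopf subalgebra of $B$) and a surjective Hopf algebra map $\pi\colon B\to C$, such that $A=\{b\in B:(\mathrm{id}\otimes\pi)\Delta(b)=b\otimes1\}$ and such that $\pi$ admits a coalgebra section, i.e. a coalgebra map $\sigma\colon C\to B$ with $\pi\sigma=\mathrm{id}_C$. For subspaces $F,E$ of an algebra, $FE$ denotes the linear span of the products $fe$. A cocommutative Hopf algebra $H$ is called amenable if for every finite-dimensional subspace $F\le H$ and every $\epsilon>0$ there exists a finite-dimensional subcoalgebra $E\le H$ with $\dim\frac{E+FE}{E}<\epsilon\dim E$ (the strict inequality forces $E\neq0$). *)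

theory Defs
  imports Complex_Main "HOL-Library.Poly_Mapping"
begin

text \<open>
  Vector spaces are whole types with a scalar multiplication, as in the locale \<^locale>\<open>vector_space\<close>.
  An element of a tensor product \<open>V \<otimes> W\<close> is given by a representative in the free vector space
  \<open>V \<times> W \<Rightarrow>\<^sub>0 'k\<close>, and equality in \<open>V \<otimes> W\<close> is congruence modulo the span of the bilinearity
  relations. Accordingly a comultiplication is a map into the free vector space, and all its axioms
  are stated modulo these relations.
\<close>

definition free_scale :: "'k::field \<Rightarrow> ('x \<Rightarrow>\<^sub>0 'k) \<Rightarrow> ('x \<Rightarrow>\<^sub>0 'k)" where
  "free_scale c p = Poly_Mapping.map (\<lambda>d. c * d) p"

text \<open>The value at \<open>p\<close> of the linear extension of \<open>f\<close> from the basis \<open>'x\<close> to the free vector space.\<close>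

definition lin_ext :: "('k::field \<Rightarrow> 'v::ab_group_add \<Rightarrow> 'v) \<Rightarrow> ('x \<Rightarrow> 'v) \<Rightarrow> ('x \<Rightarrow>\<^sub>0 'k) \<Rightarrow> 'v" where
  "lin_ext s f p = (\<Sum>x\<in>Poly_Mapping.keys p. s (Poly_Mapping.lookup p x) (f x))"

abbreviation basis_vec :: "'x \<Rightarrow> ('x \<Rightarrow>\<^sub>0 'k::field)" where
  "basis_vec x \<equiv> Poly_Mapping.single x 1"

definition tensor_rels ::
  "('k::field \<Rightarrow> 'a::ab_group_add \<Rightarrow> 'a) \<Rightarrow> ('k \<Rightarrow> 'b::ab_group_add \<Rightarrow> 'b) \<Rightarrow> ('a \<times> 'b \<Rightarrow>\<^sub>0 'k) set" where
  "tensor_rels s t = module.span free_scale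
     ({basis_vec (x + x', y) - basis_vec (x, y) - basis_vec (x', y) | x x' y. True} \<union>
      {basis_vec (x, y + y') - basis_vec (x, y) - basis_vec (x, y') | x y y'. True} \<union>
      {basis_vec (s c x, y) - free_scale c (basis_vec (x, y)) | c x y. True} \<union>
      {basis_vec (x, t c y) - free_scale c (basis_vec (x, y)) | c x y. True})"

definition tensor_eq ::
  "('k::field \<Rightarrow> 'a::ab_group_add \<Rightarrow> 'a) \<Rightarrow> ('k \<Rightarrow> 'b::ab_group_add \<Rightarrow> 'b)
    \<Rightarrow> ('a \<times> 'b \<Rightarrow>\<^sub>0 'k) \<Rightarrow> ('a \<times> 'b \<Rightarrow>\<^sub>0 'k) \<Rightarrow> bool" where
  "tensor_eq s t p q \<longleftrightarrow> p - q \<in> tensor_rels s t"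

definition tensor_map :: "('a \<Rightarrow> 'c) \<Rightarrow> ('b \<Rightarrow> 'd) \<Rightarrow> ('a \<times> 'b \<Rightarrow>\<^sub>0 'k::field) \<Rightarrow> ('c \<times> 'd \<Rightarrow>\<^sub>0 'k)" where
  "tensor_map f g = lin_ext free_scale (\<lambda>(x, y). basis_vec (f x, g y))"

definition tensor_flip :: "('a \<times> 'b \<Rightarrow>\<^sub>0 'k::field) \<Rightarrow> ('b \<times> 'a \<Rightarrow>\<^sub>0 'k)" where
  "tensor_flip = lin_ext free_scale (\<lambda>(x, y). basis_vec (y, x))"

definition tensor_mult ::
  "('a::times \<times> 'b::times \<Rightarrow>\<^sub>0 'k::field) \<Rightarrow> ('a \<times> 'b \<Rightarrow>\<^sub>0 'k) \<Rightarrow> ('a \<times> 'b \<Rightarrow>\<^sub>0 'k)" where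
  "tensor_mult p q =
     lin_ext free_scale (\<lambda>(x, y). lin_ext free_scale (\<lambda>(x', y'). basis_vec (x * x', y * y')) q) p"

definition tensor3_rels :: "('k::field \<Rightarrow> 'a::ab_group_add \<Rightarrow> 'a) \<Rightarrow> ('a \<times> 'a \<times> 'a \<Rightarrow>\<^sub>0 'k) set" where
  "tensor3_rels s = module.span free_scale
     ({basis_vec (x + x', y, z) - basis_vec (x, y, z) - basis_vec (x', y, z) | x x' y z. True} \<union>
      {basis_vec (x, y + y', z) - basis_vec (x, y, z) - basis_vec (x, y', z) | x y y' z. True} \<union>
      {basis_vec (x, y, z + z') - basis_vec (x, y, z) - basis_vec (x, y, z') | x y z z'. True} \<union>
      {basis_vec (s c x, y, z) - free_scale c (basis_vec (x, y, z)) | c x y z. True} \<union>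
      {basis_vec (x, s c y, z) - free_scale c (basis_vec (x, y, z)) | c x y z. True} \<union>
      {basis_vec (x, y, s c z) - free_scale c (basis_vec (x, y, z)) | c x y z. True})"

definition tensor3_eq ::
  "('k::field \<Rightarrow> 'a::ab_group_add \<Rightarrow> 'a) \<Rightarrow> ('a \<times> 'a \<times> 'a \<Rightarrow>\<^sub>0 'k) \<Rightarrow> ('a \<times> 'a \<times> 'a \<Rightarrow>\<^sub>0 'k) \<Rightarrow> bool" where
  "tensor3_eq s p q \<longleftrightarrow> p - q \<in> tensor3_rels s"

text \<open>For \<open>\<Delta> : V \<rightarrow> V \<otimes> V\<close>, the maps \<open>\<Delta> \<otimes> id\<close> and \<open>id \<otimes> \<Delta>\<close> from \<open>V \<otimes> V\<close> to \<open>V \<otimes> V \<otimes> V\<close>.\<close>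

definition comult_left ::
  "('a \<Rightarrow> ('a \<times> 'a \<Rightarrow>\<^sub>0 'k::field)) \<Rightarrow> ('a \<times> 'a \<Rightarrow>\<^sub>0 'k) \<Rightarrow> ('a \<times> 'a \<times> 'a \<Rightarrow>\<^sub>0 'k)" where
  "comult_left \<Delta> =
     lin_ext free_scale (\<lambda>(x, y). lin_ext free_scale (\<lambda>(a, b). basis_vec (a, b, y)) (\<Delta> x))"

definition comult_right ::
  "('a \<Rightarrow> ('a \<times> 'a \<Rightarrow>\<^sub>0 'k::field)) \<Rightarrow> ('a \<times> 'a \<Rightarrow>\<^sub>0 'k) \<Rightarrow> ('a \<times> 'a \<times> 'a \<Rightarrow>\<^sub>0 'k)" where
  "comult_right \<Delta> =
     lin_ext free_scale (\<lambda>(x, y). lin_ext free_scale (\<lambda>(a, b). basis_vec (x, a, b)) (\<Delta> y))"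

locale k_algebra = vector_space scale
  for scale :: "'k::field \<Rightarrow> 'a::ring_1 \<Rightarrow> 'a" +
  assumes scale_mult_left: "scale c x * y = scale c (x * y)"
    and scale_mult_right: "x * scale c y = scale c (x * y)"

locale coalgebra = vector_space scale
  for scale :: "'k::field \<Rightarrow> 'a::ab_group_add \<Rightarrow> 'a" +
  fixes comult :: "'a \<Rightarrow> ('a \<times> 'a \<Rightarrow>\<^sub>0 'k)" and counit :: "'a \<Rightarrow> 'k"
  assumes comult_add: "tensor_eq scale scale (comult (x + y)) (comult x + comult y)"
    and comult_scale: "tensor_eq scale scale (comult (scale c x)) (free_scale c (comult x))"
    and counit_linear: "Vector_Spaces.linear scale (*) counit"
    and coassoc: "tensor3_eq scale (comult_left comult (comult x)) (comult_right comult (comult x))"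
    and counit_left: "lin_ext scale (\<lambda>(a, b). scale (counit a) b) (comult x) = x"
    and counit_right: "lin_ext scale (\<lambda>(a, b). scale (counit b) a) (comult x) = x"

locale hopf_algebra = k_algebra scale + coalgebra scale comult counit
  for scale :: "'k::field \<Rightarrow> 'a::ring_1 \<Rightarrow> 'a"
    and comult :: "'a \<Rightarrow> ('a \<times> 'a \<Rightarrow>\<^sub>0 'k)" and counit :: "'a \<Rightarrow> 'k" +
  fixes antipode :: "'a \<Rightarrow> 'a"
  assumes comult_mult: "tensor_eq scale scale (comult (x * y)) (tensor_mult (comult x) (comult y))"
    and comult_one: "tensor_eq scale scale (comult 1) (basis_vec (1, 1))"
    and counit_mult: "counit (x * y) = counit x * counit y"
    and counit_one: "counit 1 = 1"
    and antipode_linear: "Vector_Spaces.linear scale scale antipode"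
    and antipode_left: "lin_ext scale (\<lambda>(a, b). antipode a * b) (comult x) = scale (counit x) 1"
    and antipode_right: "lin_ext scale (\<lambda>(a, b). a * antipode b) (comult x) = scale (counit x) 1"

locale cocommutative_hopf_algebra = hopf_algebra +
  assumes cocommutative: "tensor_eq scale scale (tensor_flip (comult x)) (comult x)"

definition coalgebra_map ::
  "('k::field \<Rightarrow> 'a::ab_group_add \<Rightarrow> 'a) \<Rightarrow> ('a \<Rightarrow> ('a \<times> 'a \<Rightarrow>\<^sub>0 'k)) \<Rightarrow> ('a \<Rightarrow> 'k)
    \<Rightarrow> ('k \<Rightarrow> 'b::ab_group_add \<Rightarrow> 'b) \<Rightarrow> ('b \<Rightarrow> ('b \<times> 'b \<Rightarrow>\<^sub>0 'k)) \<Rightarrow> ('b \<Rightarrow> 'k)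
    \<Rightarrow> ('a \<Rightarrow> 'b) \<Rightarrow> bool" where
  "coalgebra_map s \<Delta> \<epsilon> s' \<Delta>' \<epsilon>' f \<longleftrightarrow>
     Vector_Spaces.linear s s' f \<and>
     (\<forall>x. tensor_eq s' s' (\<Delta>' (f x)) (tensor_map f f (\<Delta> x))) \<and>
     (\<forall>x. \<epsilon>' (f x) = \<epsilon> x)"

text \<open>Compatibility with the antipodes is automatic for bialgebra maps, hence not required.\<close>

definition hopf_map ::
  "('k::field \<Rightarrow> 'a::ring_1 \<Rightarrow> 'a) \<Rightarrow> ('a \<Rightarrow> ('a \<times> 'a \<Rightarrow>\<^sub>0 'k)) \<Rightarrow> ('a \<Rightarrow> 'k)
    \<Rightarrow> ('k \<Rightarrow> 'b::ring_1 \<Rightarrow> 'b) \<Rightarrow> ('b \<Rightarrow> ('b \<times> 'b \<Rightarrow>\<^sub>0 'k)) \<Rightarrow> ('b \<Rightarrow> 'k)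
    \<Rightarrow> ('a \<Rightarrow> 'b) \<Rightarrow> bool" where
  "hopf_map s \<Delta> \<epsilon> s' \<Delta>' \<epsilon>' f \<longleftrightarrow>
     coalgebra_map s \<Delta> \<epsilon> s' \<Delta>' \<epsilon>' f \<and> (\<forall>x y. f (x * y) = f x * f y) \<and> f 1 = 1"

locale cleft_exact_sequence =
  A: hopf_algebra sA \<Delta>A \<epsilon>A SA + B: hopf_algebra sB \<Delta>B \<epsilon>B SB + C: hopf_algebra sC \<Delta>C \<epsilon>C SC
  for sA :: "'k::field \<Rightarrow> 'a::ring_1 \<Rightarrow> 'a" and \<Delta>A \<epsilon>A SA
    and sB :: "'k \<Rightarrow> 'b::ring_1 \<Rightarrow> 'b" and \<Delta>B \<epsilon>B SB
    and sC :: "'k \<Rightarrow> 'c::ring_1 \<Rightarrow> 'c" and \<Delta>C \<epsilon>C SC +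
  fixes \<iota> :: "'a \<Rightarrow> 'b" and \<pi> :: "'b \<Rightarrow> 'c"
  assumes incl_hopf: "hopf_map sA \<Delta>A \<epsilon>A sB \<Delta>B \<epsilon>B \<iota>"
    and incl_inj: "inj \<iota>"
    and proj_hopf: "hopf_map sB \<Delta>B \<epsilon>B sC \<Delta>C \<epsilon>C \<pi>"
    and proj_surj: "surj \<pi>"
    and coinvariants: "range \<iota> = {b. tensor_eq sB sC (tensor_map id \<pi> (\<Delta>B b)) (basis_vec (b, 1))}"
    and cleft: "\<exists>\<sigma>. coalgebra_map sC \<Delta>C \<epsilon>C sB \<Delta>B \<epsilon>B \<sigma> \<and> \<pi> \<circ> \<sigma> = id"

definition fin_dim_subspace :: "('k::field \<Rightarrow> 'a::ab_group_add \<Rightarrow> 'a) \<Rightarrow> 'a set \<Rightarrow> bool" where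
  "fin_dim_subspace s V \<longleftrightarrow> module.subspace s V \<and> (\<exists>X. finite X \<and> V = module.span s X)"

text \<open>\<open>E \<otimes> E\<close> is viewed inside \<open>V \<otimes> V\<close>, as the classes of the formal combinations of pairs from \<open>E\<close>.\<close>

definition subcoalgebra ::
  "('k::field \<Rightarrow> 'a::ab_group_add \<Rightarrow> 'a) \<Rightarrow> ('a \<Rightarrow> ('a \<times> 'a \<Rightarrow>\<^sub>0 'k)) \<Rightarrow> 'a set \<Rightarrow> bool" where
  "subcoalgebra s \<Delta> E \<longleftrightarrow> module.subspace s E \<and>
     (\<forall>x\<in>E. \<exists>p. Poly_Mapping.keys p \<subseteq> E \<times> E \<and> tensor_eq s s (\<Delta> x) p)"

definition subspace_prod :: "('k::field \<Rightarrow> 'a::ring_1 \<Rightarrow> 'a) \<Rightarrow> 'a set \<Rightarrow> 'a set \<Rightarrow> 'a set" where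
  "subspace_prod s F E = module.span s {f * e | f e. f \<in> F \<and> e \<in> E}"

text \<open>\<open>S\<close> maps bijectively onto a basis of the quotient space \<open>V/W\<close>.\<close>

definition quotient_basis :: "('k::field \<Rightarrow> 'a::ab_group_add \<Rightarrow> 'a) \<Rightarrow> 'a set \<Rightarrow> 'a set \<Rightarrow> 'a set \<Rightarrow> bool" where
  "quotient_basis s V W S \<longleftrightarrow> finite S \<and> S \<subseteq> V \<and>
     (\<forall>v\<in>V. \<exists>c. v - (\<Sum>x\<in>S. s (c x) x) \<in> W) \<and>
     (\<forall>c. (\<Sum>x\<in>S. s (c x) x) \<in> W \<longrightarrow> (\<forall>x\<in>S. c x = 0))"

text \<open>The dimension of \<open>V/W\<close>, meaningful when it is finite and \<open>W\<close> is a subspace of \<open>V\<close>.\<close>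

definition quotient_dim :: "('k::field \<Rightarrow> 'a::ab_group_add \<Rightarrow> 'a) \<Rightarrow> 'a set \<Rightarrow> 'a set \<Rightarrow> nat" where
  "quotient_dim s V W = (THE n. \<exists>S. quotient_basis s V W S \<and> card S = n)"

definition amenable ::
  "('k::field \<Rightarrow> 'a::ring_1 \<Rightarrow> 'a) \<Rightarrow> ('a \<Rightarrow> ('a \<times> 'a \<Rightarrow>\<^sub>0 'k)) \<Rightarrow> bool" where
  "amenable s \<Delta> \<longleftrightarrow>
     (\<forall>F (\<epsilon>::real). fin_dim_subspace s F \<and> \<epsilon> > 0 \<longrightarrow>
       (\<exists>E. fin_dim_subspace s E \<and> subcoalgebra s \<Delta> E \<and>
          real (quotient_dim s {x + y | x y. x \<in> E \<and> y \<in> subspace_prod s F E} E)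
            < \<epsilon> * real (vector_space.dim s E)))"

end

theory Submission imports Defs "HOL-Library.Function_Algebras" begin

text \<open>
  Let \<open>\<sigma>\<close> be a coalgebra section of \<open>\<pi>\<close>. By cocommutativity \<open>q b = S (\<sigma> (\<pi> b\<^sub>1)) b\<^sub>2\<close> and
  \<open>p b = b\<^sub>1 S (\<sigma> (\<pi> b\<^sub>2))\<close> take values in \<open>A\<close>, and \<open>p\<close> is a left \<open>A\<close>-linear coalgebra map \<open>B \<rightarrow> A\<close>.

  If \<open>A\<close> and \<open>C\<close> are amenable, then \<open>\<sigma>(E\<^sub>C) E\<^sub>A\<close> is almost invariant for suitable \<open>E\<^sub>C\<close> and \<open>E\<^sub>A\<close>: its dimension
  is \<open>dim E\<^sub>C dim E\<^sub>A\<close>, and \<open>b = \<sigma> (\<pi> b\<^sub>1) (q b\<^sub>2)\<close> applied to \<open>b = f \<sigma>(c)\<close> shows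
  \<open>F \<sigma>(E\<^sub>C) \<subseteq> \<sigma>(\<pi>(F') E\<^sub>C) A'\<close> with finite-dimensional \<open>F'\<close> and \<open>A' \<subseteq> A\<close>.

  Conversely, let \<open>g : B \<rightarrow> X\<close> be one of the module coalgebra maps \<open>\<pi>\<close> and \<open>p\<close>, and let \<open>E \<subseteq> B\<close> be almost
  invariant. For \<open>D \<subseteq> X\<close> put \<open>E\<^sub>D = {e \<in> E. (id \<otimes> g) (\<Delta> e) \<in> B \<otimes> D}\<close>. The function
  \<open>D \<mapsto> dim E\<^sub>D - \<lambda> dim D\<close> is supermodular, hence has a largest maximiser \<open>D\<^sub>\<lambda>\<close>; this plays the role of the
  level set of the push-forward of the uniform measure on \<open>E\<close>. It is a subcoalgebra, and if \<open>E'\<close> contains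
  \<open>E + FE\<close> then \<open>F D\<^sub>\<lambda>\<close> is contained in the maximiser \<open>D'\<^sub>\<lambda>\<close> of \<open>E'\<close>. As \<open>dim E\<close> is the integral of \<open>dim D\<^sub>\<lambda>\<close> over \<open>\<lambda>\<close>,
  some \<open>D\<^sub>\<lambda>\<close> has small boundary.
\<close>

section \<open>Finite-dimensional subspaces\<close>

text \<open>For a group, \<open>F D_\<lambda> \<subseteq> D'_\<lambda>\<close> is transport of level
  sets along a bijection. For a general element f of a Hopf algebra, left multiplication is
  incompatible with slicing, because \<Delta>(fb) involves all the f_1 and f_2. The remedy is to
  make f an entry of the coefficient matrix m of a finite-dimensional comodule: the rule \<Delta>
  m_ij = sum_k m_ik \<otimes> m_kj lets the whole matrix act on n-tuples like a single group
  element, with inverse S(m). The price is that D_\<lambda> has to be compared with all subspaces of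
  X^n, not only with powers D^n; splitting off one coordinate at a time shows that the n-th power of
  a maximiser is still a maximiser there. The parameter \<lambda> is taken of the form j/N, so that
  scores become integers and maxima are attained; N is made large only at the very end, to absorb a
  boundary term independent of N. Equality of tensors is always tested by evaluating bilinear maps
  on representatives, and identities in Sweedler notation are checked on entries of coefficient
  matrices, where they become finite matrix identities.\<close>

lemma linI:
  assumes "vector_space s1" "vector_space s2"
    and "\<And>x y. f (x + y) = f x + f y" "\<And>c x. f (s1 c x) = s2 c (f x)"
  shows "Vector_Spaces.linear s1 s2 f"
  using assms by (simp add: Vector_Spaces.linear_iff)

lemma lin_add: "Vector_Spaces.linear s1 s2 f \<Longrightarrow> f (x + y) = f x + f y"
  and lin_scale: "Vector_Spaces.linear s1 s2 f \<Longrightarrow> f (s1 c x) = s2 c (f x)"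
  by (simp_all add: Vector_Spaces.linear_iff)

lemma lin_zero: "Vector_Spaces.linear s1 s2 f \<Longrightarrow> f 0 = 0"
  and lin_diff: "Vector_Spaces.linear s1 s2 f \<Longrightarrow> f (x - y) = f x - f y"
  and lin_sum: "Vector_Spaces.linear s1 s2 f \<Longrightarrow> f (sum g A) = (\<Sum>x\<in>A. f (g x))"
  unfolding linear_iff_module_hom
  by (simp_all add: module_hom.zero module_hom.diff module_hom.sum)

lemma lin_compose:
  "Vector_Spaces.linear s1 s2 f \<Longrightarrow> Vector_Spaces.linear s2 s3 g \<Longrightarrow> Vector_Spaces.linear s1 s3 (\<lambda>x. g (f x))"
  by (simp add: Vector_Spaces.linear_iff)

lemma linear_vector_space:
  assumes "Vector_Spaces.linear s1 s2 f"
  shows "vector_space s1" "vector_space s2"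
  using assms by (simp_all add: Vector_Spaces.linear_iff)

lemma vector_space_self: "vector_space ((*) :: 'k::field \<Rightarrow> 'k \<Rightarrow> 'k)"
  by unfold_locales (simp_all add: algebra_simps)

context vector_space
begin

lemma independent_span_Int:
  assumes "independent S" "T \<subseteq> S" "U \<subseteq> S" "T \<inter> U = {}"
  shows "span T \<inter> span U = {0}"
proof -
  have "x = 0" if x: "x \<in> span T" "x \<in> span U" for x
  proof -
    have "representation S x = representation T x" "representation S x = representation U x"
      using representation_extend[OF assms(1) x(1) assms(2)] representation_extend[OF assms(1) x(2) assms(3)]
      by simp_all
    then have "representation S x b = 0" for b
      using representation_ne_zero[of T x b] representation_ne_zero[of U x b] assms(4) by (metis disjoint_iff)
    moreover have "x \<in> span S" using x(1) assms(2) span_mono by blast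
    ultimately show ?thesis
      using sum_nonzero_representation_eq[OF assms(1), of x] by simp
  qed
  then show ?thesis using span_zero by auto
qed

lemma fin_dim_span: "finite X \<Longrightarrow> fin_dim_subspace scale (span X)"
  by (auto simp: fin_dim_subspace_def)

lemma fin_dim_subspaceD: "fin_dim_subspace scale V \<Longrightarrow> subspace V"
  by (auto simp: fin_dim_subspace_def)

lemma fin_dim_basis:
  assumes "fin_dim_subspace scale V"
  obtains Bs where "finite Bs" "independent Bs" "span Bs = V" "card Bs = dim V"
proof -
  obtain X where X: "finite X" "V = span X"
    using assms by (auto simp: fin_dim_subspace_def)
  obtain Bs where "Bs \<subseteq> X" "independent Bs" "X \<subseteq> span Bs"
    using maximal_independent_subset[of X] by blast
  moreover from this have "span Bs = V"
    using X by (metis span_eq span_mono span_superset subset_trans)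
  ultimately show thesis
    using X that dim_eq_card_independent dim_span finite_subset by metis
qed

lemma fin_dim_independent:
  assumes "fin_dim_subspace scale V" "independent S" "S \<subseteq> V"
  shows "finite S" "card S \<le> dim V"
proof -
  obtain Bs where "finite Bs" "independent Bs" "span Bs = V" "card Bs = dim V"
    using fin_dim_basis[OF assms(1)] .
  then show "finite S" "card S \<le> dim V"
    using independent_span_bound[of Bs S] assms by auto
qed

lemma fin_dim_mono:
  assumes "fin_dim_subspace scale V" "subspace U" "U \<subseteq> V"
  shows "fin_dim_subspace scale U" "dim U \<le> dim V"
proof -
  obtain S where S: "S \<subseteq> U" "independent S" "U \<subseteq> span S"
    using maximal_independent_subset[of U] by blast
  then have "finite S" "card S \<le> dim V"
    using fin_dim_independent[OF assms(1) S(2)] assms(3) by auto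
  moreover have "span S = U"
    using S assms(2) by (simp add: span_subspace)
  ultimately show "fin_dim_subspace scale U" "dim U \<le> dim V"
    using fin_dim_span S(2) dim_span_eq_card_independent by metis+
qed

lemma fin_dim_eqI:
  assumes V: "fin_dim_subspace scale V" and U: "subspace U" "U \<subseteq> V" and le: "dim V \<le> dim U"
  shows "U = V"
proof (rule ccontr)
  assume "U \<noteq> V"
  then obtain v where v: "v \<in> V" "v \<notin> U" using U by auto
  obtain Bs where Bs: "finite Bs" "independent Bs" "span Bs = U" "card Bs = dim U"
    using fin_dim_basis[OF fin_dim_mono(1)[OF V U]] .
  have "independent (insert v Bs)" "v \<notin> Bs"
    using Bs v independent_insertI span_base by auto
  moreover have "insert v Bs \<subseteq> V"
    using Bs v U span_superset by blast
  ultimately show False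
    using fin_dim_independent(2)[OF V, of "insert v Bs"] Bs le by simp
qed

lemma fin_dim_zero: "fin_dim_subspace scale {0}" and dim_zero: "dim {0} = 0"
  using fin_dim_span[of "{}"] dim_eq_card_independent[of "{}"] dim_span[of "{}"]
  by (auto simp: independent_empty)

lemma fin_dim_eq_zero:
  assumes "fin_dim_subspace scale V" "dim V = 0"
  shows "V = {0}"
  using fin_dim_eqI[OF assms(1), of "{0}"] fin_dim_subspaceD[OF assms(1)] subspace_0 assms(2)
  by auto

lemma fin_dim_sums:
  assumes "fin_dim_subspace scale U" "fin_dim_subspace scale V"
  shows "fin_dim_subspace scale {x + y | x y. x \<in> U \<and> y \<in> V}"
proof -
  obtain X Y where "finite X" "U = span X" "finite Y" "V = span Y"
    using assms by (auto simp: fin_dim_subspace_def)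
  then show ?thesis
    using span_Un[of X Y] fin_dim_span[of "X \<union> Y"] by simp
qed

text \<open>The map x - P x then serves as a model of the quotient map modulo D without leaving the
  ambient type.\<close>

lemma projection_exists:
  assumes "subspace D"
  obtains P where "Vector_Spaces.linear scale scale P" "\<And>x. P x \<in> D" "\<And>d. d \<in> D \<Longrightarrow> P d = d"
proof -
  interpret vector_space_pair scale scale by unfold_locales
  obtain Bs where Bs: "Bs \<subseteq> D" "independent Bs" "D \<subseteq> span Bs"
    using maximal_independent_subset[of D] by blast
  have span: "span Bs = D" using Bs assms by (simp add: span_subspace)
  let ?P = "construct Bs id"
  have lin: "Vector_Spaces.linear scale scale ?P" by (rule linear_construct[OF Bs(2)])
  show thesis
  proof
    show "Vector_Spaces.linear scale scale ?P" by fact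
    show "?P x \<in> D" for x
      using construct_in_span[OF Bs(2), of id x] span by simp
    show "?P d = d" if "d \<in> D" for d
    proof -
      have "d \<in> span Bs" using that span by simp
      moreover have "Vector_Spaces.linear scale scale (\<lambda>x. x)"
        by (rule linI) (auto intro: vector_space_axioms)
      ultimately show ?thesis
        using linear_eq_on[OF lin, of "\<lambda>x. x" d Bs] construct_basis[OF Bs(2), of _ id] by simp
    qed
  qed
qed

lemma separating_functional:
  assumes "subspace D" "x \<notin> D"
  obtains h where "Vector_Spaces.linear scale (*) h" "\<And>d. d \<in> D \<Longrightarrow> h d = 0" "h x \<noteq> 0"
proof -
  interpret vector_space_pair scale "(*)"
    by (intro vector_space_pair.intro vector_space_axioms vector_space_self)
  obtain Bs where Bs: "Bs \<subseteq> D" "independent Bs" "D \<subseteq> span Bs"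
    using maximal_independent_subset[of D] by blast
  have span: "span Bs = D" using Bs assms by (simp add: span_subspace)
  have ind: "independent (insert x Bs)"
    using Bs assms span independent_insertI by auto
  let ?h = "construct (insert x Bs) (\<lambda>b. if b = x then 1 else 0)"
  have lin: "Vector_Spaces.linear scale (*) ?h" by (rule linear_construct[OF ind])
  show thesis
  proof
    show "Vector_Spaces.linear scale (*) ?h" by fact
    show "?h x \<noteq> 0" using construct_basis[OF ind, of x] by simp
    show "?h d = 0" if "d \<in> D" for d
    proof -
      have "x \<notin> Bs" using Bs assms by auto
      then have "?h b = 0" if "b \<in> Bs" for b
        using construct_basis[OF ind, of b "\<lambda>b. if b = x then 1 else 0"] that by auto
      then show ?thesis
        using module_hom.eq_0_on_span[of scale "(*)" ?h Bs d] lin that span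
        unfolding linear_iff_module_hom by auto
    qed
  qed
qed

lemma functional_ext:
  assumes "\<And>h. Vector_Spaces.linear scale (*) h \<Longrightarrow> h x = h y"
  shows "x = y"
proof (rule ccontr)
  assume "x \<noteq> y"
  then obtain h where "Vector_Spaces.linear scale (*) h" "h (x - y) \<noteq> 0"
    using separating_functional[of "{0}" "x - y"] by auto
  then show False using assms[of h] by (simp add: lin_diff)
qed

lemma dual_basis:
  assumes "independent Bs"
  obtains h where "\<And>b. Vector_Spaces.linear scale (*) (h b)"
    "\<And>b b'. b' \<in> Bs \<Longrightarrow> h b b' = (if b = b' then 1 else 0)"
proof -
  interpret vector_space_pair scale "(*)"
    by (intro vector_space_pair.intro vector_space_axioms vector_space_self)
  show thesis
    by (rule that[of "\<lambda>b. construct Bs (\<lambda>b'. if b = b' then 1 else 0)"])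
      (simp_all add: linear_construct construct_basis assms)
qed

end

context vector_space_pair
begin

lemma fin_dim_image:
  assumes "Vector_Spaces.linear s1 s2 f" "fin_dim_subspace s1 V"
  shows "fin_dim_subspace s2 (f ` V)"
proof -
  obtain X where X: "finite X" "V = vs1.span X"
    using assms by (auto simp: fin_dim_subspace_def)
  have "f ` V = vs2.span (f ` X)"
    using linear_span_image[OF assms(1)] X by simp
  then show ?thesis using X vs2.fin_dim_span by simp
qed

lemma fin_dim_kernel:
  assumes "Vector_Spaces.linear s1 s2 f" "fin_dim_subspace s1 V"
  shows "vs1.subspace {v \<in> V. f v = 0}" "fin_dim_subspace s1 {v \<in> V. f v = 0}"
proof -
  have "{v \<in> V. f v = 0} = V \<inter> {v. f v = 0}" by auto
  then show *: "vs1.subspace {v \<in> V. f v = 0}"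
    using vs1.subspace_inter[OF vs1.fin_dim_subspaceD[OF assms(2)] linear_subspace_kernel[OF assms(1)]]
    by simp
  show "fin_dim_subspace s1 {v \<in> V. f v = 0}"
    by (rule vs1.fin_dim_mono(1)[OF assms(2) *]) auto
qed

theorem rank_nullity:
  assumes f: "Vector_Spaces.linear s1 s2 f" and V: "fin_dim_subspace s1 V"
  shows "vs1.dim V = vs2.dim (f ` V) + vs1.dim {v \<in> V. f v = 0}"
proof -
  let ?K = "{v \<in> V. f v = 0}"
  obtain K where K: "finite K" "vs1.independent K" "vs1.span K = ?K" "card K = vs1.dim ?K"
    using vs1.fin_dim_basis[OF fin_dim_kernel(2)[OF f V]] .
  have "K \<subseteq> V" using K(3) vs1.span_superset by blast
  then obtain Bs where Bs: "K \<subseteq> Bs" "Bs \<subseteq> V" "vs1.independent Bs" "V \<subseteq> vs1.span Bs"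
    using vs1.maximal_independent_subset_extend K(2) by metis
  have span: "vs1.span Bs = V"
    using Bs vs1.fin_dim_subspaceD[OF V] by (simp add: vs1.span_subspace)
  have fin: "finite Bs" using vs1.fin_dim_independent[OF V Bs(3,2)] by simp
  let ?C = "Bs - K"
  have spanC: "vs1.span ?C \<subseteq> V" using span vs1.span_mono[of ?C Bs] by auto
  have inj: "inj_on f (vs1.span ?C)"
  proof (subst linear_inj_on_iff_eq_0[OF f vs1.subspace_span], intro ballI impI)
    fix x assume x: "x \<in> vs1.span ?C" "f x = 0"
    then have "x \<in> vs1.span K" unfolding K(3) using spanC by auto
    moreover have "vs1.span K \<inter> vs1.span ?C = {0}"
      by (rule vs1.independent_span_Int[OF Bs(3) Bs(1)]) auto
    ultimately show "x = 0" using x(1) by auto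
  qed
  have "f ` V = vs2.span (f ` ?C)"
  proof -
    have "f ` V = vs2.span (f ` Bs)" unfolding span[symmetric] by (rule linear_span_image[OF f, symmetric])
    also have "\<dots> = vs2.span (f ` ?C)"
    proof (rule vs2.span_eq[THEN iffD2], intro conjI subsetI)
      fix x assume "x \<in> f ` Bs"
      then obtain b where b: "b \<in> Bs" "x = f b" by auto
      show "x \<in> vs2.span (f ` ?C)"
      proof (cases "b \<in> K")
        case True
        then have "f b = 0" using vs1.span_base[OF True] unfolding K(3) by simp
        then show ?thesis using b vs2.span_zero by simp
      next
        case False
        then show ?thesis using b by (simp add: vs2.span_base)
      qed
    qed (auto intro: vs2.span_base)
    finally show ?thesis .
  qed
  moreover have "vs2.independent (f ` ?C)"
    by (rule linear_independent_injective_image[OF f vs1.independent_mono[OF Bs(3) Diff_subset] inj])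
  ultimately have "vs2.dim (f ` V) = card (f ` ?C)"
    by (simp add: vs2.dim_eq_card_independent)
  also have "\<dots> = card ?C"
    by (rule card_image[OF inj_on_subset[OF inj vs1.span_superset]])
  finally have "vs2.dim (f ` V) + card K = card Bs"
    using fin Bs(1) by (simp add: card_Diff_subset K(1) card_mono)
  moreover have "vs1.dim V = card Bs"
    unfolding span[symmetric] by (rule vs1.dim_span_eq_card_independent[OF Bs(3)])
  ultimately show ?thesis using K(4) by simp
qed

text \<open>Rank-nullity for T followed by the quotient map modulo W. For the identity T it is the
  dimension formula for sums and intersections; for a matrix T it gives the exact count behind the
  exchange argument on tuples.\<close>

lemma dim_image_sums:
  assumes T: "Vector_Spaces.linear s1 s2 T"
    and Z: "fin_dim_subspace s1 Z" and W: "fin_dim_subspace s2 W"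
  shows "vs2.dim {x + y | x y. x \<in> T ` Z \<and> y \<in> W} + vs1.dim {z \<in> Z. T z \<in> W} = vs1.dim Z + vs2.dim W"
proof -
  have sW: "vs2.subspace W" using W by (rule vs2.fin_dim_subspaceD)
  obtain P where P: "Vector_Spaces.linear s2 s2 P" "\<And>x. P x \<in> W" "\<And>d. d \<in> W \<Longrightarrow> P d = d"
    using vs2.projection_exists[OF sW] by blast
  \<comment> \<open>\<open>f\<close> stands for the quotient map modulo W: its kernel is exactly
    W.\<close>
  define f where "f x = x - P x" for x
  have f: "Vector_Spaces.linear s2 s2 f"
    by (rule linI[OF vs2.vector_space_axioms vs2.vector_space_axioms])
      (simp_all add: f_def lin_add[OF P(1)] lin_scale[OF P(1)] vs2.scale_right_diff_distrib)
  have ker: "f x = 0 \<longleftrightarrow> x \<in> W" for x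
    using P by (metis f_def eq_iff_diff_eq_0)
  interpret V22: vector_space_pair s2 s2 by unfold_locales
  let ?S = "{x + y | x y. x \<in> T ` Z \<and> y \<in> W}"
  have S: "fin_dim_subspace s2 ?S" by (rule vs2.fin_dim_sums[OF fin_dim_image[OF T Z] W])
  have fT: "Vector_Spaces.linear s1 s2 (\<lambda>x. f (T x))" by (rule lin_compose[OF T f])
  have "f ` ?S = (\<lambda>x. f (T x)) ` Z"
  proof
    show "f ` ?S \<subseteq> (\<lambda>x. f (T x)) ` Z"
    proof safe
      fix z w assume "z \<in> Z" "w \<in> W"
      then have "f (T z + w) = f (T z)" using ker[of w] by (simp add: lin_add[OF f])
      then show "f (T z + w) \<in> (\<lambda>x. f (T x)) ` Z" using \<open>z \<in> Z\<close> by simp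
    qed
    show "(\<lambda>x. f (T x)) ` Z \<subseteq> f ` ?S"
    proof safe
      fix z assume "z \<in> Z"
      moreover have "T z = T z + 0" by simp
      ultimately have "T z \<in> ?S" using vs2.subspace_0[OF sW] by blast
      then show "f (T z) \<in> f ` ?S" by blast
    qed
  qed
  moreover have "{v \<in> ?S. f v = 0} = W"
  proof -
    have "w \<in> ?S" if "w \<in> W" for w
    proof -
      have "0 \<in> T ` Z" "w = 0 + w"
        using lin_zero[OF T] vs1.subspace_0[OF vs1.fin_dim_subspaceD[OF Z]] by (auto intro: image_eqI[of _ _ 0])
      then show ?thesis using that by blast
    qed
    then show ?thesis using ker by auto
  qed
  ultimately show ?thesis
    using V22.rank_nullity[OF f S] rank_nullity[OF fT Z] by (simp add: ker)
qed

end

context vector_space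
begin

lemma dim_sums_Int_fin:
  assumes U: "fin_dim_subspace scale U" and W: "fin_dim_subspace scale W"
  shows "dim {x + y | x y. x \<in> U \<and> y \<in> W} + dim (U \<inter> W) = dim U + dim W"
proof -
  interpret vector_space_pair scale scale by unfold_locales
  have "{z \<in> U. z \<in> W} = U \<inter> W" by auto
  then show ?thesis
    using dim_image_sums[of "\<lambda>x. x", OF linI U W] vector_space_axioms by simp
qed

lemma subspace_sums_upper:
  assumes "subspace U" "subspace W"
  shows "U \<subseteq> {x + y | x y. x \<in> U \<and> y \<in> W}" "W \<subseteq> {x + y | x y. x \<in> U \<and> y \<in> W}"
proof -
  have "x = x + 0" "x = 0 + x" for x :: 'b by simp_all
  then show "U \<subseteq> {x + y | x y. x \<in> U \<and> y \<in> W}" "W \<subseteq> {x + y | x y. x \<in> U \<and> y \<in> W}"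
    using assms subspace_0 by blast+
qed

lemma quotient_basis_card:
  assumes V: "fin_dim_subspace scale V" and E: "subspace E" "E \<subseteq> V"
    and S: "quotient_basis scale V E S"
  shows "card S + dim E = dim V"
proof -
  have fin: "finite S" and SV: "S \<subseteq> V"
    and gen: "\<And>v. v \<in> V \<Longrightarrow> \<exists>c. v - (\<Sum>x\<in>S. scale (c x) x) \<in> E"
    and ind: "\<And>c. (\<Sum>x\<in>S. scale (c x) x) \<in> E \<Longrightarrow> \<forall>x\<in>S. c x = 0"
    using S by (auto simp: quotient_basis_def)
  have fE: "fin_dim_subspace scale E" using fin_dim_mono(1)[OF V E] .
  have "independent S"
    using fin ind subspace_0[OF E(1)] by (metis dependent_finite)
  then have card: "card S = dim (span S)" by (simp add: dim_eq_card_independent)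
  have "span S \<inter> E = {0}"
  proof -
    have "x = 0" if x: "x \<in> span S" "x \<in> E" for x
    proof -
      obtain c where c: "x = (\<Sum>v\<in>S. scale (c v) v)" using x(1) span_finite[OF fin] by auto
      then show ?thesis using ind[of c] x(2) by simp
    qed
    then show ?thesis using span_zero subspace_0[OF E(1)] by auto
  qed
  moreover have "{x + y | x y. x \<in> span S \<and> y \<in> E} = V"
  proof
    show "{x + y | x y. x \<in> span S \<and> y \<in> E} \<subseteq> V"
      using SV E(2) fin_dim_subspaceD[OF V] span_minimal subspace_add by blast
    show "V \<subseteq> {x + y | x y. x \<in> span S \<and> y \<in> E}"
    proof
      fix v assume "v \<in> V"
      then obtain c where c: "v - (\<Sum>x\<in>S. scale (c x) x) \<in> E" using gen by blast
      have "(\<Sum>x\<in>S. scale (c x) x) \<in> span S" by (intro span_sum span_scale span_base)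
      moreover have "v = (\<Sum>x\<in>S. scale (c x) x) + (v - (\<Sum>x\<in>S. scale (c x) x))" by simp
      ultimately show "v \<in> {x + y | x y. x \<in> span S \<and> y \<in> E}" using c by blast
    qed
  qed
  ultimately show ?thesis
    using dim_sums_Int_fin[OF fin_dim_span[OF fin] fE] dim_zero card by simp
qed

lemma quotient_basis_exists:
  assumes V: "fin_dim_subspace scale V" and E: "subspace E" "E \<subseteq> V"
  obtains S where "quotient_basis scale V E S"
proof -
  obtain K where K: "finite K" "independent K" "span K = E" "card K = dim E"
    using fin_dim_basis[OF fin_dim_mono(1)[OF V E]] .
  have "K \<subseteq> V" using K(3) E(2) span_superset by blast
  then obtain Bs where Bs: "K \<subseteq> Bs" "Bs \<subseteq> V" "independent Bs" "V \<subseteq> span Bs"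
    using maximal_independent_subset_extend K(2) by metis
  have fin: "finite Bs" using fin_dim_independent[OF V Bs(3,2)] by simp
  have "quotient_basis scale V E (Bs - K)"
    unfolding quotient_basis_def
  proof (intro conjI ballI allI impI)
    show "finite (Bs - K)" "Bs - K \<subseteq> V" using fin Bs by auto
  next
    fix v assume "v \<in> V"
    then obtain c where c: "v = (\<Sum>x\<in>Bs. scale (c x) x)"
      using Bs(4) span_finite[OF fin] by auto
    have "v - (\<Sum>x\<in>Bs - K. scale (c x) x) = (\<Sum>x\<in>K. scale (c x) x)"
      using c sum.subset_diff[OF Bs(1) fin, of "\<lambda>x. scale (c x) x"] by simp
    moreover have "\<dots> \<in> E" unfolding K(3)[symmetric] by (intro span_sum span_scale span_base)
    ultimately show "\<exists>c. v - (\<Sum>x\<in>Bs - K. scale (c x) x) \<in> E" by metis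
  next
    fix c x assume c: "(\<Sum>x\<in>Bs - K. scale (c x) x) \<in> E" and x: "x \<in> Bs - K"
    obtain d where d: "(\<Sum>x\<in>Bs - K. scale (c x) x) = (\<Sum>x\<in>K. scale (d x) x)"
      using c K(3) span_finite[OF K(1)] by auto
    let ?e = "\<lambda>x. if x \<in> K then - d x else c x"
    have "(\<Sum>x\<in>Bs. scale (?e x) x) = (\<Sum>x\<in>Bs - K. scale (?e x) x) + (\<Sum>x\<in>K. scale (?e x) x)"
      by (rule sum.subset_diff[OF Bs(1) fin])
    also have "\<dots> = (\<Sum>x\<in>Bs - K. scale (c x) x) - (\<Sum>x\<in>K. scale (d x) x)"
      by (simp add: sum_negf)
    also have "\<dots> = 0" using d by simp
    finally have "?e x = 0"
      using independentD[OF Bs(3) fin, of ?e x] x by auto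
    then show "c x = 0" using x by simp
  qed
  then show thesis by (rule that)
qed

text \<open>Quotient bases exist and all have the same cardinality, so the definite description in
  \<open>quotient_dim\<close> is meaningful here.\<close>

lemma quotient_dim_eq:
  assumes V: "fin_dim_subspace scale V" and E: "subspace E" "E \<subseteq> V"
  shows "quotient_dim scale V E = dim V - dim E"
proof -
  obtain S where S: "quotient_basis scale V E S" using quotient_basis_exists[OF assms] .
  show ?thesis
    unfolding quotient_dim_def
    using S quotient_basis_card[OF assms] by (intro the_equality) (metis add_diff_cancel_right')+
qed

end

section \<open>Maximal slices\<close>

definition tup_scale :: "('k \<Rightarrow> 'v \<Rightarrow> 'v) \<Rightarrow> 'k \<Rightarrow> ('i \<Rightarrow> 'v) \<Rightarrow> ('i \<Rightarrow> 'v)" where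
  "tup_scale s c z = (\<lambda>i. s c (z i))"

text \<open>The power D^I, realised inside a function space; vanishing outside I keeps its dimension
  equal to card I times dim D even when the index type is infinite.\<close>

definition tuples :: "'i set \<Rightarrow> 'v::zero set \<Rightarrow> ('i \<Rightarrow> 'v) set" where
  "tuples I D = {z. (\<forall>i\<in>I. z i \<in> D) \<and> (\<forall>i. i \<notin> I \<longrightarrow> z i = 0)}"

definition tup_single :: "'i \<Rightarrow> 'v::zero \<Rightarrow> ('i \<Rightarrow> 'v)" where
  "tup_single i d = (\<lambda>j. if j = i then d else 0)"

definition tup_matrix :: "'i set \<Rightarrow> ('i \<Rightarrow> 'i \<Rightarrow> 'v \<Rightarrow> 'w::comm_monoid_add) \<Rightarrow> ('i \<Rightarrow> 'v) \<Rightarrow> ('i \<Rightarrow> 'w)" where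
  "tup_matrix I P z = (\<lambda>i. if i \<in> I then \<Sum>k\<in>I. P i k (z k) else 0)"

lemma vector_space_tup_scale:
  assumes "vector_space s"
  shows "vector_space (tup_scale s)"
proof -
  interpret vector_space s by fact
  show ?thesis
    by unfold_locales (simp_all add: tup_scale_def fun_eq_iff scale_right_distrib scale_left_distrib)
qed

lemma linear_tup_component:
  assumes "vector_space s"
  shows "Vector_Spaces.linear (tup_scale s) s (\<lambda>z. z i)"
  by (rule linI[OF vector_space_tup_scale[OF assms] assms]) (simp_all add: tup_scale_def)

lemma linear_tup_single:
  assumes "vector_space s"
  shows "Vector_Spaces.linear s (tup_scale s) (tup_single i)"
proof -
  interpret vector_space s by fact
  show ?thesis
    by (rule linI[OF assms vector_space_tup_scale[OF assms]]) (auto simp: tup_scale_def tup_single_def)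
qed

lemma linear_tup_matrix:
  assumes s: "vector_space s" "vector_space t"
    and "\<And>i k. i \<in> I \<Longrightarrow> k \<in> I \<Longrightarrow> Vector_Spaces.linear s t (P i k)"
  shows "Vector_Spaces.linear (tup_scale s) (tup_scale t) (tup_matrix I P)"
proof -
  interpret t: vector_space t by fact
  show ?thesis
    by (rule linI[OF vector_space_tup_scale[OF s(1)] vector_space_tup_scale[OF s(2)]])
      (auto simp: fun_eq_iff tup_scale_def tup_matrix_def lin_add[OF assms(3)] lin_scale[OF assms(3)]
        sum.distrib t.scale_sum_right intro!: sum.cong)
qed

lemma tup_matrix_single:
  assumes "finite I" "i \<in> I" "l \<in> I" "\<And>i k. i \<in> I \<Longrightarrow> k \<in> I \<Longrightarrow> P i k 0 = 0"
  shows "tup_matrix I P (tup_single l d) i = P i l d"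
proof -
  have "(\<Sum>k\<in>I. P i k (tup_single l d k)) = (\<Sum>k\<in>I. if k = l then P i l d else 0)"
    using assms by (intro sum.cong) (auto simp: tup_single_def)
  then show ?thesis using assms by (simp add: tup_matrix_def)
qed

context vector_space
begin

lemma subspace_tuples:
  assumes "subspace D"
  shows "module.subspace (tup_scale scale) (tuples I D)"
proof -
  interpret t: vector_space "tup_scale scale" by (rule vector_space_tup_scale) (rule vector_space_axioms)
  show ?thesis
    using assms by (intro t.subspaceI) (auto simp: tuples_def tup_scale_def subspace_0 subspace_add subspace_scale)
qed

lemma fin_dim_tuples:
  assumes "finite I" and D: "fin_dim_subspace scale D"
  shows "fin_dim_subspace (tup_scale scale) (tuples I D)"
    and "vector_space.dim (tup_scale scale) (tuples I D) = card I * dim D"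
proof -
  interpret t: vector_space "tup_scale scale" by (rule vector_space_tup_scale) (rule vector_space_axioms)
  interpret p: vector_space_pair scale "tup_scale scale" ..
  have sD: "subspace D" using D by (rule fin_dim_subspaceD)
  have "fin_dim_subspace (tup_scale scale) (tuples I D) \<and> t.dim (tuples I D) = card I * dim D"
    using assms(1)
  proof (induction I)
    case empty
    have "tuples {} D = {0 :: 'c \<Rightarrow> 'b}" by (auto simp: tuples_def)
    then show ?case using t.fin_dim_zero t.dim_zero by simp
  next
    case (insert i I)
    let ?T = "tup_single i :: 'b \<Rightarrow> 'c \<Rightarrow> 'b"
    have T: "Vector_Spaces.linear scale (tup_scale scale) ?T"
      by (rule linear_tup_single) (rule vector_space_axioms)
    have sums: "{x + y | x y. x \<in> ?T ` D \<and> y \<in> tuples I D} = tuples (insert i I) D"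
    proof (intro equalityI subsetI)
      fix z assume "z \<in> {x + y | x y. x \<in> ?T ` D \<and> y \<in> tuples I D}"
      then obtain d y where "z = ?T d + y" "d \<in> D" "y \<in> tuples I D" by auto
      then show "z \<in> tuples (insert i I) D"
        using sD insert.hyps by (auto simp: tuples_def tup_single_def subspace_add subspace_0)
    next
      fix z assume z: "z \<in> tuples (insert i I) D"
      have "z = ?T (z i) + z(i := 0)" by (auto simp: tup_single_def)
      moreover have "z i \<in> D" "z(i := 0) \<in> tuples I D" using z insert.hyps by (auto simp: tuples_def)
      ultimately show "z \<in> {x + y | x y. x \<in> ?T ` D \<and> y \<in> tuples I D}" by blast
    qed
    have fin: "fin_dim_subspace (tup_scale scale) (tuples (insert i I) D)"
      using t.fin_dim_sums[OF p.fin_dim_image[OF T D], of "tuples I D"] insert.IH sums by simp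
    have ker: "{z \<in> D. ?T z \<in> tuples I D} = {0}"
    proof -
      have "z = 0" if "?T z \<in> tuples I D" for z
      proof -
        have "?T z i = 0" using that insert.hyps by (simp add: tuples_def)
        then show ?thesis by (simp add: tup_single_def)
      qed
      moreover have "?T 0 \<in> tuples I D" using sD by (auto simp: tuples_def tup_single_def subspace_0)
      ultimately show ?thesis using sD subspace_0 by auto
    qed
    have "t.dim (tuples (insert i I) D) = dim D + t.dim (tuples I D)"
      using p.dim_image_sums[OF T D, of "tuples I D"] insert.IH sums ker dim_zero by simp
    then show ?case using fin insert by simp
  qed
  then show "fin_dim_subspace (tup_scale scale) (tuples I D)"
    and "t.dim (tuples I D) = card I * dim D" by simp_all
qed

end

text \<open>The arithmetic shared by supermodularity and by splitting off a coordinate: an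
  inequality for slices and an exact formula for subspaces combine into an inequality of scores with
  weights N and j.\<close>

lemma weighted_diff_mono:
  fixes a b c d :: nat
  assumes "a + b \<le> c + d" "e + f = g + h"
  shows "(int N * int a - int j * int g) + (int N * int b - int j * int h)
    \<le> (int N * int c - int j * int e) + (int N * int d - int j * int f)"
proof -
  have "int N * (int a + int b) \<le> int N * (int c + int d)"
    using assms(1) by (intro mult_left_mono) auto
  moreover have "int j * (int e + int f) = int j * (int g + int h)"
    using assms(2) by (metis of_nat_add)
  ultimately show ?thesis by (simp add: algebra_simps)
qed

section \<open>Supermodular scores and their largest maximisers\<close>

locale slicing = vector_space_pair sB sX
  for sB :: "'k::field \<Rightarrow> 'b::ab_group_add \<Rightarrow> 'b" and sX :: "'k \<Rightarrow> 'x::ab_group_add \<Rightarrow> 'x" +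
  fixes \<C> :: "('b \<Rightarrow> 'x) set"
  assumes slicing_linear: "c \<in> \<C> \<Longrightarrow> Vector_Spaces.linear sB sX c"
begin

text \<open>This is E_D when \<C> consists of the maps b -> \<phi>(b_1) g(b_2) for all functionals
  \<phi>: testing against every \<phi> expresses membership in B \<otimes> D.\<close>

definition slice :: "'b set \<Rightarrow> 'x set \<Rightarrow> 'b set" where
  "slice E D = {e \<in> E. \<forall>c\<in>\<C>. c e \<in> D}"

text \<open>N times (dim E_D - \<lambda> dim D) for \<lambda> = j/N; clearing the denominator makes
  the values integers.\<close>

definition score :: "nat \<Rightarrow> nat \<Rightarrow> 'b set \<Rightarrow> 'x set \<Rightarrow> int" where
  "score N j E D = int N * int (vs1.dim (slice E D)) - int j * int (vs2.dim D)"

definition optimal :: "nat \<Rightarrow> nat \<Rightarrow> 'b set \<Rightarrow> 'x set \<Rightarrow> bool" where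
  "optimal N j E D \<longleftrightarrow> fin_dim_subspace sX D \<and>
     (\<forall>D'. fin_dim_subspace sX D' \<longrightarrow> score N j E D' \<le> score N j E D)"

definition max_optimal :: "nat \<Rightarrow> nat \<Rightarrow> 'b set \<Rightarrow> 'x set \<Rightarrow> bool" where
  "max_optimal N j E D \<longleftrightarrow> optimal N j E D \<and> (\<forall>D'. optimal N j E D' \<longrightarrow> D' \<subseteq> D)"

lemma fin_dim_slice:
  assumes "fin_dim_subspace sB E" "vs2.subspace D"
  shows "fin_dim_subspace sB (slice E D)" "vs1.dim (slice E D) \<le> vs1.dim E"
proof -
  have "vs1.subspace (slice E D)"
    using vs1.fin_dim_subspaceD[OF assms(1)] assms(2)
    by (intro vs1.subspaceI)
      (auto simp: slice_def lin_add[OF slicing_linear] lin_scale[OF slicing_linear] lin_zero[OF slicing_linear]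
        vs1.subspace_0 vs1.subspace_add vs1.subspace_scale vs2.subspace_0 vs2.subspace_add vs2.subspace_scale)
  then show "fin_dim_subspace sB (slice E D)" "vs1.dim (slice E D) \<le> vs1.dim E"
    using vs1.fin_dim_mono[OF assms(1), of "slice E D"] by (auto simp: slice_def)
qed

lemma score_le:
  assumes "fin_dim_subspace sB E" "vs2.subspace D"
  shows "score N j E D \<le> int N * int (vs1.dim E) - int j * int (vs2.dim D)"
  unfolding score_def using fin_dim_slice(2)[OF assms] by (intro diff_right_mono mult_left_mono) auto

text \<open>Slicing commutes with intersections, the sum of two slices lies in the slice of the sum,
  and dim D is modular.\<close>

lemma score_supermodular:
  assumes E: "fin_dim_subspace sB E" and D: "fin_dim_subspace sX D" and D': "fin_dim_subspace sX D'"
  shows "score N j E D + score N j E D' \<le> score N j E {x + y | x y. x \<in> D \<and> y \<in> D'} + score N j E (D \<inter> D')"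
proof -
  let ?S = "{x + y | x y. x \<in> D \<and> y \<in> D'}"
  have sD: "vs2.subspace D" "vs2.subspace D'" using D D' vs2.fin_dim_subspaceD by auto
  note fs = fin_dim_slice[OF E]
  have sub: "{x + y | x y. x \<in> slice E D \<and> y \<in> slice E D'} \<subseteq> slice E ?S"
  proof safe
    fix x y assume x: "x \<in> slice E D" "y \<in> slice E D'"
    have "c (x + y) \<in> ?S" if "c \<in> \<C>" for c
    proof -
      have "c (x + y) = c x + c y" "c x \<in> D" "c y \<in> D'"
        using x that lin_add[OF slicing_linear[OF that]] by (auto simp: slice_def)
      then show ?thesis by blast
    qed
    moreover have "x + y \<in> E"
      using x vs1.subspace_add[OF vs1.fin_dim_subspaceD[OF E]] by (auto simp: slice_def)
    ultimately show "x + y \<in> slice E ?S" by (auto simp: slice_def)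
  qed
  have "slice E D \<inter> slice E D' = slice E (D \<inter> D')" by (auto simp: slice_def)
  then have "vs1.dim (slice E D) + vs1.dim (slice E D') =
      vs1.dim {x + y | x y. x \<in> slice E D \<and> y \<in> slice E D'} + vs1.dim (slice E (D \<inter> D'))"
    using vs1.dim_sums_Int_fin[OF fs(1)[OF sD(1)] fs(1)[OF sD(2)]] by simp
  also have "\<dots> \<le> vs1.dim (slice E ?S) + vs1.dim (slice E (D \<inter> D'))"
    using vs1.fin_dim_mono(2)[OF fs(1) _ sub] vs2.subspace_sums[OF sD]
      vs1.subspace_sums[OF vs1.fin_dim_subspaceD[OF fs(1)[OF sD(1)]] vs1.fin_dim_subspaceD[OF fs(1)[OF sD(2)]]]
    by simp
  finally show ?thesis
    unfolding score_def using vs2.dim_sums_Int_fin[OF D D'] by (rule weighted_diff_mono)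
qed

text \<open>Scores are integers bounded above by N dim E, so a minimal defect \<open>n\<close> from
  this bound is attained.\<close>

lemma optimal_exists:
  assumes "fin_dim_subspace sB E"
  obtains D where "optimal N j E D"
proof -
  let ?b = "int N * int (vs1.dim E)"
  let ?P = "\<lambda>n. \<exists>D. fin_dim_subspace sX D \<and> n = nat (?b - score N j E D)"
  have "?P (nat (?b - score N j E {0}))" using vs2.fin_dim_zero by blast
  then obtain n where n: "?P n" "\<And>m. ?P m \<Longrightarrow> n \<le> m" using exists_least_iff[of ?P] by (metis not_le)
  then obtain D where D: "fin_dim_subspace sX D" "n = nat (?b - score N j E D)" by blast
  have "score N j E D' \<le> score N j E D" if D': "fin_dim_subspace sX D'" for D'
  proof -
    have "score N j E F \<le> ?b" if "fin_dim_subspace sX F" for F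
      using score_le[OF assms vs2.fin_dim_subspaceD[OF that], of N j]
      by (meson diff_le_eq le_add_same_cancel1 mult_nonneg_nonneg of_nat_0_le_iff order_trans)
    note this[OF D'] this[OF D(1)]
    moreover have "n \<le> nat (?b - score N j E D')" using D' by (intro n(2)) blast
    ultimately show ?thesis using D(2) by linarith
  qed
  then show thesis using that[of D] D(1) by (auto simp: optimal_def)
qed

text \<open>As D' is optimal, the intersection scores at most as much as D'; supermodularity then
  leaves the sum at least the score of D.\<close>

lemma optimal_sums:
  assumes E: "fin_dim_subspace sB E" and "optimal N j E D" "optimal N j E D'"
  shows "optimal N j E {x + y | x y. x \<in> D \<and> y \<in> D'}"
proof -
  have D: "fin_dim_subspace sX D" "fin_dim_subspace sX D'" using assms by (auto simp: optimal_def)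
  have S: "fin_dim_subspace sX {x + y | x y. x \<in> D \<and> y \<in> D'}" by (rule vs2.fin_dim_sums[OF D])
  have I: "fin_dim_subspace sX (D \<inter> D')"
    using vs2.fin_dim_mono(1)[OF D(1)] vs2.subspace_inter D vs2.fin_dim_subspaceD by simp
  have "score N j E (D \<inter> D') \<le> score N j E D'" using assms(3) I by (simp add: optimal_def)
  then have "score N j E D \<le> score N j E {x + y | x y. x \<in> D \<and> y \<in> D'}"
    using score_supermodular[OF E D, of N j] by simp
  then show ?thesis using assms(2) S unfolding optimal_def by (meson order_trans)
qed

text \<open>Optimality against the zero subspace gives j dim D \<le> N dim E, a bound on dim D since
  j \<ge> 1. An optimal D of greatest dimension absorbs any other by
  \<open>optimal_sums\<close>.\<close>

lemma max_optimal_exists: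
  assumes E: "fin_dim_subspace sB E" and j: "j \<ge> 1"
  obtains D where "max_optimal N j E D"
proof -
  obtain D0 where D0: "optimal N j E D0" using optimal_exists[OF E] .
  have bound: "vs2.dim D \<le> N * vs1.dim E" if D: "optimal N j E D" for D
  proof -
    have "0 \<le> score N j E {0}" by (simp add: score_def vs2.dim_zero)
    also have "\<dots> \<le> score N j E D" using D vs2.fin_dim_zero by (simp add: optimal_def)
    also have "\<dots> \<le> int N * int (vs1.dim E) - int j * int (vs2.dim D)"
      using score_le[OF E] D vs2.fin_dim_subspaceD by (auto simp: optimal_def)
    finally have "int j * int (vs2.dim D) \<le> int N * int (vs1.dim E)" by simp
    moreover have "1 * int (vs2.dim D) \<le> int j * int (vs2.dim D)" using j by (intro mult_right_mono) auto
    ultimately have "int (vs2.dim D) \<le> int (N * vs1.dim E)" by simp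
    then show ?thesis by (simp only: of_nat_le_iff)
  qed
  let ?P = "\<lambda>n. \<exists>D. optimal N j E D \<and> n = vs2.dim D"
  have P: "?P (vs2.dim D0)" using D0 by blast
  have bd: "\<And>n. ?P n \<Longrightarrow> n \<le> N * vs1.dim E" using bound by blast
  define n where "n = (GREATEST n. ?P n)"
  have "?P n" unfolding n_def by (rule GreatestI_nat[of ?P, OF P bd])
  then obtain D where D: "optimal N j E D" "n = vs2.dim D" by blast
  have max: "vs2.dim D' \<le> vs2.dim D" if "optimal N j E D'" for D'
  proof -
    have "?P (vs2.dim D')" using that by blast
    then have "vs2.dim D' \<le> n" unfolding n_def by (rule Greatest_le_nat[of ?P]) (rule bd)
    then show ?thesis using D(2) by simp
  qed
  have "D' \<subseteq> D" if D': "optimal N j E D'" for D'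
  proof -
    let ?S = "{x + y | x y. x \<in> D \<and> y \<in> D'}"
    have sD: "vs2.subspace D" "vs2.subspace D'"
      using D(1) D' vs2.fin_dim_subspaceD by (auto simp: optimal_def)
    have S: "optimal N j E ?S" by (rule optimal_sums[OF E D(1) D'])
    have "D = ?S"
      using vs2.fin_dim_eqI[OF _ sD(1) vs2.subspace_sums_upper(1)[OF sD] max[OF S]] S
      by (simp add: optimal_def)
    then show ?thesis using vs2.subspace_sums_upper(2)[OF sD] by simp
  qed
  then show thesis using that D(1) by (auto simp: max_optimal_def)
qed

section \<open>Scores of arbitrary subspaces of tuples\<close>

text \<open>For U = D^I this is the power of \<open>slice E D\<close>, but U may be any subspace of
  X^I, in particular one that mixes coordinates.\<close>

definition tslice :: "'i set \<Rightarrow> 'b set \<Rightarrow> ('i \<Rightarrow> 'x) set \<Rightarrow> ('i \<Rightarrow> 'b) set" where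
  "tslice I E U = {z \<in> tuples I E. \<forall>c\<in>\<C>. (\<lambda>i. c (z i)) \<in> U}"

definition tscore :: "nat \<Rightarrow> nat \<Rightarrow> 'i set \<Rightarrow> 'b set \<Rightarrow> ('i \<Rightarrow> 'x) set \<Rightarrow> int" where
  "tscore N j I E U = int N * int (vector_space.dim (tup_scale sB) (tslice I E U))
     - int j * int (vector_space.dim (tup_scale sX) U)"

lemma subspace_tslice:
  fixes I :: "'i set"
  assumes "vs1.subspace E" "module.subspace (tup_scale sX) U"
  shows "module.subspace (tup_scale sB) (tslice I E U)"
proof -
  interpret tB: vector_space "tup_scale sB :: 'k \<Rightarrow> ('i \<Rightarrow> 'b) \<Rightarrow> _" by (rule vector_space_tup_scale) (rule vs1.vector_space_axioms)
  interpret tX: vector_space "tup_scale sX :: 'k \<Rightarrow> ('i \<Rightarrow> 'x) \<Rightarrow> _" by (rule vector_space_tup_scale) (rule vs2.vector_space_axioms)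
  note tE = vs1.subspace_tuples[OF assms(1), of I]
  show ?thesis
  proof (rule tB.subspaceI)
    have "(\<lambda>i. c ((0 :: 'i \<Rightarrow> 'b) i)) \<in> U" if "c \<in> \<C>" for c
    proof -
      have "(\<lambda>i. c ((0 :: 'i \<Rightarrow> 'b) i)) = 0" using lin_zero[OF slicing_linear[OF that]] by auto
      then show ?thesis using tX.subspace_0[OF assms(2)] by simp
    qed
    then show "0 \<in> tslice I E U"
      using tB.subspace_0[OF tE] unfolding tslice_def by blast
  next
    fix x y assume xy: "x \<in> tslice I E U" "y \<in> tslice I E U"
    have "(\<lambda>i. c ((x + y) i)) \<in> U" if "c \<in> \<C>" for c
    proof -
      have "(\<lambda>i. c ((x + y) i)) = (\<lambda>i. c (x i)) + (\<lambda>i. c (y i))"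
        using lin_add[OF slicing_linear[OF that]] by auto
      then show ?thesis using xy that tX.subspace_add[OF assms(2)] by (simp add: tslice_def)
    qed
    then show "x + y \<in> tslice I E U"
      using xy tB.subspace_add[OF tE] unfolding tslice_def by blast
  next
    fix a x assume x: "x \<in> tslice I E U"
    have "(\<lambda>i. c (tup_scale sB a x i)) \<in> U" if "c \<in> \<C>" for c
    proof -
      have "(\<lambda>i. c (tup_scale sB a x i)) = tup_scale sX a (\<lambda>i. c (x i))"
        using lin_scale[OF slicing_linear[OF that]] by (auto simp: tup_scale_def)
      then show ?thesis using x that tX.subspace_scale[OF assms(2)] by (simp add: tslice_def)
    qed
    then show "tup_scale sB a x \<in> tslice I E U"
      using x tB.subspace_scale[OF tE] unfolding tslice_def by blast
  qed
qed

text \<open>Apply rank-nullity to the i-th coordinate. For U it is an exact count; for the slice,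
  image and kernel are merely contained in the slices belonging to the image and the kernel of U,
  which is the favourable direction.\<close>

lemma tscore_step:
  fixes I :: "'i set"
  assumes I: "finite I" "i \<notin> I" and E: "fin_dim_subspace sB E"
    and U: "fin_dim_subspace (tup_scale sX) U"
  shows "tscore N j (insert i I) E U \<le> score N j E ((\<lambda>u. u i) ` U) + tscore N j I E {u \<in> U. u i = 0}"
proof -
  interpret tB: vector_space "tup_scale sB :: 'k \<Rightarrow> ('i \<Rightarrow> 'b) \<Rightarrow> _" by (rule vector_space_tup_scale) (rule vs1.vector_space_axioms)
  interpret tX: vector_space "tup_scale sX :: 'k \<Rightarrow> ('i \<Rightarrow> 'x) \<Rightarrow> _" by (rule vector_space_tup_scale) (rule vs2.vector_space_axioms)
  interpret pB: vector_space_pair "tup_scale sB :: 'k \<Rightarrow> ('i \<Rightarrow> 'b) \<Rightarrow> _" sB ..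
  interpret pX: vector_space_pair "tup_scale sX :: 'k \<Rightarrow> ('i \<Rightarrow> 'x) \<Rightarrow> _" sX ..
  have lB: "Vector_Spaces.linear (tup_scale sB) sB (\<lambda>z. z i)"
    by (rule linear_tup_component) (rule vs1.vector_space_axioms)
  have lX: "Vector_Spaces.linear (tup_scale sX) sX (\<lambda>z. z i)"
    by (rule linear_tup_component) (rule vs2.vector_space_axioms)
  let ?V = "tslice (insert i I) E U" and ?U0 = "{u \<in> U. u i = 0}"
  have sE: "vs1.subspace E" using E by (rule vs1.fin_dim_subspaceD)
  have fin: "fin_dim_subspace (tup_scale sB) (tslice J E W)"
    if "finite J" "tX.subspace W" for J W
    by (rule tB.fin_dim_mono(1)[OF vs1.fin_dim_tuples(1)[OF that(1) E] subspace_tslice[OF sE that(2)]])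
      (auto simp: tslice_def)
  have V: "fin_dim_subspace (tup_scale sB) ?V"
    using fin I(1) tX.fin_dim_subspaceD[OF U] by simp
  have "(\<lambda>z. z i) ` ?V \<subseteq> slice E ((\<lambda>u. u i) ` U)"
  proof safe
    fix z assume z: "z \<in> ?V"
    have "c (z i) \<in> (\<lambda>u. u i) ` U" if "c \<in> \<C>" for c
      using z that by (auto simp: tslice_def intro!: image_eqI[of _ _ "\<lambda>i. c (z i)"])
    then show "z i \<in> slice E ((\<lambda>u. u i) ` U)" using z by (auto simp: slice_def tslice_def tuples_def)
  qed
  then have 1: "vs1.dim ((\<lambda>z. z i) ` ?V) \<le> vs1.dim (slice E ((\<lambda>u. u i) ` U))"
    using vs1.fin_dim_mono(2)[OF fin_dim_slice(1)[OF E]] pX.fin_dim_image[OF lX U]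
      vs1.fin_dim_subspaceD[OF pB.fin_dim_image[OF lB V]] vs2.fin_dim_subspaceD by simp
  have "{z \<in> ?V. z i = 0} \<subseteq> tslice I E ?U0"
  proof safe
    fix z assume z: "z \<in> ?V" "z i = 0"
    have "c (z i) = 0" if "c \<in> \<C>" for c using z(2) lin_zero[OF slicing_linear[OF that]] by simp
    moreover have "z \<in> tuples I E" using z by (force simp: tslice_def tuples_def)
    ultimately show "z \<in> tslice I E ?U0" using z(1) unfolding tslice_def by blast
  qed
  then have 2: "tB.dim {z \<in> ?V. z i = 0} \<le> tB.dim (tslice I E ?U0)"
    using tB.fin_dim_mono(2)[OF fin[OF I(1) pX.fin_dim_kernel(1)[OF lX U]]] pB.fin_dim_kernel(1)[OF lB V]
    by simp
  have "tB.dim ?V + 0 \<le> vs1.dim (slice E ((\<lambda>u. u i) ` U)) + tB.dim (tslice I E ?U0)"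
    using pB.rank_nullity[OF lB V] 1 2 by simp
  moreover have "vs2.dim ((\<lambda>u. u i) ` U) + tX.dim ?U0 = tX.dim U + 0"
    using pX.rank_nullity[OF lX U] by simp
  ultimately have "(int N * int (tB.dim ?V) - int j * int (tX.dim U)) + (int N * int 0 - int j * int 0)
      \<le> score N j E ((\<lambda>u. u i) ` U) + tscore N j I E ?U0"
    unfolding score_def tscore_def by (rule weighted_diff_mono)
  moreover have "int N * int 0 - int j * int 0 = 0" by simp
  ultimately show ?thesis by (simp only: tscore_def add_0_right)
qed

text \<open>By induction, each coordinate split off contributes at most the optimal score; so
  passing to tuples creates no better maximiser than D^I.\<close>

lemma tscore_le:
  fixes I :: "'i set"
  assumes "finite I" and E: "fin_dim_subspace sB E" and D: "optimal N j E D"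
    and "fin_dim_subspace (tup_scale sX) U" "U \<subseteq> tuples I UNIV"
  shows "tscore N j I E U \<le> int (card I) * score N j E D"
  using assms(1,4,5)
proof (induction I arbitrary: U)
  case empty
  interpret tB: vector_space "tup_scale sB :: 'k \<Rightarrow> ('i \<Rightarrow> 'b) \<Rightarrow> _" by (rule vector_space_tup_scale) (rule vs1.vector_space_axioms)
  have "tslice {} E U \<subseteq> {0}" by (auto simp: tslice_def tuples_def)
  then have "tB.dim (tslice {} E U) \<le> 0"
    using tB.dim_le_card[of "tslice {} E U" "{}"] by simp
  then show ?case by (simp add: tscore_def)
next
  case (insert i I)
  interpret tX: vector_space "tup_scale sX :: 'k \<Rightarrow> ('i \<Rightarrow> 'x) \<Rightarrow> _" by (rule vector_space_tup_scale) (rule vs2.vector_space_axioms)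
  interpret pX: vector_space_pair "tup_scale sX :: 'k \<Rightarrow> ('i \<Rightarrow> 'x) \<Rightarrow> _" sX ..
  have lX: "Vector_Spaces.linear (tup_scale sX) sX (\<lambda>z. z i)"
    by (rule linear_tup_component) (rule vs2.vector_space_axioms)
  have "score N j E ((\<lambda>u. u i) ` U) \<le> score N j E D"
    using D pX.fin_dim_image[OF lX insert.prems(1)] by (simp add: optimal_def)
  moreover have "{u \<in> U. u i = 0} \<subseteq> tuples I UNIV" using insert.prems(2) by (auto simp: tuples_def)
  then have "tscore N j I E {u \<in> U. u i = 0} \<le> int (card I) * score N j E D"
    by (rule insert.IH[OF pX.fin_dim_kernel(2)[OF lX insert.prems(1)]])
  ultimately show ?case
    using tscore_step[OF insert.hyps(1,2) E insert.prems(1), of N j] insert.hyps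
    by (simp add: algebra_simps)
qed

text \<open>When the bound is attained, splitting off coordinate i first leaves at most card I - 1
  optimal scores for the rest, so the i-th projection of U is itself optimal and lies in the largest
  maximiser.\<close>

lemma tscore_max:
  fixes I :: "'i set"
  assumes I: "finite I" and E: "fin_dim_subspace sB E" and D: "max_optimal N j E D"
    and U: "fin_dim_subspace (tup_scale sX) U" "U \<subseteq> tuples I UNIV"
    and ge: "tscore N j I E U \<ge> int (card I) * score N j E D"
    and u: "u \<in> U" and i: "i \<in> I"
  shows "u i \<in> D"
proof -
  interpret tX: vector_space "tup_scale sX :: 'k \<Rightarrow> ('i \<Rightarrow> 'x) \<Rightarrow> _" by (rule vector_space_tup_scale) (rule vs2.vector_space_axioms)
  interpret pX: vector_space_pair "tup_scale sX :: 'k \<Rightarrow> ('i \<Rightarrow> 'x) \<Rightarrow> _" sX ..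
  have lX: "Vector_Spaces.linear (tup_scale sX) sX (\<lambda>z. z i)"
    by (rule linear_tup_component) (rule vs2.vector_space_axioms)
  have opt: "optimal N j E D" using D by (simp add: max_optimal_def)
  have J: "insert i (I - {i}) = I" "finite (I - {i})" "i \<notin> I - {i}" using I i by auto
  have "{u \<in> U. u i = 0} \<subseteq> tuples (I - {i}) UNIV" using U(2) by (auto simp: tuples_def)
  then have 1: "tscore N j (I - {i}) E {u \<in> U. u i = 0} \<le> int (card (I - {i})) * score N j E D"
    by (rule tscore_le[OF J(2) E opt pX.fin_dim_kernel(2)[OF lX U(1)]])
  have card: "int (card I) = int (card (I - {i})) + 1" using card.remove[OF I i] by simp
  have "int (card I) * score N j E D \<le> score N j E ((\<lambda>u. u i) ` U) + tscore N j (I - {i}) E {u \<in> U. u i = 0}"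
    using ge tscore_step[OF J(2,3) E U(1), of N j] J(1) by simp
  then have "score N j E D \<le> score N j E ((\<lambda>u. u i) ` U)"
    using 1 unfolding card by (simp add: algebra_simps)
  moreover have "fin_dim_subspace sX ((\<lambda>u. u i) ` U)" by (rule pX.fin_dim_image[OF lX U(1)])
  ultimately have "optimal N j E ((\<lambda>u. u i) ` U)"
    using opt unfolding optimal_def by (meson order_trans)
  then show ?thesis using D u unfolding max_optimal_def by blast
qed

text \<open>The matrix form of "f maps level sets of E into level sets of E'". P acts on tuples over
  B and Q on tuples over X; \<open>PQ\<close> turns slices of P z into Q-images of slices of z, and
  \<open>QP\<close> is the reverse passage, which for coefficient matrices comes from the antipode.
  The proof is an exchange argument between the image of D^I and the power of D'.\<close>

lemma matrix_max_optimal: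
  fixes I :: "'i set"
  assumes I: "finite I" and E: "fin_dim_subspace sB E" and E': "fin_dim_subspace sB E'"
    and P: "\<And>i k. i \<in> I \<Longrightarrow> k \<in> I \<Longrightarrow> Vector_Spaces.linear sB sB (P i k)"
    and Q: "\<And>i k. i \<in> I \<Longrightarrow> k \<in> I \<Longrightarrow> Vector_Spaces.linear sX sX (Q i k)"
    and PE: "\<And>i k e. i \<in> I \<Longrightarrow> k \<in> I \<Longrightarrow> e \<in> E \<Longrightarrow> P i k e \<in> E'"
    and PQ: "\<And>c. c \<in> \<C> \<Longrightarrow> \<exists>d. (\<forall>k\<in>I. \<forall>l\<in>I. d k l \<in> \<C>) \<and>
        (\<forall>i\<in>I. \<forall>l\<in>I. \<forall>b. c (P i l b) = (\<Sum>k\<in>I. Q i k (d k l b)))"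
    and QP: "\<And>c i. c \<in> \<C> \<Longrightarrow> i \<in> I \<Longrightarrow> \<exists>d. (\<forall>k\<in>I. d k \<in> \<C>) \<and>
        (\<forall>l\<in>I. \<forall>b. Q i l (c b) = (\<Sum>k\<in>I. d k (P k l b)))"
    and D: "optimal N j E D" and D': "max_optimal N j E' D'"
    and il: "i \<in> I" "l \<in> I" and d: "d \<in> D"
  shows "Q i l d \<in> D'"
proof -
  interpret tB: vector_space "tup_scale sB :: 'k \<Rightarrow> ('i \<Rightarrow> 'b) \<Rightarrow> _" by (rule vector_space_tup_scale) (rule vs1.vector_space_axioms)
  interpret tX: vector_space "tup_scale sX :: 'k \<Rightarrow> ('i \<Rightarrow> 'x) \<Rightarrow> _" by (rule vector_space_tup_scale) (rule vs2.vector_space_axioms)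
  interpret pB: vector_space_pair "tup_scale sB :: 'k \<Rightarrow> ('i \<Rightarrow> 'b) \<Rightarrow> _" "tup_scale sB :: 'k \<Rightarrow> ('i \<Rightarrow> 'b) \<Rightarrow> _" ..
  interpret pX: vector_space_pair "tup_scale sX :: 'k \<Rightarrow> ('i \<Rightarrow> 'x) \<Rightarrow> _" "tup_scale sX :: 'k \<Rightarrow> ('i \<Rightarrow> 'x) \<Rightarrow> _" ..
  let ?T = "tup_matrix I P" and ?TX = "tup_matrix I Q"
  let ?Z = "tuples I (slice E D)" and ?W = "tuples I (slice E' D')"
  let ?DX = "tuples I D" and ?WX = "tuples I D'"
  \<comment> \<open>\<open>?U\<close> and \<open>?R\<close> are the sum of Q(D^I) with D'^I and the
    part of D^I that Q sends into D'^I; \<open>?V\<close> and \<open>?K\<close> are the same two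
    constructions for P and the powers of the slices.\<close>
  let ?U = "{x + y | x y. x \<in> ?TX ` ?DX \<and> y \<in> ?WX}" and ?V = "{x + y | x y. x \<in> ?T ` ?Z \<and> y \<in> ?W}"
  let ?R = "{x \<in> ?DX. ?TX x \<in> ?WX}" and ?K = "{z \<in> ?Z. ?T z \<in> ?W}"
  have lT: "Vector_Spaces.linear (tup_scale sB) (tup_scale sB) ?T"
    by (rule linear_tup_matrix[OF vs1.vector_space_axioms vs1.vector_space_axioms P])
  have lTX: "Vector_Spaces.linear (tup_scale sX) (tup_scale sX) ?TX"
    by (rule linear_tup_matrix[OF vs2.vector_space_axioms vs2.vector_space_axioms Q])
  have fD: "fin_dim_subspace sX D" using D by (simp add: optimal_def)
  have fD': "fin_dim_subspace sX D'" using D' by (simp add: max_optimal_def optimal_def)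
  have sD: "vs2.subspace D" "vs2.subspace D'" using fD fD' vs2.fin_dim_subspaceD by auto
  have sE': "vs1.subspace E'" using E' vs1.fin_dim_subspaceD by auto
  note fZ = vs1.fin_dim_tuples[OF I fin_dim_slice(1)[OF E sD(1)]]
  note fW = vs1.fin_dim_tuples[OF I fin_dim_slice(1)[OF E' sD(2)]]
  note fDX = vs2.fin_dim_tuples[OF I fD]
  note fWX = vs2.fin_dim_tuples[OF I fD']
  note dimV = pB.dim_image_sums[OF lT fZ(1) fW(1)]
  note dimU = pX.dim_image_sums[OF lTX fDX(1) fWX(1)]
  have fU: "fin_dim_subspace (tup_scale sX) ?U" by (rule tX.fin_dim_sums[OF pX.fin_dim_image[OF lTX fDX(1)] fWX(1)])
  have fV: "fin_dim_subspace (tup_scale sB) ?V" by (rule tB.fin_dim_sums[OF pB.fin_dim_image[OF lT fZ(1)] fW(1)])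
  have fR: "fin_dim_subspace (tup_scale sX) ?R"
  proof (rule tX.fin_dim_mono(1)[OF fDX(1)])
    have "?R = ?DX \<inter> {x. ?TX x \<in> ?WX}" by auto
    then show "tX.subspace ?R"
      using tX.subspace_inter[OF tX.fin_dim_subspaceD[OF fDX(1)] pX.linear_subspace_linear_preimage[OF lTX tX.fin_dim_subspaceD[OF fWX(1)]]]
      by simp
  qed auto
  have fts: "fin_dim_subspace (tup_scale sB) (tslice I F S)"
    if "fin_dim_subspace sB F" "fin_dim_subspace (tup_scale sX) S" for F S
    by (rule tB.fin_dim_mono(1)[OF vs1.fin_dim_tuples(1)[OF I that(1)]
          subspace_tslice[OF vs1.fin_dim_subspaceD[OF that(1)] tX.fin_dim_subspaceD[OF that(2)]]])
      (auto simp: tslice_def)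
  \<comment> \<open>This inclusion rests on \<open>PQ\<close>: a slice of P z + y is Q w plus a
    slice of y.\<close>
  have "?V \<subseteq> tslice I E' ?U"
  proof safe
    fix z y assume z: "z \<in> ?Z" and y: "y \<in> ?W"
    have yE: "y \<in> tuples I E'" using y by (auto simp: tuples_def slice_def)
    have "?T z i \<in> E'" if "i \<in> I" for i
      using that z PE by (auto simp: tup_matrix_def tuples_def slice_def intro!: vs1.subspace_sum[OF sE'])
    then have zE: "?T z \<in> tuples I E'" by (auto simp: tuples_def tup_matrix_def)
    have "(\<lambda>i. c ((?T z + y) i)) \<in> ?U" if c: "c \<in> \<C>" for c
    proof -
      have lc: "Vector_Spaces.linear sB sX c" by (rule slicing_linear[OF c])
      obtain d where d: "\<And>k l. k \<in> I \<Longrightarrow> l \<in> I \<Longrightarrow> d k l \<in> \<C>"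
          "\<And>i l b. i \<in> I \<Longrightarrow> l \<in> I \<Longrightarrow> c (P i l b) = (\<Sum>k\<in>I. Q i k (d k l b))"
        using PQ[OF c] by blast
      define w where "w = (\<lambda>k. if k \<in> I then \<Sum>l\<in>I. d k l (z l) else 0)"
      have "w \<in> ?DX"
        using z d(1) by (auto simp: w_def tuples_def slice_def intro!: vs2.subspace_sum[OF sD(1)])
      moreover have "(\<lambda>i. c (y i)) \<in> ?WX"
        using y c lin_zero[OF lc] by (auto simp: tuples_def slice_def)
      moreover have "(\<lambda>i. c ((?T z + y) i)) = ?TX w + (\<lambda>i. c (y i))"
      proof
        fix i
        have "c (?T z i) = ?TX w i"
        proof (cases "i \<in> I")
          case True
          have "c (?T z i) = (\<Sum>l\<in>I. c (P i l (z l)))"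
            using True by (simp add: tup_matrix_def lin_sum[OF lc])
          also have "\<dots> = (\<Sum>l\<in>I. \<Sum>k\<in>I. Q i k (d k l (z l)))"
            using d(2) True by (intro sum.cong) auto
          also have "\<dots> = (\<Sum>k\<in>I. \<Sum>l\<in>I. Q i k (d k l (z l)))" by (rule sum.swap)
          also have "\<dots> = ?TX w i"
            using True by (auto simp: tup_matrix_def w_def lin_sum[OF Q[OF True]] intro!: sum.cong)
          finally show ?thesis .
        qed (simp add: tup_matrix_def lin_zero[OF lc])
        then show "c ((?T z + y) i) = (?TX w + (\<lambda>i. c (y i))) i" by (simp add: lin_add[OF lc])
      qed
      ultimately show ?thesis by blast
    qed
    moreover have "?T z + y \<in> tuples I E'"
      using tB.subspace_add[OF vs1.subspace_tuples[OF sE'] zE yE] .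
    ultimately show "?T z + y \<in> tslice I E' ?U" unfolding tslice_def by blast
  qed
  then have V: "tB.dim ?V \<le> tB.dim (tslice I E' ?U)"
    using tB.fin_dim_mono(2)[OF fts[OF E' fU] tB.fin_dim_subspaceD[OF fV]] by simp
  \<comment> \<open>This inclusion rests on \<open>QP\<close>: Q applied to a slice of z is a sum of
    slices of P z, and these lie in D'.\<close>
  have "?K \<subseteq> tslice I E ?R"
  proof safe
    fix z assume z: "z \<in> ?Z" "?T z \<in> ?W"
    have "(\<lambda>i. c (z i)) \<in> ?R" if c: "c \<in> \<C>" for c
    proof -
      have lc: "Vector_Spaces.linear sB sX c" by (rule slicing_linear[OF c])
      have "(\<Sum>l\<in>I. Q i l (c (z l))) \<in> D'" if i: "i \<in> I" for i
      proof -
        obtain d where d: "\<And>k. k \<in> I \<Longrightarrow> d k \<in> \<C>"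
            "\<And>l b. l \<in> I \<Longrightarrow> Q i l (c b) = (\<Sum>k\<in>I. d k (P k l b))"
          using QP[OF c i] by blast
        have "(\<Sum>l\<in>I. Q i l (c (z l))) = (\<Sum>l\<in>I. \<Sum>k\<in>I. d k (P k l (z l)))"
          using d(2) by (intro sum.cong) auto
        also have "\<dots> = (\<Sum>k\<in>I. \<Sum>l\<in>I. d k (P k l (z l)))" by (rule sum.swap)
        also have "\<dots> = (\<Sum>k\<in>I. d k (?T z k))"
          by (intro sum.cong) (simp_all add: tup_matrix_def lin_sum[OF slicing_linear[OF d(1)]])
        also have "\<dots> \<in> D'"
          using z(2) d(1) by (intro vs2.subspace_sum[OF sD(2)]) (auto simp: tuples_def slice_def)
        finally show ?thesis .
      qed
      then have "?TX (\<lambda>i. c (z i)) \<in> ?WX" by (auto simp: tuples_def tup_matrix_def)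
      moreover have "(\<lambda>i. c (z i)) \<in> ?DX"
        using z(1) c lin_zero[OF lc] by (auto simp: tuples_def slice_def)
      ultimately show ?thesis by blast
    qed
    moreover have "z \<in> tuples I E" using z(1) by (auto simp: tuples_def slice_def)
    ultimately show "z \<in> tslice I E ?R" unfolding tslice_def by blast
  qed
  moreover have "tB.subspace ?K"
  proof -
    have "?K = ?Z \<inter> {x. ?T x \<in> ?W}" by auto
    then show ?thesis
      using tB.subspace_inter[OF tB.fin_dim_subspaceD[OF fZ(1)] pB.linear_subspace_linear_preimage[OF lT tB.fin_dim_subspaceD[OF fW(1)]]]
      by simp
  qed
  ultimately have K: "tB.dim ?K \<le> tB.dim (tslice I E ?R)"
    using tB.fin_dim_mono(2)[OF fts[OF E fR]] by simp
  have "?R \<subseteq> tuples I UNIV" by (auto simp: tuples_def)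
  then have R: "tscore N j I E ?R \<le> int (card I) * score N j E D"
    by (rule tscore_le[OF I E D fR])
  \<comment> \<open>By the two exact dimension counts, \<open>?R\<close> and \<open>?U\<close>
    together score at least card I times the two optimal scores. As \<open>?R\<close> cannot exceed
    the optimum for E, \<open>?U\<close> reaches the one for E'.\<close>
  have "tscore N j I E' ?U \<ge> int (card I) * score N j E' D'"
  proof -
    have a: "int (tB.dim ?V) + int (tB.dim ?K) = int (card I) * (int (vs1.dim (slice E D)) + int (vs1.dim (slice E' D')))"
      using dimV unfolding fZ(2) fW(2) by (simp add: algebra_simps flip: of_nat_add of_nat_mult)
    have b: "int (tX.dim ?U) + int (tX.dim ?R) = int (card I) * (int (vs2.dim D) + int (vs2.dim D'))"
      using dimU unfolding fDX(2) fWX(2) by (simp add: algebra_simps flip: of_nat_add of_nat_mult)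
    have "int N * (int (tB.dim ?V) + int (tB.dim ?K)) - int j * (int (tX.dim ?U) + int (tX.dim ?R))
        = int (card I) * (score N j E D + score N j E' D')"
      unfolding a b score_def by (simp add: algebra_simps)
    moreover have "int N * int (tB.dim ?V) \<le> int N * int (tB.dim (tslice I E' ?U))"
      "int N * int (tB.dim ?K) \<le> int N * int (tB.dim (tslice I E ?R))"
      using V K by (auto intro: mult_left_mono)
    ultimately have "int (card I) * (score N j E D + score N j E' D') \<le> tscore N j I E ?R + tscore N j I E' ?U"
      unfolding tscore_def by (simp add: algebra_simps)
    then show ?thesis using R by (simp add: algebra_simps)
  qed
  moreover have "?U \<subseteq> tuples I UNIV" by (auto simp: tuples_def tup_matrix_def)
  ultimately have max: "u i \<in> D'" if "u \<in> ?U" for u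
    using tscore_max[OF I E' D' fU] that il(1) by blast
  \<comment> \<open>The tuple with d in slot l isolates the single entry
    \<open>Q i l d\<close>.\<close>
  have "tup_single l d \<in> ?DX"
    using il(2) d vs2.subspace_0[OF sD(1)] by (auto simp: tuples_def tup_single_def)
  then have "?TX (tup_single l d) + 0 \<in> ?U" using tX.subspace_0[OF tX.fin_dim_subspaceD[OF fWX(1)]] by blast
  then have "?TX (tup_single l d) i \<in> D'" using max by fastforce
  then show ?thesis using tup_matrix_single[OF I il, of Q d] lin_zero[OF Q] by simp
qed

text \<open>A discrete form of \<open>dim E = \<integral> dim D\<^sub>\<lambda> d\<lambda>\<close>, where \<open>D\<^sub>\<lambda>\<close> maximises
  \<open>dim (slice E D) - \<lambda> dim D\<close> and \<open>\<lambda>\<close> runs through the multiples of \<open>1/N\<close>.\<close>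

lemma max_optimal_telescope:
  assumes E: "fin_dim_subspace sB E" and E': "fin_dim_subspace sB E'"
    and inj: "\<And>e. e \<in> E \<Longrightarrow> \<forall>c\<in>\<C>. c e = 0 \<Longrightarrow> e = 0"
    and Df: "fin_dim_subspace sX Df" "slice E Df = E"
    and \<kappa>: "\<kappa> \<ge> (0::real)"
    and hyp: "\<And>j D D'. 1 \<le> j \<Longrightarrow> max_optimal N j E D \<Longrightarrow> max_optimal N j E' D' \<Longrightarrow>
        \<kappa> * real (vs2.dim D) \<le> real (vs2.dim D')"
  shows "\<kappa> * (real N * real (vs1.dim E) - real (vs2.dim Df)) \<le> real N * real (vs1.dim E')"
proof -
  have "\<exists>D. \<forall>j\<ge>1. max_optimal N j F (D j)" if "fin_dim_subspace sB F" for F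
    by (rule exI[of _ "\<lambda>j. SOME D. max_optimal N j F D"]) (metis max_optimal_exists[OF that] someI)
  then obtain D D' where D: "\<And>j. j \<ge> 1 \<Longrightarrow> max_optimal N j E (D j)"
    and D': "\<And>j. j \<ge> 1 \<Longrightarrow> max_optimal N j E' (D' j)"
    using E E' by metis
  define M where "M j = real_of_int (score N j E (D j))" for j
  \<comment> \<open>At j = 0 a largest maximiser need not exist; the value is replaced by the upper
    bound N dim E' of all scores.\<close>
  define M' where "M' j = (if j = 0 then real N * real (vs1.dim E') else real_of_int (score N j E' (D' j)))" for j
  have fD: "fin_dim_subspace sX (D j)" "fin_dim_subspace sX (D' j)" if "j \<ge> 1" for j
    using D[OF that] D'[OF that] by (auto simp: max_optimal_def optimal_def)
  have opt: "real_of_int (score N j E F) \<le> M j" if "j \<ge> 1" "fin_dim_subspace sX F" for j F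
    using D[OF that(1)] that(2) by (simp add: M_def max_optimal_def optimal_def)
  have opt': "real_of_int (score N j E' F) \<le> M' j" if "fin_dim_subspace sX F" for j F
  proof (cases "j = 0")
    case True
    have "score N j E' F \<le> int N * int (vs1.dim E')"
      using score_le[OF E' vs2.fin_dim_subspaceD[OF that], of N j] True by simp
    then have "real_of_int (score N j E' F) \<le> real_of_int (int N * int (vs1.dim E'))"
      by (simp only: of_int_le_iff)
    then show ?thesis using True by (simp add: M'_def)
  next
    case False
    then show ?thesis using D'[of j] that by (simp add: M'_def max_optimal_def optimal_def)
  qed
  \<comment> \<open>Testing D_j at parameter j+1 bounds the drop of \<open>M\<close> from j to j+1
    by dim D_j. Testing D'_j at j-1 shows that \<open>M'\<close> drops by at least dim D'_j from j-1
    to j. The two sums are thus offset by one, which is why \<open>M 1\<close> appears on the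
    left.\<close>
  have step: "\<kappa> * (M 1 - M (Suc j)) \<le> real N * real (vs1.dim E') - M' j" for j
  proof (induction j)
    case 0
    then show ?case by (simp add: M'_def)
  next
    case (Suc j)
    have "M (Suc j) - M (Suc (Suc j)) \<le> real (vs2.dim (D (Suc j)))"
      using opt[of "Suc (Suc j)" "D (Suc j)"] fD(1)[of "Suc j"]
      by (simp add: M_def score_def algebra_simps)
    then have "\<kappa> * (M (Suc j) - M (Suc (Suc j))) \<le> \<kappa> * real (vs2.dim (D (Suc j)))"
      using \<kappa> by (rule mult_left_mono)
    also have "\<dots> \<le> real (vs2.dim (D' (Suc j)))"
      using hyp[of "Suc j"] D D' by simp
    also have "\<dots> \<le> M' j - M' (Suc j)"
      using opt'[of "D' (Suc j)" j] fD(2)[of "Suc j"] by (simp add: M'_def score_def algebra_simps split: if_splits)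
    finally show ?case using Suc.IH by (simp add: algebra_simps)
  qed
  \<comment> \<open>Once j exceeds N dim E, a nonzero D has negative score, while the zero subspace
    scores 0; so the telescoping sum may stop here.\<close>
  let ?J = "N * vs1.dim E"
  have "M (Suc ?J) \<le> 0"
  proof (cases "vs2.dim (D (Suc ?J)) = 0")
    case True
    then have "D (Suc ?J) = {0}" using vs2.fin_dim_eq_zero fD by simp
    moreover have "slice E {0} \<subseteq> {0}" using inj by (auto simp: slice_def)
    then have "vs1.dim (slice E {0}) \<le> 0" using vs1.dim_le_card[of "slice E {0}" "{}"] by simp
    ultimately show ?thesis using True by (simp add: M_def score_def)
  next
    case False
    have "score N (Suc ?J) E (D (Suc ?J)) \<le> int ?J - int (Suc ?J) * int (vs2.dim (D (Suc ?J)))"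
      using score_le[OF E vs2.fin_dim_subspaceD, of "D (Suc ?J)" N "Suc ?J"] fD by simp
    also have "\<dots> \<le> int ?J - int (Suc ?J) * 1"
      using False by (intro diff_left_mono mult_left_mono) auto
    finally show ?thesis by (simp add: M_def)
  qed
  moreover have "M' ?J \<ge> 0"
    using opt'[OF vs2.fin_dim_zero, of ?J] by (simp add: score_def vs2.dim_zero)
      (meson mult_nonneg_nonneg of_nat_0_le_iff order_trans)
  \<comment> \<open>\<open>Df\<close> contains every slice of E, so at j = 1 it costs only dim Df, a
    loss that does not grow with N.\<close>
  moreover have "real N * real (vs1.dim E) - real (vs2.dim Df) \<le> M 1"
    using opt[of 1 Df] Df by (simp add: score_def)
  then have "\<kappa> * (real N * real (vs1.dim E) - real (vs2.dim Df)) \<le> \<kappa> * M 1"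
    using \<kappa> by (rule mult_left_mono)
  moreover have "\<kappa> * M (Suc ?J) \<le> 0" using \<kappa> calculation(1) by (simp add: mult_nonneg_nonpos)
  ultimately show ?thesis using step[of ?J] by (simp add: right_diff_distrib)
qed

text \<open>If no parameter worked, the telescoped inequality would hold for every N. Its left-over
  term \<kappa> dim Df is constant, so a large N contradicts \<open>less\<close>.\<close>

lemma max_optimal_small_growth:
  assumes E: "fin_dim_subspace sB E" and E': "fin_dim_subspace sB E'"
    and inj: "\<And>e. e \<in> E \<Longrightarrow> \<forall>c\<in>\<C>. c e = 0 \<Longrightarrow> e = 0"
    and Df: "fin_dim_subspace sX Df" "slice E Df = E"
    and \<kappa>: "\<kappa> \<ge> (0::real)" and less: "real (vs1.dim E') < \<kappa> * real (vs1.dim E)"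
  obtains N j D D' where "1 \<le> j" "max_optimal N j E D" "max_optimal N j E' D'"
    "real (vs2.dim D') < \<kappa> * real (vs2.dim D)"
proof -
  have "\<exists>N j D D'. 1 \<le> j \<and> max_optimal N j E D \<and> max_optimal N j E' D' \<and>
      real (vs2.dim D') < \<kappa> * real (vs2.dim D)"
  proof (rule ccontr)
    assume "\<not> ?thesis"
    then have "\<kappa> * (real N * real (vs1.dim E) - real (vs2.dim Df)) \<le> real N * real (vs1.dim E')" for N
      by (intro max_optimal_telescope[OF E E' inj Df \<kappa>]) (auto simp: not_less)
    then have "real N * (\<kappa> * real (vs1.dim E) - real (vs1.dim E')) \<le> \<kappa> * real (vs2.dim Df)" for N
      by (simp add: algebra_simps)
    then show False
      using ex_less_of_nat_mult[of "\<kappa> * real (vs1.dim E) - real (vs1.dim E')" "\<kappa> * real (vs2.dim Df)"] less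
      by (meson diff_gt_0_iff_gt not_less)
  qed
  then show thesis using that by blast
qed

end

section \<open>Tensor products and comatrices\<close>

lemma lookup_free_scale: "Poly_Mapping.lookup (free_scale c p) x = c * Poly_Mapping.lookup p x"
  by (simp add: free_scale_def Poly_Mapping.map.rep_eq when_def)

lemma vector_space_free_scale: "vector_space (free_scale :: 'k::field \<Rightarrow> ('x \<Rightarrow>\<^sub>0 'k) \<Rightarrow> _)"
  by unfold_locales
    (auto intro!: poly_mapping_eqI simp: lookup_free_scale lookup_add algebra_simps)

lemma keys_free_scale: "Poly_Mapping.keys (free_scale c p) \<subseteq> Poly_Mapping.keys p"
  by (auto simp: in_keys_iff lookup_free_scale)

lemma keys_lin_ext_free:
  "Poly_Mapping.keys (lin_ext free_scale g p) \<subseteq> (\<Union>x\<in>Poly_Mapping.keys p. Poly_Mapping.keys (g x))"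
proof -
  have "Poly_Mapping.keys (lin_ext free_scale g p)
      \<subseteq> (\<Union>x\<in>Poly_Mapping.keys p. Poly_Mapping.keys (free_scale (Poly_Mapping.lookup p x) (g x)))"
    unfolding lin_ext_def by (rule Poly_Mapping.keys_sum)
  also have "\<dots> \<subseteq> (\<Union>x\<in>Poly_Mapping.keys p. Poly_Mapping.keys (g x))"
    by (intro UN_mono keys_free_scale) simp
  finally show ?thesis .
qed

context vector_space
begin

lemma lin_ext_superset:
  assumes "finite K" "Poly_Mapping.keys p \<subseteq> K"
  shows "lin_ext scale f p = (\<Sum>x\<in>K. scale (Poly_Mapping.lookup p x) (f x))"
  unfolding lin_ext_def using assms by (intro sum.mono_neutral_left) (auto simp: in_keys_iff)

lemma linear_lin_ext: "Vector_Spaces.linear free_scale scale (lin_ext scale f)"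
proof (rule linI[OF vector_space_free_scale vector_space_axioms])
  fix p q :: "'c \<Rightarrow>\<^sub>0 'a"
  let ?K = "Poly_Mapping.keys p \<union> Poly_Mapping.keys q"
  have "Poly_Mapping.keys (p + q) \<subseteq> ?K" by (rule Poly_Mapping.keys_add)
  then show "lin_ext scale f (p + q) = lin_ext scale f p + lin_ext scale f q"
    by (simp add: lin_ext_superset[of ?K] lookup_add scale_left_distrib sum.distrib)
next
  fix c and p :: "'c \<Rightarrow>\<^sub>0 'a"
  show "lin_ext scale f (free_scale c p) = scale c (lin_ext scale f p)"
    using lin_ext_superset[OF finite_keys keys_free_scale[of c p], of f]
    by (simp add: lookup_free_scale scale_sum_right lin_ext_def)
qed

lemma lin_ext_single: "lin_ext scale f (Poly_Mapping.single x c) = scale c (f x)"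
  using lin_ext_superset[of "{x}" "Poly_Mapping.single x c" f] by simp

lemma lin_ext_comp:
  "lin_ext scale f (lin_ext free_scale g p) = lin_ext scale (\<lambda>x. lin_ext scale f (g x)) p"
  by (simp add: lin_ext_def[of free_scale] lin_ext_def[of scale "\<lambda>x. lin_ext scale f (g x)"]
      lin_sum[OF linear_lin_ext] lin_scale[OF linear_lin_ext])

lemma lin_ext_fun_add: "lin_ext scale (\<lambda>x. f x + g x) p = lin_ext scale f p + lin_ext scale g p"
  by (simp add: lin_ext_def scale_right_distrib sum.distrib)

lemma lin_ext_fun_diff: "lin_ext scale (\<lambda>x. f x - g x) p = lin_ext scale f p - lin_ext scale g p"
  by (simp add: lin_ext_def scale_right_diff_distrib sum_subtractf)

lemma lin_ext_fun_scale: "lin_ext scale (\<lambda>x. scale c (f x)) p = scale c (lin_ext scale f p)"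
  by (simp add: lin_ext_def scale_sum_right mult.commute)

lemma lin_ext_fun_sum: "lin_ext scale (\<lambda>x. \<Sum>i\<in>I. f i x) p = (\<Sum>i\<in>I. lin_ext scale (f i) p)"
  unfolding lin_ext_def scale_sum_right by (rule sum.swap)

end

lemma lin_ext_out:
  assumes "Vector_Spaces.linear t u h"
  shows "h (lin_ext t f p) = lin_ext u (\<lambda>x. h (f x)) p"
  by (simp add: lin_ext_def lin_sum[OF assms] lin_scale[OF assms])

section \<open>Bilinear maps and the universal property of the tensor product\<close>

definition bilinear_map ::
  "('k::field \<Rightarrow> 'a::ab_group_add \<Rightarrow> 'a) \<Rightarrow> ('k \<Rightarrow> 'b::ab_group_add \<Rightarrow> 'b) \<Rightarrow> ('k \<Rightarrow> 'c::ab_group_add \<Rightarrow> 'c)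
    \<Rightarrow> ('a \<Rightarrow> 'b \<Rightarrow> 'c) \<Rightarrow> bool" where
  "bilinear_map s1 s2 t \<beta> \<longleftrightarrow>
     (\<forall>y. Vector_Spaces.linear s1 t (\<lambda>x. \<beta> x y)) \<and> (\<forall>x. Vector_Spaces.linear s2 t (\<beta> x))"

lemma bilinear_mapD:
  assumes "bilinear_map s1 s2 t \<beta>"
  shows "Vector_Spaces.linear s1 t (\<lambda>x. \<beta> x y)" "Vector_Spaces.linear s2 t (\<beta> x)"
    "Vector_Spaces.linear s2 t (\<lambda>y. \<beta> x y)"
  using assms by (auto simp: bilinear_map_def)

lemma bilinear_map_compose:
  assumes "bilinear_map s1 s2 t \<beta>" "Vector_Spaces.linear r1 s1 f" "Vector_Spaces.linear r2 s2 g"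
  shows "bilinear_map r1 r2 t (\<lambda>x y. \<beta> (f x) (g y))"
  unfolding bilinear_map_def
  using lin_compose[OF assms(2) bilinear_mapD(1)[OF assms(1)]]
    lin_compose[OF assms(3) bilinear_mapD(2)[OF assms(1)]] by simp

lemma bilinear_map_flip: "bilinear_map s1 s2 t \<beta> \<Longrightarrow> bilinear_map s2 s1 t (\<lambda>x y. \<beta> y x)"
  by (simp add: bilinear_map_def)

lemma (in vector_space) bilinear_map_scale:
  "bilinear_map (*) scale scale (\<lambda>c x. scale c x)"
  unfolding bilinear_map_def
  by (auto intro!: linI vector_space_self vector_space_axioms simp: scale_left_distrib scale_right_distrib scale_left_commute)

lemmas field_lin_ext_single = vector_space.lin_ext_single[OF vector_space_self]
  and field_linear_lin_ext = vector_space.linear_lin_ext[OF vector_space_self]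
  and field_lin_ext_add = vector_space.lin_ext_fun_add[OF vector_space_self]
  and field_lin_ext_diff = vector_space.lin_ext_fun_diff[OF vector_space_self]
  and field_lin_ext_scale = vector_space.lin_ext_fun_scale[OF vector_space_self]
  and field_bilinear_map_mult = vector_space.bilinear_map_scale[OF vector_space_self]

lemma (in k_algebra) bilinear_map_mult: "bilinear_map scale scale scale (\<lambda>x y. x * y)"
  unfolding bilinear_map_def
  by (auto intro!: linI vector_space_axioms simp: scale_mult_left scale_mult_right distrib_left distrib_right)

lemma (in k_algebra) linear_mult:
  "Vector_Spaces.linear scale scale (\<lambda>x. x * y)" "Vector_Spaces.linear scale scale (\<lambda>x. y * x)"
  using bilinear_mapD[OF bilinear_map_mult] by auto

lemma lin_ident: "vector_space s \<Longrightarrow> Vector_Spaces.linear s s (\<lambda>x. x)"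
  by (rule linI) auto

text \<open>The value of the linear map induced by \<beta> on a representative:
  \<open>tev t \<beta> (comult b)\<close> is \<beta>(b_1, b_2) in Sweedler notation.\<close>

abbreviation tev :: "('k::field \<Rightarrow> 'v::ab_group_add \<Rightarrow> 'v) \<Rightarrow> ('x \<Rightarrow> 'y \<Rightarrow> 'v) \<Rightarrow> ('x \<times> 'y \<Rightarrow>\<^sub>0 'k) \<Rightarrow> 'v" where
  "tev t \<beta> \<equiv> lin_ext t (\<lambda>(x, y). \<beta> x y)"

abbreviation tev3 :: "('k::field \<Rightarrow> 'v::ab_group_add \<Rightarrow> 'v) \<Rightarrow> ('x \<Rightarrow> 'y \<Rightarrow> 'z \<Rightarrow> 'v) \<Rightarrow> ('x \<times> 'y \<times> 'z \<Rightarrow>\<^sub>0 'k) \<Rightarrow> 'v" where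
  "tev3 t \<beta> \<equiv> lin_ext t (\<lambda>(x, y, z). \<beta> x y z)"

lemma tev_tensor_map:
  assumes "vector_space t"
  shows "tev t \<beta> (tensor_map f g p) = tev t (\<lambda>x y. \<beta> (f x) (g y)) p"
proof -
  interpret vector_space t by fact
  show ?thesis
    unfolding tensor_map_def lin_ext_comp by (auto simp: lin_ext_single intro!: arg_cong2[of _ _ _ _ "lin_ext t"])
qed

lemma tev_tensor_flip:
  assumes "vector_space t"
  shows "tev t \<beta> (tensor_flip p) = tev t (\<lambda>x y. \<beta> y x) p"
proof -
  interpret vector_space t by fact
  show ?thesis
    unfolding tensor_flip_def lin_ext_comp by (auto simp: lin_ext_single intro!: arg_cong2[of _ _ _ _ "lin_ext t"])
qed

lemma tev_tensor_mult:
  assumes "vector_space t"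
  shows "tev t \<beta> (tensor_mult p q) = tev t (\<lambda>x y. tev t (\<lambda>x' y'. \<beta> (x * x') (y * y')) q) p"
proof -
  interpret vector_space t by fact
  show ?thesis
    unfolding tensor_mult_def lin_ext_comp
    by (auto simp: lin_ext_comp lin_ext_single split_def)
qed

lemma tev3_comult:
  assumes "vector_space t"
  shows "tev3 t \<beta> (comult_left \<Delta> p) = tev t (\<lambda>x y. tev t (\<lambda>a b. \<beta> a b y) (\<Delta> x)) p"
    and "tev3 t \<beta> (comult_right \<Delta> p) = tev t (\<lambda>x y. tev t (\<lambda>a b. \<beta> x a b) (\<Delta> y)) p"
proof -
  interpret vector_space t by fact
  show "tev3 t \<beta> (comult_left \<Delta> p) = tev t (\<lambda>x y. tev t (\<lambda>a b. \<beta> a b y) (\<Delta> x)) p"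
    and "tev3 t \<beta> (comult_right \<Delta> p) = tev t (\<lambda>x y. tev t (\<lambda>a b. \<beta> x a b) (\<Delta> y)) p"
    unfolding comult_left_def comult_right_def lin_ext_comp
    by (auto simp: lin_ext_comp lin_ext_single split_def)
qed

lemma tensor_eq_tev:
  assumes eq: "tensor_eq s1 s2 p q" and \<beta>: "bilinear_map s1 s2 t \<beta>"
  shows "tev t \<beta> p = tev t \<beta> q"
proof -
  have t: "vector_space t" using bilinear_mapD(1)[OF \<beta>] by (rule linear_vector_space)
  interpret t: vector_space t by fact
  let ?h = "tev t \<beta>"
  have lin: "Vector_Spaces.linear free_scale t ?h" by (rule t.linear_lin_ext)
  have "?h (p - q) = 0"
    using eq unfolding tensor_eq_def tensor_rels_def
  proof (rule module_hom.eq_0_on_span[OF lin[unfolded linear_iff_module_hom], rotated])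
    note b = lin_add[OF bilinear_mapD(1)[OF \<beta>]] lin_add[OF bilinear_mapD(2)[OF \<beta>]]
      lin_scale[OF bilinear_mapD(1)[OF \<beta>]] lin_scale[OF bilinear_mapD(2)[OF \<beta>]]
    fix x assume "x \<in> {basis_vec (x + x', y) - basis_vec (x, y) - basis_vec (x', y) | x x' y. True} \<union>
      {basis_vec (x, y + y') - basis_vec (x, y) - basis_vec (x, y') | x y y'. True} \<union>
      {basis_vec (s1 c x, y) - free_scale c (basis_vec (x, y)) | c x y. True} \<union>
      {basis_vec (x, s2 c y) - free_scale c (basis_vec (x, y)) | c x y. True}"
    then show "?h x = 0"
      by (auto simp: lin_diff[OF lin] lin_scale[OF lin] t.lin_ext_single b)
  qed
  then show ?thesis by (simp add: lin_diff[OF lin])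
qed

text \<open>If p - q were not a relation, a functional on the free space would kill all relations
  but not p - q, and its values on basis pairs form a bilinear form. Hence scalar bilinear forms
  suffice for every tensor identity.\<close>

lemma tensor_eqI:
  assumes s: "vector_space s1" "vector_space s2"
    and eq: "\<And>\<beta>. bilinear_map s1 s2 (*) \<beta> \<Longrightarrow> tev (*) \<beta> p = tev (*) \<beta> q"
  shows "tensor_eq s1 s2 p q"
proof (rule ccontr)
  interpret f: vector_space "free_scale :: 'a \<Rightarrow> ('b \<times> 'c \<Rightarrow>\<^sub>0 'a) \<Rightarrow> _" by (rule vector_space_free_scale)
  assume "\<not> ?thesis"
  then have "p - q \<notin> tensor_rels s1 s2" by (simp add: tensor_eq_def)
  moreover have "f.subspace (tensor_rels s1 s2)" unfolding tensor_rels_def by (rule f.subspace_span)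
  ultimately obtain h where h: "Vector_Spaces.linear free_scale (*) h"
      "\<And>d. d \<in> tensor_rels s1 s2 \<Longrightarrow> h d = 0" "h (p - q) \<noteq> 0"
    using f.separating_functional by blast
  define \<beta> where "\<beta> x y = h (basis_vec (x, y))" for x y
  have rel: "h x = h y" if "x - y \<in> tensor_rels s1 s2" for x y
    using h(2)[OF that] by (simp add: lin_diff[OF h(1)])
  have "h (basis_vec (x + x', y)) = h (basis_vec (x, y) + basis_vec (x', y))" for x x' y
    by (rule rel, unfold tensor_rels_def diff_diff_eq[symmetric], rule f.span_base, blast)
  moreover have "h (basis_vec (x, y + y')) = h (basis_vec (x, y) + basis_vec (x, y'))" for x y y'
    by (rule rel, unfold tensor_rels_def diff_diff_eq[symmetric], rule f.span_base, blast)
  moreover have "h (basis_vec (s1 c x, y)) = h (free_scale c (basis_vec (x, y)))" for c x y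
    by (rule rel, unfold tensor_rels_def, rule f.span_base, blast)
  moreover have "h (basis_vec (x, s2 c y)) = h (free_scale c (basis_vec (x, y)))" for c x y
    by (rule rel, unfold tensor_rels_def, rule f.span_base, blast)
  ultimately have "bilinear_map s1 s2 (*) \<beta>"
    unfolding bilinear_map_def \<beta>_def
    by (auto intro!: linI s vector_space_self simp: lin_add[OF h(1)] lin_scale[OF h(1)])
  moreover have "h r = tev (*) \<beta> r" for r
  proof -
    have "r = lin_ext free_scale basis_vec r"
      by (rule poly_mapping_eqI)
        (simp add: lin_ext_def lookup_sum lookup_free_scale lookup_single when_def in_keys_iff
          sum.delta'[OF finite_keys] if_distrib cong: if_cong)
    then have "h r = h (lin_ext free_scale basis_vec r)" by simp
    also have "\<dots> = tev (*) \<beta> r"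
      unfolding lin_ext_out[OF h(1)] \<beta>_def by (simp add: split_def)
    finally show ?thesis .
  qed
  ultimately show False using eq h(3) by (simp add: lin_diff[OF field_linear_lin_ext])
qed

lemma tensor3_eq_tev3:
  assumes eq: "tensor3_eq s p q"
    and \<beta>: "\<And>y z. Vector_Spaces.linear s t (\<lambda>x. \<beta> x y z)" "\<And>x z. Vector_Spaces.linear s t (\<lambda>y. \<beta> x y z)"
      "\<And>x y. Vector_Spaces.linear s t (\<lambda>z. \<beta> x y z)"
  shows "tev3 t \<beta> p = tev3 t \<beta> q"
proof -
  have t: "vector_space t" using \<beta>(1) by (rule linear_vector_space)
  interpret t: vector_space t by fact
  let ?h = "tev3 t \<beta>"
  have lin: "Vector_Spaces.linear free_scale t ?h" by (rule t.linear_lin_ext)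
  have "?h (p - q) = 0"
    using eq unfolding tensor3_eq_def tensor3_rels_def
  proof (rule module_hom.eq_0_on_span[OF lin[unfolded linear_iff_module_hom], rotated])
    note b = lin_add[OF \<beta>(1)] lin_add[OF \<beta>(2)] lin_add[OF \<beta>(3)]
      lin_scale[OF \<beta>(1)] lin_scale[OF \<beta>(2)] lin_scale[OF \<beta>(3)]
    fix x assume "x \<in> {basis_vec (x + x', y, z) - basis_vec (x, y, z) - basis_vec (x', y, z) | x x' y z. True} \<union>
      {basis_vec (x, y + y', z) - basis_vec (x, y, z) - basis_vec (x, y', z) | x y y' z. True} \<union>
      {basis_vec (x, y, z + z') - basis_vec (x, y, z) - basis_vec (x, y, z') | x y z z'. True} \<union>
      {basis_vec (s c x, y, z) - free_scale c (basis_vec (x, y, z)) | c x y z. True} \<union>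
      {basis_vec (x, s c y, z) - free_scale c (basis_vec (x, y, z)) | c x y z. True} \<union>
      {basis_vec (x, y, s c z) - free_scale c (basis_vec (x, y, z)) | c x y z. True}"
    then show "?h x = 0"
      by (auto simp: lin_diff[OF lin] lin_scale[OF lin] t.lin_ext_single b)
  qed
  then show ?thesis by (simp add: lin_diff[OF lin])
qed

lemma (in vector_space) dual_basis_expansion:
  assumes "finite Bs"
    and h: "\<And>b. Vector_Spaces.linear scale (*) (h b)" "\<And>b b'. b' \<in> Bs \<Longrightarrow> h b b' = (if b = b' then 1 else 0)"
    and y: "y \<in> span Bs"
  shows "y = (\<Sum>b\<in>Bs. scale (h b y) b)"
proof -
  obtain c where c: "y = (\<Sum>b\<in>Bs. scale (c b) b)" using y span_finite[OF assms(1)] by auto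
  have "h b y = c b" if "b \<in> Bs" for b
  proof -
    have "h b y = (\<Sum>b'\<in>Bs. c b' * h b b')"
      unfolding c by (simp add: lin_sum[OF h(1)] lin_scale[OF h(1)])
    also have "\<dots> = (\<Sum>b'\<in>Bs. if b = b' then c b else 0)"
      using h(2) by (intro sum.cong) auto
    finally show ?thesis using assms(1) that by simp
  qed
  then show ?thesis unfolding c by (intro sum.cong) auto
qed

text \<open>If all slices \<open>(id \<otimes> \<psi>) p\<close> lie in \<open>D\<close>, then \<open>p \<in> D \<otimes> W\<close>.\<close>

lemma tev_slice_zero:
  assumes s: "vector_space s1" "vector_space s2"
    and slices: "\<And>\<psi>. Vector_Spaces.linear s2 (*) \<psi> \<Longrightarrow> tev s1 (\<lambda>x y. s1 (\<psi> y) x) p \<in> D"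
    and \<gamma>: "bilinear_map s1 s2 t \<gamma>" "\<And>d y. d \<in> D \<Longrightarrow> \<gamma> d y = 0"
  shows "tev t \<gamma> p = 0"
proof -
  interpret s1: vector_space s1 by fact
  interpret s2: vector_space s2 by fact
  interpret t: vector_space t by (rule linear_vector_space(2)[OF bilinear_mapD(1)[OF \<gamma>(1)]])
  let ?Y = "snd ` Poly_Mapping.keys p"
  obtain Bs where Bs: "Bs \<subseteq> ?Y" "s2.independent Bs" "?Y \<subseteq> s2.span Bs"
    using s2.maximal_independent_subset[of ?Y] by blast
  have fin: "finite Bs" using finite_subset[OF Bs(1)] by simp
  obtain h where h: "\<And>b. Vector_Spaces.linear s2 (*) (h b)"
      "\<And>b b'. b' \<in> Bs \<Longrightarrow> h b b' = (if b = b' then 1 else 0)"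
    using s2.dual_basis[OF Bs(2)] by blast
  \<comment> \<open>Expanding the second factors in a finite basis writes p as the sum of its slices
    tensored with the basis vectors b.\<close>
  have exp: "\<gamma> x y = (\<Sum>b\<in>Bs. \<gamma> (s1 (h b y) x) b)" if "(x, y) \<in> Poly_Mapping.keys p" for x y
  proof -
    have "y \<in> s2.span Bs" using that Bs(3) by force
    then have "\<gamma> x y = \<gamma> x (\<Sum>b\<in>Bs. s2 (h b y) b)"
      using s2.dual_basis_expansion[OF fin h, of y] by simp
    then show ?thesis
      by (simp add: lin_sum[OF bilinear_mapD(2)[OF \<gamma>(1)]] lin_scale[OF bilinear_mapD(2)[OF \<gamma>(1)]]
          lin_scale[OF bilinear_mapD(1)[OF \<gamma>(1)]])
  qed
  have "tev t \<gamma> p = tev t (\<lambda>x y. \<Sum>b\<in>Bs. \<gamma> (s1 (h b y) x) b) p"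
    unfolding lin_ext_def using exp by (intro sum.cong) auto
  also have "\<dots> = (\<Sum>b\<in>Bs. tev t (\<lambda>x y. \<gamma> (s1 (h b y) x) b) p)"
    by (simp add: split_def t.lin_ext_fun_sum)
  also have "\<dots> = (\<Sum>b\<in>Bs. \<gamma> (tev s1 (\<lambda>x y. s1 (h b y) x) p) b)"
    by (simp add: lin_ext_out[OF bilinear_mapD(1)[OF \<gamma>(1)]] split_def)
  also have "\<dots> = 0" using slices[OF h(1)] \<gamma>(2) by simp
  finally show ?thesis .
qed

section \<open>Slices and coefficient matrices in a coalgebra\<close>

context coalgebra
begin

text \<open>\<open>comult\<close> is linear only modulo the tensor relations; composing it with a
  bilinear evaluation gives an honest linear map.\<close>

lemma linear_tev_comult:
  assumes "bilinear_map scale scale t \<beta>"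
  shows "Vector_Spaces.linear scale t (\<lambda>x. tev t \<beta> (comult x))"
proof -
  have t: "vector_space t" using bilinear_mapD(1)[OF assms] by (rule linear_vector_space)
  interpret t: vector_space t by fact
  show ?thesis
    by (rule linI[OF vector_space_axioms t])
      (simp_all add: tensor_eq_tev[OF comult_add assms] tensor_eq_tev[OF comult_scale assms]
        lin_add[OF t.linear_lin_ext] lin_scale[OF t.linear_lin_ext])
qed

lemma tev_coassoc:
  assumes "\<And>y z. Vector_Spaces.linear scale t (\<lambda>x. \<beta> x y z)" "\<And>x z. Vector_Spaces.linear scale t (\<lambda>y. \<beta> x y z)"
    "\<And>x y. Vector_Spaces.linear scale t (\<lambda>z. \<beta> x y z)"
  shows "tev t (\<lambda>x y. tev t (\<lambda>a b. \<beta> a b y) (comult x)) (comult v)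
    = tev t (\<lambda>x y. tev t (\<lambda>a b. \<beta> x a b) (comult y)) (comult v)"
proof -
  have "vector_space t" using assms(1) by (rule linear_vector_space)
  from tev3_comult[OF this] show ?thesis
    using tensor3_eq_tev3[OF coassoc assms] by metis
qed

lemma slice_bilinear:
  assumes "Vector_Spaces.linear scale (*) \<psi>"
  shows "bilinear_map scale scale scale (\<lambda>x y. scale (\<psi> y) x)"
    and "bilinear_map scale scale scale (\<lambda>x y. scale (\<psi> x) y)"
  using bilinear_map_compose[OF bilinear_map_scale assms lin_ident[OF vector_space_axioms]]
  by (auto dest: bilinear_map_flip)

text \<open>The slices place \<Delta> x in both D \<otimes> V and V \<otimes> D, whose intersection
  is D \<otimes> D. With a projection P onto D this is the splitting of id - P \<otimes> P into (id
  - P) \<otimes> id and P \<otimes> (id - P), each of which kills \<Delta> x.\<close>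

lemma subcoalgebraI:
  assumes D: "subspace D"
    and slices: "\<And>x \<psi>. x \<in> D \<Longrightarrow> Vector_Spaces.linear scale (*) \<psi> \<Longrightarrow> tev scale (\<lambda>x y. scale (\<psi> y) x) (comult x) \<in> D"
      "\<And>x \<psi>. x \<in> D \<Longrightarrow> Vector_Spaces.linear scale (*) \<psi> \<Longrightarrow> tev scale (\<lambda>x y. scale (\<psi> x) y) (comult x) \<in> D"
  shows "subcoalgebra scale comult D"
  unfolding subcoalgebra_def
proof (intro conjI ballI D)
  fix x assume x: "x \<in> D"
  obtain P where P: "Vector_Spaces.linear scale scale P" "\<And>x. P x \<in> D" "\<And>d. d \<in> D \<Longrightarrow> P d = d"
    using projection_exists[OF D] by blast
  let ?p = "tensor_map P P (comult x)"
  note vs = vector_space_axioms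
  have PI: "Vector_Spaces.linear scale scale (\<lambda>x. x - P x)"
    by (rule linI[OF vs vs]) (simp_all add: lin_add[OF P(1)] lin_scale[OF P(1)] scale_right_diff_distrib)
  have "Poly_Mapping.keys ?p \<subseteq> D \<times> D"
    unfolding tensor_map_def using P(2) by (intro order.trans[OF keys_lin_ext_free]) auto
  moreover have "tensor_eq scale scale (comult x) ?p"
  proof (rule tensor_eqI[OF vs vs])
    fix \<beta> :: "'a \<Rightarrow> 'a \<Rightarrow> 'k" assume \<beta>: "bilinear_map scale scale (*) \<beta>"
    have "tev (*) (\<lambda>a b. \<beta> (a - P a) b) (comult x) = 0"
      by (rule tev_slice_zero[OF vs vs slices(1)[OF x] bilinear_map_compose[OF \<beta> PI lin_ident[OF vs]]])
        (simp_all add: P(3) lin_zero[OF bilinear_mapD(1)[OF \<beta>]])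
    moreover have "tev (*) (\<lambda>b a. \<beta> (P a) (b - P b)) (tensor_flip (comult x)) = 0"
      by (rule tev_slice_zero[OF vs vs _ bilinear_map_flip[OF bilinear_map_compose[OF \<beta> P(1) PI]], where D = D])
        (simp_all add: P(3) tev_tensor_flip[OF vs] slices(2)[OF x] lin_zero[OF bilinear_mapD(2)[OF \<beta>]])
    ultimately have "tev (*) (\<lambda>a b. \<beta> (a - P a) b + \<beta> (P a) (b - P b)) (comult x) = 0"
      by (simp only: tev_tensor_flip[OF vector_space_self]) (simp add: split_def field_lin_ext_add)
    then have "tev (*) (\<lambda>a b. \<beta> a b - \<beta> (P a) (P b)) (comult x) = 0"
      by (simp add: lin_diff[OF bilinear_mapD(1)[OF \<beta>]] lin_diff[OF bilinear_mapD(2)[OF \<beta>]])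
    then show "tev (*) \<beta> (comult x) = tev (*) \<beta> ?p"
      by (simp only: tev_tensor_map[OF vector_space_self]) (simp add: split_def field_lin_ext_diff)
  qed
  ultimately show "\<exists>p. Poly_Mapping.keys p \<subseteq> D \<times> D \<and> tensor_eq scale scale (comult x) p" by blast
qed

text \<open>The coefficient matrix of a finite-dimensional comodule. Every finite set lies in the span of
  such a matrix, so computations in Sweedler notation become computations with finite matrices.\<close>

definition comatrix :: "nat \<Rightarrow> (nat \<Rightarrow> nat \<Rightarrow> 'a) \<Rightarrow> bool" where
  "comatrix n m \<longleftrightarrow> (\<forall>i<n. \<forall>j<n.
     tensor_eq scale scale (comult (m i j)) (\<Sum>k<n. basis_vec (m i k, m k j)) \<and>
     counit (m i j) = (if i = j then 1 else 0))"

lemma tev_comatrix: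
  assumes "comatrix n m" "i < n" "j < n" and \<beta>: "bilinear_map scale scale t \<beta>"
  shows "tev t \<beta> (comult (m i j)) = (\<Sum>k<n. \<beta> (m i k) (m k j))"
proof -
  have t: "vector_space t" using bilinear_mapD(1)[OF \<beta>] by (rule linear_vector_space)
  interpret t: vector_space t by fact
  have "tev t \<beta> (comult (m i j)) = tev t \<beta> (\<Sum>k<n. basis_vec (m i k, m k j))"
    using assms by (intro tensor_eq_tev[OF _ \<beta>]) (simp add: comatrix_def)
  then show ?thesis by (simp add: lin_sum[OF t.linear_lin_ext] t.lin_ext_single)
qed

lemma counit_comatrix: "comatrix n m \<Longrightarrow> i < n \<Longrightarrow> j < n \<Longrightarrow> counit (m i j) = (if i = j then 1 else 0)"
  by (simp add: comatrix_def)

text \<open>The finiteness theorem for comodules: X generates a finite-dimensional right subcomodule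
  V, and the coefficients of V in a basis form the matrix.\<close>

lemma comatrix_exists:
  assumes "finite X"
  obtains n m where "comatrix n m" "X \<subseteq> span {m i j | i j. i < n \<and> j < n}"
proof -
  note vs = vector_space_axioms
  let ?L = "Vector_Spaces.linear scale ((*) :: 'k \<Rightarrow> _)"
  define R where "R \<psi> x = tev scale (\<lambda>x y. scale (\<psi> y) x) (comult x)" for \<psi> x
  have linR: "Vector_Spaces.linear scale scale (R \<psi>)" if "?L \<psi>" for \<psi>
    unfolding R_def by (rule linear_tev_comult[OF slice_bilinear(1)[OF that]])
  \<comment> \<open>All slices x_1 \<psi>(x_2). They span a finite-dimensional space because each
    \<Delta> x has finitely many terms, and the slice by the counit is x itself.\<close>
  define V where "V = span {R \<psi> x | \<psi> x. ?L \<psi> \<and> x \<in> X}"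
  have XV: "x \<in> V" if "x \<in> X" for x
    unfolding V_def using counit_linear counit_right[of x] that
    by (intro span_base) (auto simp: R_def intro!: exI[of _ counit] exI[of _ x])
  have V: "fin_dim_subspace scale V"
  proof -
    let ?G = "fst ` (\<Union>x\<in>X. Poly_Mapping.keys (comult x))"
    have "R \<psi> x \<in> span ?G" if "x \<in> X" for \<psi> x
      unfolding R_def lin_ext_def
    proof (intro span_sum span_scale)
      fix z assume "z \<in> Poly_Mapping.keys (comult x)"
      then have "fst z \<in> ?G" using that by blast
      then show "(case z of (a, b) \<Rightarrow> scale (\<psi> b) a) \<in> span ?G"
        unfolding split_def by (intro span_scale span_base)
    qed
    then have "V \<subseteq> span ?G" unfolding V_def by (intro span_minimal) auto
    then show ?thesis
      using fin_dim_mono(1)[OF fin_dim_span[of ?G], of V] assms by (simp add: V_def)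
  qed
  have RV: "R \<psi> v \<in> V" if \<psi>: "?L \<psi>" and v: "v \<in> V" for \<psi> v
  proof -
    have "R \<psi> (R \<chi> x) \<in> V" if \<chi>: "?L \<chi>" and x: "x \<in> X" for \<chi> x
    proof -
      \<comment> \<open>The convolution product of \<psi> and \<chi>; by coassociativity, slicing
        twice is slicing once by it.\<close>
      let ?\<phi> = "\<lambda>b. tev (*) (\<lambda>u v. \<psi> u * \<chi> v) (comult b)"
      have \<phi>: "?L ?\<phi>"
        by (rule linear_tev_comult[OF bilinear_map_compose[OF field_bilinear_map_mult \<psi> \<chi>]])
      have "R \<psi> (R \<chi> x) = tev scale (\<lambda>u v. scale (\<chi> v) (R \<psi> u)) (comult x)"
        unfolding R_def[of \<chi>] lin_ext_out[OF linR[OF \<psi>]] by (simp add: split_def lin_scale[OF linR[OF \<psi>]])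
      also have "\<dots> = tev scale (\<lambda>u v. tev scale (\<lambda>a b. scale (\<chi> v * \<psi> b) a) (comult u)) (comult x)"
        unfolding R_def by (simp only: split_def scale_scale[symmetric] lin_ext_fun_scale)
      also have "\<dots> = tev scale (\<lambda>u v. tev scale (\<lambda>a b. scale (\<chi> b * \<psi> a) u) (comult v)) (comult x)"
        by (rule tev_coassoc[where \<beta> = "\<lambda>a b v. scale (\<chi> v * \<psi> b) a"]; rule linI[OF vs vs])
          (simp_all add: lin_add[OF \<chi>] lin_add[OF \<psi>] lin_scale[OF \<chi>] lin_scale[OF \<psi>]
            scale_left_distrib scale_right_distrib distrib_left distrib_right mult_ac)
      also have "\<dots> = R ?\<phi> x"
      proof -
        have "scale (lin_ext (*) f p) u = lin_ext scale (\<lambda>z. scale (f z) u) p" for f :: "'a \<times> 'a \<Rightarrow> 'k" and p u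
          by (rule lin_ext_out[OF bilinear_mapD(1)[OF bilinear_map_scale]])
        then show ?thesis unfolding R_def by (simp add: split_def mult.commute)
      qed
      also have "\<dots> \<in> V" unfolding V_def using \<phi> x by (intro span_base) blast
      finally show ?thesis .
    qed
    then have "R \<psi> ` {R \<psi> x | \<psi> x. ?L \<psi> \<and> x \<in> X} \<subseteq> V" by auto
    then have "span (R \<psi> ` {R \<psi> x | \<psi> x. ?L \<psi> \<and> x \<in> X}) \<subseteq> V"
      by (rule span_minimal) (simp add: V_def)
    then have "R \<psi> ` V \<subseteq> V"
      unfolding V_def module_hom.span_image[OF linR[OF \<psi>, unfolded linear_iff_module_hom]] .
    then show ?thesis using v by blast
  qed
  obtain Bs where Bs: "finite Bs" "independent Bs" "span Bs = V" "card Bs = dim V"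
    using fin_dim_basis[OF V] .
  obtain h where h: "\<And>b. ?L (h b)" "\<And>b b'. b' \<in> Bs \<Longrightarrow> h b b' = (if b = b' then 1 else 0)"
    using dual_basis[OF Bs(2)] by blast
  define n where "n = card Bs"
  obtain e where e: "bij_betw e {..<n} Bs"
    using ex_bij_betw_nat_finite[OF Bs(1)] unfolding n_def atLeast0LessThan by blast
  have eV: "e i \<in> V" if "i < n" for i
    using e that unfolding Bs(3)[symmetric] by (intro span_base) (auto simp: bij_betw_def)
  have he: "h (e i) (e j) = (if i = j then 1 else 0)" if "i < n" "j < n" for i j
    using h(2)[of "e j" "e i"] that e by (auto simp: bij_betw_def inj_on_def)
  \<comment> \<open>The coefficients in \<Delta> e_j = sum_i e_i \<otimes> m_ij, which exist because
    V contains all right slices of its elements.\<close>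
  define m where "m i j = tev scale (\<lambda>x y. scale (h (e i) x) y) (comult (e j))" for i j
  have proj: "v = (\<Sum>i<n. scale (h (e i) v) (e i))" if "v \<in> V" for v
    using dual_basis_expansion[OF Bs(1) h, of v] Bs(3) that
      sum.reindex_bij_betw[OF e, of "\<lambda>b. scale (h b v) b"] by simp
  have coact: "tev t \<beta> (comult (e j)) = (\<Sum>i<n. \<beta> (e i) (m i j))"
    if \<beta>: "bilinear_map scale scale t \<beta>" and j: "j < n" for t :: "'k \<Rightarrow> 't::ab_group_add \<Rightarrow> 't" and \<beta> j
  proof -
    interpret t: vector_space t by (rule linear_vector_space(2)[OF bilinear_mapD(1)[OF \<beta>]])
    let ?P = "\<lambda>x. \<Sum>i<n. scale (h (e i) x) (e i)"
    have lin: "Vector_Spaces.linear scale scale (\<lambda>x. x - ?P x)"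
      by (rule linI[OF vs vs])
        (simp_all add: lin_add[OF h(1)] lin_scale[OF h(1)] scale_left_distrib sum.distrib
          scale_right_diff_distrib scale_sum_right)
    have "tev t (\<lambda>x y. \<beta> (x - ?P x) y) (comult (e j)) = 0"
    proof (rule tev_slice_zero[OF vs vs _ bilinear_map_compose[OF \<beta> lin lin_ident[OF vs]]])
      show "tev scale (\<lambda>x y. scale (\<psi> y) x) (comult (e j)) \<in> V" if "?L \<psi>" for \<psi>
        using RV[OF that eV[OF j]] by (simp add: R_def)
      show "\<beta> (d - ?P d) y = 0" if "d \<in> V" for d y
        using proj[OF that] by (simp add: lin_zero[OF bilinear_mapD(1)[OF \<beta>]])
    qed
    then have "tev t \<beta> (comult (e j)) = tev t (\<lambda>x y. \<beta> (?P x) y) (comult (e j))"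
      by (simp add: lin_diff[OF bilinear_mapD(1)[OF \<beta>]] split_def t.lin_ext_fun_diff)
    also have "\<dots> = tev t (\<lambda>x y. \<Sum>i<n. \<beta> (e i) (scale (h (e i) x) y)) (comult (e j))"
      by (simp add: lin_sum[OF bilinear_mapD(1)[OF \<beta>]] lin_scale[OF bilinear_mapD(1)[OF \<beta>]]
          lin_scale[OF bilinear_mapD(2)[OF \<beta>]])
    also have "\<dots> = (\<Sum>i<n. \<beta> (e i) (m i j))"
      unfolding m_def lin_ext_out[OF bilinear_mapD(2)[OF \<beta>]] by (simp add: split_def t.lin_ext_fun_sum)
    finally show ?thesis .
  qed
  have "comatrix n m"
    unfolding comatrix_def
  proof (intro allI impI conjI)
    fix i j assume ij: "i < n" "j < n"
    show "tensor_eq scale scale (comult (m i j)) (\<Sum>k<n. basis_vec (m i k, m k j))"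
    proof (rule tensor_eqI[OF vs vs])
      fix \<beta> :: "'a \<Rightarrow> 'a \<Rightarrow> 'k" assume \<beta>: "bilinear_map scale scale (*) \<beta>"
      note l = linear_tev_comult[OF \<beta>]
      have hb: "bilinear_map scale scale (*) (\<lambda>x y. h (e i) x * \<beta> y z)" for z
        by (rule bilinear_map_compose[OF field_bilinear_map_mult h(1) bilinear_mapD(1)[OF \<beta>]])
      have "tev (*) \<beta> (comult (m i j)) = tev (*) (\<lambda>x y. h (e i) x * tev (*) \<beta> (comult y)) (comult (e j))"
        unfolding m_def lin_ext_out[OF l]
        by (intro arg_cong2[where f = "lin_ext (*)"] ext refl) (simp add: lin_scale[OF l] split: prod.split)
      also have "\<dots> = tev (*) (\<lambda>x y. tev (*) (\<lambda>a b. h (e i) x * \<beta> a b) (comult y)) (comult (e j))"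
        by (simp add: split_def field_lin_ext_scale)
      also have "\<dots> = tev (*) (\<lambda>x y. tev (*) (\<lambda>a b. h (e i) a * \<beta> b y) (comult x)) (comult (e j))"
        by (rule tev_coassoc[where \<beta> = "\<lambda>x a b. h (e i) x * \<beta> a b", symmetric]; rule linI[OF vs vector_space_self])
          (simp_all add: lin_add[OF h(1)] lin_scale[OF h(1)]
            lin_add[OF bilinear_mapD(1)[OF \<beta>]] lin_scale[OF bilinear_mapD(1)[OF \<beta>]]
            lin_add[OF bilinear_mapD(2)[OF \<beta>]] lin_scale[OF bilinear_mapD(2)[OF \<beta>]] distrib_left distrib_right mult_ac)
      also have "\<dots> = (\<Sum>k<n. tev (*) (\<lambda>a b. h (e i) a * \<beta> b (m k j)) (comult (e k)))"
      proof (rule coact[OF _ ij(2)])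
        show "bilinear_map scale scale (*) (\<lambda>x y. tev (*) (\<lambda>a b. h (e i) a * \<beta> b y) (comult x))"
          unfolding bilinear_map_def
        proof (intro conjI allI)
          show "Vector_Spaces.linear scale (*) (\<lambda>x. tev (*) (\<lambda>a b. h (e i) a * \<beta> b y) (comult x))" for y
            by (rule linear_tev_comult[OF hb])
          show "Vector_Spaces.linear scale (*) (\<lambda>y. tev (*) (\<lambda>a b. h (e i) a * \<beta> b y) (comult x))" for x
            by (rule linI[OF vs vector_space_self])
              (simp_all add: lin_add[OF bilinear_mapD(2)[OF \<beta>]] lin_scale[OF bilinear_mapD(2)[OF \<beta>]]
                distrib_left split_def field_lin_ext_add mult.left_commute field_lin_ext_scale)
        qed
      qed
      also have "\<dots> = (\<Sum>k<n. \<Sum>l<n. h (e i) (e l) * \<beta> (m l k) (m k j))"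
        by (intro sum.cong refl coact[OF hb]) simp
      also have "\<dots> = (\<Sum>k<n. \<Sum>l<n. if i = l then \<beta> (m i k) (m k j) else 0)"
        using he[OF ij(1)] by (intro sum.cong refl) auto
      also have "\<dots> = (\<Sum>k<n. \<beta> (m i k) (m k j))" using ij by simp
      finally show "tev (*) \<beta> (comult (m i j)) = tev (*) \<beta> (\<Sum>k<n. basis_vec (m i k, m k j))"
        by (simp add: lin_sum[OF field_linear_lin_ext] field_lin_ext_single)
    qed
    have "counit (m i j) = tev (*) (\<lambda>x y. h (e i) x * counit y) (comult (e j))"
      unfolding m_def lin_ext_out[OF counit_linear] by (simp add: split_def lin_scale[OF counit_linear])
    also have "\<dots> = h (e i) (tev scale (\<lambda>x y. scale (counit y) x) (comult (e j)))"
      unfolding lin_ext_out[OF h(1)] by (simp add: split_def lin_scale[OF h(1)] mult.commute)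
    also have "\<dots> = (if i = j then 1 else 0)" using he[OF ij] by (simp add: counit_right)
    finally show "counit (m i j) = (if i = j then 1 else 0)" .
  qed
  moreover have "X \<subseteq> span {m i j | i j. i < n \<and> j < n}"
  proof
    fix x assume "x \<in> X"
    \<comment> \<open>Applying the counit to the first factor of \<Delta> e_j recovers e_j from
      column j, so the entries span at least V.\<close>
    have "e j \<in> span {m i j | i j. i < n \<and> j < n}" if "j < n" for j
    proof -
      have "e j = (\<Sum>i<n. scale (counit (e i)) (m i j))"
        using coact[OF slice_bilinear(2)[OF counit_linear] that] counit_left[of "e j"] by simp
      moreover have "\<dots> \<in> span {m i j | i j. i < n \<and> j < n}"
        using that by (intro span_sum span_scale span_base) auto
      ultimately show ?thesis by simp
    qed
    then have "(\<Sum>i<n. scale (h (e i) x) (e i)) \<in> span {m i j | i j. i < n \<and> j < n}"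
      by (intro span_sum span_scale) auto
    then show "x \<in> span {m i j | i j. i < n \<and> j < n}" using proj[OF XV[OF \<open>x \<in> X\<close>]] by simp
  qed
  ultimately show thesis by (rule that)
qed

text \<open>Every element is a linear combination of entries of some coefficient matrix; this is how
  identities in Sweedler notation are reduced to matrices.\<close>

lemma linear_eq_comatrix:
  assumes f: "Vector_Spaces.linear scale t f" "Vector_Spaces.linear scale t g"
    and eq: "\<And>n m i j. comatrix n m \<Longrightarrow> i < n \<Longrightarrow> j < n \<Longrightarrow> f (m i j) = g (m i j)"
  shows "f x = g x"
proof -
  obtain n m where m: "comatrix n m" "{x} \<subseteq> span {m i j | i j. i < n \<and> j < n}"
    using comatrix_exists[of "{x}"] by blast
  have "vector_space t" using f(1) by (rule linear_vector_space)
  interpret vector_space_pair scale t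
    by (intro vector_space_pair.intro vector_space_axioms) fact
  show ?thesis
    using linear_eq_on[OF f, of x "{m i j | i j. i < n \<and> j < n}"] m eq by blast
qed

end

lemma coalgebra_map_linear: "coalgebra_map s \<Delta> \<epsilon> s' \<Delta>' \<epsilon>' f \<Longrightarrow> Vector_Spaces.linear s s' f"
  by (simp add: coalgebra_map_def)

lemma coalgebra_map_comatrix:
  assumes "coalgebra s \<Delta> \<epsilon>" "coalgebra s' \<Delta>' \<epsilon>'" and f: "coalgebra_map s \<Delta> \<epsilon> s' \<Delta>' \<epsilon>' f"
    and m: "coalgebra.comatrix s \<Delta> \<epsilon> n m"
  shows "coalgebra.comatrix s' \<Delta>' \<epsilon>' n (\<lambda>i j. f (m i j))"
proof -
  interpret A: coalgebra s \<Delta> \<epsilon> by fact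
  interpret B: coalgebra s' \<Delta>' \<epsilon>' by fact
  note lf = coalgebra_map_linear[OF f]
  show ?thesis
    unfolding B.comatrix_def
  proof (intro allI impI conjI)
    fix i j assume ij: "i < n" "j < n"
    show "\<epsilon>' (f (m i j)) = (if i = j then 1 else 0)"
      using f A.counit_comatrix[OF m ij] by (simp add: coalgebra_map_def)
    show "tensor_eq s' s' (\<Delta>' (f (m i j))) (\<Sum>k<n. basis_vec (f (m i k), f (m k j)))"
    proof (rule tensor_eqI[OF B.vector_space_axioms B.vector_space_axioms])
      fix \<beta> :: "'c \<Rightarrow> 'c \<Rightarrow> 'a" assume \<beta>: "bilinear_map s' s' (*) \<beta>"
      have "tev (*) \<beta> (\<Delta>' (f (m i j))) = tev (*) \<beta> (tensor_map f f (\<Delta> (m i j)))"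
        using f by (intro tensor_eq_tev[OF _ \<beta>]) (simp add: coalgebra_map_def)
      also have "\<dots> = (\<Sum>k<n. \<beta> (f (m i k)) (f (m k j)))"
        unfolding tev_tensor_map[OF vector_space_self]
        by (rule A.tev_comatrix[OF m ij bilinear_map_compose[OF \<beta> lf lf]])
      finally show "tev (*) \<beta> (\<Delta>' (f (m i j))) = tev (*) \<beta> (\<Sum>k<n. basis_vec (f (m i k), f (m k j)))"
        by (simp add: lin_sum[OF field_linear_lin_ext] field_lin_ext_single)
    qed
  qed
qed

lemma coalgebra_mapI:
  assumes "coalgebra s \<Delta> \<epsilon>" "coalgebra s' \<Delta>' \<epsilon>'" and f: "Vector_Spaces.linear s s' f"
    and comult: "\<And>n m i j \<beta>. coalgebra.comatrix s \<Delta> \<epsilon> n m \<Longrightarrow> i < n \<Longrightarrow> j < n \<Longrightarrow> bilinear_map s' s' (*) \<beta> \<Longrightarrow>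
        tev (*) \<beta> (\<Delta>' (f (m i j))) = (\<Sum>k<n. \<beta> (f (m i k)) (f (m k j)))"
    and counit: "\<And>n m i j. coalgebra.comatrix s \<Delta> \<epsilon> n m \<Longrightarrow> i < n \<Longrightarrow> j < n \<Longrightarrow> \<epsilon>' (f (m i j)) = \<epsilon> (m i j)"
  shows "coalgebra_map s \<Delta> \<epsilon> s' \<Delta>' \<epsilon>' f"
proof -
  interpret A: coalgebra s \<Delta> \<epsilon> by fact
  interpret B: coalgebra s' \<Delta>' \<epsilon>' by fact
  show ?thesis
    unfolding coalgebra_map_def
  proof (intro conjI allI f)
    show "\<epsilon>' (f x) = \<epsilon> x" for x
      by (rule A.linear_eq_comatrix[OF lin_compose[OF f B.counit_linear] A.counit_linear]) (rule counit)
    show "tensor_eq s' s' (\<Delta>' (f x)) (tensor_map f f (\<Delta> x))" for x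
    proof (rule tensor_eqI[OF B.vector_space_axioms B.vector_space_axioms])
      fix \<beta> :: "'c \<Rightarrow> 'c \<Rightarrow> 'a" assume \<beta>: "bilinear_map s' s' (*) \<beta>"
      note \<beta>f = bilinear_map_compose[OF \<beta> f f]
      show "tev (*) \<beta> (\<Delta>' (f x)) = tev (*) \<beta> (tensor_map f f (\<Delta> x))"
        unfolding tev_tensor_map[OF vector_space_self]
        by (rule A.linear_eq_comatrix[OF lin_compose[OF f B.linear_tev_comult[OF \<beta>]] A.linear_tev_comult[OF \<beta>f]])
          (simp add: comult \<beta> A.tev_comatrix[OF _ _ _ \<beta>f])
    qed
  qed
qed

section \<open>Coefficient matrices in a Hopf algebra\<close>

context hopf_algebra
begin

lemma tev_comult_mult:
  assumes "bilinear_map scale scale t \<beta>"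
  shows "tev t \<beta> (comult (x * y)) = tev t (\<lambda>a b. tev t (\<lambda>c d. \<beta> (a * c) (b * d)) (comult y)) (comult x)"
  unfolding tensor_eq_tev[OF comult_mult assms]
  by (rule tev_tensor_mult[OF linear_vector_space(2)[OF bilinear_mapD(1)[OF assms]]])

lemma bilinear_map_mult_both:
  assumes "bilinear_map scale scale t \<beta>"
  shows "bilinear_map scale scale t (\<lambda>c d. \<beta> (a * c) (b * d))" "bilinear_map scale scale t (\<lambda>c d. \<beta> (c * a) (d * b))"
  by (rule bilinear_map_compose[OF assms linear_mult(2) linear_mult(2)],
      rule bilinear_map_compose[OF assms linear_mult(1) linear_mult(1)])

lemma bilinear_map_tev_mult:
  assumes \<beta>: "bilinear_map scale scale t \<beta>"
  shows "bilinear_map scale scale t (\<lambda>a b. tev t (\<lambda>c d. \<beta> (a * c) (b * d)) p)"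
proof -
  interpret t: vector_space t by (rule linear_vector_space(2)[OF bilinear_mapD(1)[OF \<beta>]])
  show ?thesis
    unfolding bilinear_map_def
    by (auto intro!: linI vector_space_axioms t.vector_space_axioms
        simp: distrib_right scale_mult_left lin_add[OF bilinear_mapD(1)[OF \<beta>]] lin_scale[OF bilinear_mapD(1)[OF \<beta>]]
          lin_add[OF bilinear_mapD(2)[OF \<beta>]] lin_scale[OF bilinear_mapD(2)[OF \<beta>]] split_def
          t.lin_ext_fun_add t.lin_ext_fun_scale)
qed

lemma tev_comatrix_mult:
  assumes m: "comatrix n m" "i < n" "j < n" and \<beta>: "bilinear_map scale scale t \<beta>"
  shows "tev t \<beta> (comult (m i j * y)) = (\<Sum>k<n. tev t (\<lambda>c d. \<beta> (m i k * c) (m k j * d)) (comult y))"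
    and "tev t \<beta> (comult (y * m i j)) = (\<Sum>k<n. tev t (\<lambda>c d. \<beta> (c * m i k) (d * m k j)) (comult y))"
proof -
  interpret t: vector_space t by (rule linear_vector_space(2)[OF bilinear_mapD(1)[OF \<beta>]])
  from tev_comatrix[OF m bilinear_map_tev_mult[OF \<beta>, of "comult y"]]
  show "tev t \<beta> (comult (m i j * y)) = (\<Sum>k<n. tev t (\<lambda>c d. \<beta> (m i k * c) (m k j * d)) (comult y))"
    unfolding tev_comult_mult[OF \<beta>] .
  show "tev t \<beta> (comult (y * m i j)) = (\<Sum>k<n. tev t (\<lambda>c d. \<beta> (c * m i k) (d * m k j)) (comult y))"
    unfolding tev_comult_mult[OF \<beta>]
    by (simp only: tev_comatrix[OF m bilinear_map_mult_both(1)[OF \<beta>]]) (simp add: split_def t.lin_ext_fun_sum)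
qed

text \<open>The antipode axioms, read on a coefficient matrix, say that the entrywise antipode is
  its two-sided inverse.\<close>

lemma antipode_comatrix:
  assumes m: "comatrix n m" "i < n" "j < n"
  shows "(\<Sum>k<n. antipode (m i k) * m k j) = (if i = j then 1 else 0)"
    and "(\<Sum>k<n. m i k * antipode (m k j)) = (if i = j then 1 else 0)"
proof -
  note l = lin_ident[OF vector_space_axioms]
  have "(\<Sum>k<n. antipode (m i k) * m k j) = scale (counit (m i j)) 1"
    using tev_comatrix[OF m bilinear_map_compose[OF bilinear_map_mult antipode_linear l]]
      antipode_left[of "m i j"] by simp
  moreover have "(\<Sum>k<n. m i k * antipode (m k j)) = scale (counit (m i j)) 1"
    using tev_comatrix[OF m bilinear_map_compose[OF bilinear_map_mult l antipode_linear]]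
      antipode_right[of "m i j"] by simp
  ultimately show "(\<Sum>k<n. antipode (m i k) * m k j) = (if i = j then 1 else 0)"
    and "(\<Sum>k<n. m i k * antipode (m k j)) = (if i = j then 1 else 0)"
    by (simp_all add: counit_comatrix[OF m])
qed

end

lemma (in cocommutative_hopf_algebra) comatrix_flip:
  assumes m: "comatrix n m" "i < n" "j < n" and \<beta>: "bilinear_map scale scale t \<beta>"
  shows "(\<Sum>k<n. \<beta> (m i k) (m k j)) = (\<Sum>k<n. \<beta> (m k j) (m i k))"
proof -
  have t: "vector_space t" by (rule linear_vector_space(2)[OF bilinear_mapD(1)[OF \<beta>]])
  have "tev t \<beta> (comult (m i j)) = tev t \<beta> (tensor_flip (comult (m i j)))"
    by (rule tensor_eq_tev[OF cocommutative \<beta>, symmetric])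
  also have "\<dots> = tev t (\<lambda>x y. \<beta> y x) (comult (m i j))" by (rule tev_tensor_flip[OF t])
  finally show ?thesis
    by (simp add: tev_comatrix[OF m \<beta>] tev_comatrix[OF m bilinear_map_flip[OF \<beta>]])
qed

section \<open>Transfer of amenability along coalgebra maps\<close>

lemma (in vector_space) lin_ext_in_subspace:
  assumes "subspace D" "\<And>z. z \<in> Poly_Mapping.keys p \<Longrightarrow> f z \<in> D"
  shows "lin_ext scale f p \<in> D"
  unfolding lin_ext_def using assms by (intro subspace_sum subspace_scale) auto

lemma linear_span_into:
  assumes f: "Vector_Spaces.linear s1 s2 f" and D: "module.subspace s2 D"
    and X: "\<And>x. x \<in> X \<Longrightarrow> f x \<in> D" and x: "x \<in> module.span s1 X"
  shows "f x \<in> D"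
proof -
  interpret module_hom s1 s2 f using f by (simp add: linear_iff_module_hom)
  have "f ` m1.span X \<subseteq> D"
    unfolding span_image[symmetric] using X D by (intro m2.span_minimal) auto
  then show ?thesis using x by blast
qed

context k_algebra
begin

lemma subspace_prod_subset:
  assumes "subspace W" "\<And>x y. x \<in> X \<Longrightarrow> y \<in> Y \<Longrightarrow> x * y \<in> W"
  shows "subspace_prod scale (span X) (span Y) \<subseteq> W"
  unfolding subspace_prod_def
proof (rule span_minimal[OF _ assms(1)], safe)
  fix x y assume x: "x \<in> span X" and y: "y \<in> span Y"
  have "x' * y \<in> W" if "x' \<in> X" for x'
    using linear_span_into[OF linear_mult(2) assms(1) _ y] assms(2)[OF that] by blast
  then show "x * y \<in> W"
    using linear_span_into[OF linear_mult(1) assms(1) _ x] by blast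
qed

lemma subspace_prod_mult: "x \<in> F \<Longrightarrow> y \<in> E \<Longrightarrow> x * y \<in> subspace_prod scale F E"
  unfolding subspace_prod_def by (intro span_base) blast

lemma fin_dim_subspace_prod:
  assumes "fin_dim_subspace scale F" "fin_dim_subspace scale E"
  shows "fin_dim_subspace scale (subspace_prod scale F E)"
proof -
  obtain X Y where XY: "finite X" "F = span X" "finite Y" "E = span Y"
    using assms by (auto simp: fin_dim_subspace_def)
  let ?G = "(\<lambda>(x, y). x * y) ` (X \<times> Y)"
  have "subspace_prod scale F E \<subseteq> span ?G"
    unfolding XY by (rule subspace_prod_subset) (auto intro!: span_base)
  then show ?thesis
    using fin_dim_mono(1)[OF fin_dim_span[of ?G]] XY by (simp add: subspace_prod_def)
qed

text \<open>The growth ratio dim(E + FE) / dim E is what the slicing argument controls, with 1 +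
  \<epsilon> in the role of \<kappa>.\<close>

lemma amenable_iff:
  "amenable scale \<Delta> \<longleftrightarrow> (\<forall>F (\<epsilon>::real). fin_dim_subspace scale F \<and> \<epsilon> > 0 \<longrightarrow>
     (\<exists>E. fin_dim_subspace scale E \<and> subcoalgebra scale \<Delta> E \<and>
        real (dim {x + y | x y. x \<in> E \<and> y \<in> subspace_prod scale F E}) < (1 + \<epsilon>) * real (dim E)))"
proof -
  have "real (quotient_dim scale {x + y | x y. x \<in> E \<and> y \<in> subspace_prod scale F E} E) < \<epsilon> * real (dim E) \<longleftrightarrow>
      real (dim {x + y | x y. x \<in> E \<and> y \<in> subspace_prod scale F E}) < (1 + \<epsilon>) * real (dim E)"
    if "fin_dim_subspace scale F" "fin_dim_subspace scale E" for F E and \<epsilon> :: real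
  proof -
    let ?V = "{x + y | x y. x \<in> E \<and> y \<in> subspace_prod scale F E}"
    have P: "fin_dim_subspace scale (subspace_prod scale F E)" by (rule fin_dim_subspace_prod[OF that])
    have V: "fin_dim_subspace scale ?V" by (rule fin_dim_sums[OF that(2) P])
    have E: "subspace E" "E \<subseteq> ?V"
      using subspace_sums_upper(1)[OF that(2)[THEN fin_dim_subspaceD] P[THEN fin_dim_subspaceD]]
        that(2)[THEN fin_dim_subspaceD] by auto
    have "dim E \<le> dim ?V" by (rule fin_dim_mono(2)[OF V E])
    then show ?thesis unfolding quotient_dim_eq[OF V E] by (auto simp: of_nat_diff algebra_simps)
  qed
  then show ?thesis unfolding amenable_def by blast
qed

end

text \<open>Shrinking D to the span of the slices it really receives leaves \<open>slice E D\<close>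
  unchanged, and as j \<ge> 1 any drop in dimension would raise the score. This is what later makes
  an optimal D a subcoalgebra.\<close>

lemma (in slicing) optimal_eq_span:
  assumes E: "fin_dim_subspace sB E" and D: "optimal N j E D" and j: "j \<ge> 1"
  shows "D = vs2.span {c e | c e. c \<in> \<C> \<and> e \<in> slice E D}"
proof -
  let ?D = "vs2.span {c e | c e. c \<in> \<C> \<and> e \<in> slice E D}"
  have fD: "fin_dim_subspace sX D" using D by (simp add: optimal_def)
  have sub: "?D \<subseteq> D"
    by (rule vs2.span_minimal) (auto simp: slice_def vs2.fin_dim_subspaceD[OF fD])
  have fD': "fin_dim_subspace sX ?D" by (rule vs2.fin_dim_mono(1)[OF fD _ sub]) simp
  have "slice E D = slice E ?D"
  proof
    show "slice E D \<subseteq> slice E ?D" unfolding slice_def[of E ?D]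
      by (auto intro!: vs2.span_base) (simp add: slice_def)
    show "slice E ?D \<subseteq> slice E D" using sub by (auto simp: slice_def)
  qed
  moreover have "score N j E ?D \<le> score N j E D" using D fD' by (simp add: optimal_def)
  ultimately have "int j * int (vs2.dim D) \<le> int j * int (vs2.dim ?D)"
    unfolding score_def by simp
  then have "vs2.dim D \<le> vs2.dim ?D" using j by (simp only: mult_le_cancel_left) simp
  then show ?thesis using vs2.fin_dim_eqI[OF fD vs2.subspace_span sub] by simp
qed

lemma (in cocommutative_hopf_algebra) tev_comatrix_mult_flip:
  assumes m: "comatrix n m" "i < n" "j < n" and \<beta>: "bilinear_map scale scale t \<beta>"
  shows "tev t \<beta> (comult (m i j * y)) = (\<Sum>k<n. tev t (\<lambda>c d. \<beta> (m k j * c) (m i k * d)) (comult y))"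
  unfolding tev_comatrix_mult(1)[OF m \<beta>]
  using comatrix_flip[OF m bilinear_map_tev_mult[OF \<beta>, of "comult y"]] .

text \<open>One argument for both quotients of B. The assumption \<open>matrices\<close> abstracts
  module compatibility: finitely many elements of X are covered by a matrix g whose action
  corresponds under p to that of a coefficient matrix m of B.\<close>

theorem amenable_transfer:
  fixes sB :: "'k::field \<Rightarrow> 'b::ring_1 \<Rightarrow> 'b" and sX :: "'k \<Rightarrow> 'x::ring_1 \<Rightarrow> 'x"
  assumes "cocommutative_hopf_algebra sB \<Delta>B \<epsilon>B SB" "cocommutative_hopf_algebra sX \<Delta>X \<epsilon>X SX"
    and p: "coalgebra_map sB \<Delta>B \<epsilon>B sX \<Delta>X \<epsilon>X p"
    and matrices: "\<And>F. finite F \<Longrightarrow> \<exists>n m g. coalgebra.comatrix sB \<Delta>B \<epsilon>B n m \<and>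
        F \<subseteq> module.span sX {g i j | i j. i < n \<and> j < n} \<and> (\<forall>i<n. \<forall>j<n. \<forall>b. p (m i j * b) = g i j * p b)"
    and amenable: "amenable sB \<Delta>B"
  shows "amenable sX \<Delta>X"
proof -
  interpret B: cocommutative_hopf_algebra sB \<Delta>B \<epsilon>B SB by fact
  interpret X: cocommutative_hopf_algebra sX \<Delta>X \<epsilon>X SX by fact
  interpret BX: vector_space_pair sB sX ..
  note lp = coalgebra_map_linear[OF p]
  let ?L = "\<lambda>\<phi>. Vector_Spaces.linear sB ((*) :: 'k \<Rightarrow> _) \<phi>"
  define c where "c \<phi> b = tev sX (\<lambda>x y. sX (\<phi> x) (p y)) (\<Delta>B b)" for \<phi> b
  have bil: "bilinear_map sB sB sX (\<lambda>x y. sX (\<phi> x) (p y))" if "?L \<phi>" for \<phi>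
    by (rule bilinear_map_compose[OF X.bilinear_map_scale that lp])
  have lc: "Vector_Spaces.linear sB sX (c \<phi>)" if "?L \<phi>" for \<phi>
    unfolding c_def by (rule B.linear_tev_comult[OF bil[OF that]])
  define \<C> where "\<C> = {c \<phi> | \<phi>. ?L \<phi>}"
  interpret slicing sB sX \<C>
    by (intro slicing.intro slicing_axioms.intro BX.vector_space_pair_axioms) (auto simp: \<C>_def lc)
  have lmul: "?L (\<lambda>x. \<phi> (a * x))" if "?L \<phi>" for \<phi> a
    by (rule lin_compose[OF B.linear_mult(2) that])
  \<comment> \<open>The counit of X turns \<phi>(e_1) p(e_2) back into \<phi>(e), so the slices
    determine e.\<close>
  have injective: "e = 0" if "\<forall>f\<in>\<C>. f e = 0" for e
  proof (rule B.functional_ext)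
    fix \<phi> assume \<phi>: "?L \<phi>"
    have "\<epsilon>X (c \<phi> e) = tev (*) (\<lambda>x y. \<phi> x * \<epsilon>B y) (\<Delta>B e)"
      unfolding c_def lin_ext_out[OF X.counit_linear] using p
      by (intro arg_cong2[where f = "lin_ext (*)"] ext refl)
        (simp add: lin_scale[OF X.counit_linear] coalgebra_map_def split: prod.split)
    also have "\<dots> = \<phi> (tev sB (\<lambda>x y. sB (\<epsilon>B y) x) (\<Delta>B e))"
      unfolding lin_ext_out[OF \<phi>]
      by (intro arg_cong2[where f = "lin_ext (*)"] ext refl) (simp add: lin_scale[OF \<phi>] split: prod.split)
    finally have "\<phi> e = \<epsilon>X (c \<phi> e)" by (simp add: B.counit_right)
    moreover have "c \<phi> e = 0" using that \<phi> by (auto simp: \<C>_def)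
    ultimately show "\<phi> e = \<phi> 0" by (simp add: lin_zero[OF X.counit_linear] lin_zero[OF \<phi>])
  qed
  \<comment> \<open>A slice of \<phi>(e_1) p(e_2) by \<psi> is \<phi>(e_1) \<psi>(p(e_3)) p(e_2).
    Cocommutativity exchanges e_2 and e_3, which leaves another slice of e, by the convolution of
    \<phi> with \<psi> p.\<close>
  have slice_right: "tev sX (\<lambda>x y. sX (\<psi> y) x) (\<Delta>X (c \<phi> e)) = c (\<lambda>b. tev (*) (\<lambda>u v. \<phi> u * \<psi> (p v)) (\<Delta>B b)) e"
    and slice_form: "?L (\<lambda>b. tev (*) (\<lambda>u v. \<phi> u * \<psi> (p v)) (\<Delta>B b))"
    if \<phi>: "?L \<phi>" and \<psi>: "Vector_Spaces.linear sX (*) \<psi>" for \<phi> \<psi> e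
  proof -
    let ?\<phi> = "\<lambda>b. tev (*) (\<lambda>u v. \<phi> u * \<psi> (p v)) (\<Delta>B b)"
    note l\<psi> = lin_compose[OF lp \<psi>]
    note b\<phi> = bilinear_map_compose[OF field_bilinear_map_mult \<phi> l\<psi>]
    show L: "?L ?\<phi>" by (rule B.linear_tev_comult[OF b\<phi>])
    note lR = X.linear_tev_comult[OF X.slice_bilinear(1)[OF \<psi>]]
    show "tev sX (\<lambda>x y. sX (\<psi> y) x) (\<Delta>X (c \<phi> e)) = c ?\<phi> e"
    proof (rule B.linear_eq_comatrix[OF lin_compose[OF lc[OF \<phi>] lR] lc[OF L]])
      fix n m i j assume m: "B.comatrix n m" and ij: "i < n" "j < n"
      note pm = coalgebra_map_comatrix[OF B.coalgebra_axioms X.coalgebra_axioms p m]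
      have "tev sX (\<lambda>x y. sX (\<psi> y) x) (\<Delta>X (c \<phi> (m i j))) =
          (\<Sum>k<n. sX (\<phi> (m i k)) (tev sX (\<lambda>x y. sX (\<psi> y) x) (\<Delta>X (p (m k j)))))"
        unfolding c_def B.tev_comatrix[OF m ij bil[OF \<phi>]] by (simp add: lin_sum[OF lR] lin_scale[OF lR])
      also have "\<dots> = (\<Sum>k<n. sX (\<phi> (m i k)) (\<Sum>l<n. sX (\<psi> (p (m l j))) (p (m k l))))"
        using ij by (intro sum.cong refl) (simp add: X.tev_comatrix[OF pm _ _ X.slice_bilinear(1)[OF \<psi>]])
      also have "\<dots> = (\<Sum>k<n. sX (\<phi> (m i k)) (\<Sum>l<n. sX (\<psi> (p (m k l))) (p (m l j))))"
      proof (rule sum.cong[OF refl], rule arg_cong2[where f = sX, OF refl])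
        fix k assume "k \<in> {..<n}"
        then show "(\<Sum>l<n. sX (\<psi> (p (m l j))) (p (m k l))) = (\<Sum>l<n. sX (\<psi> (p (m k l))) (p (m l j)))"
          using B.comatrix_flip[OF m _ ij(2) bil[OF l\<psi>]] by simp
      qed
      also have "\<dots> = (\<Sum>l<n. \<Sum>k<n. sX (\<phi> (m i k) * \<psi> (p (m k l))) (p (m l j)))"
        unfolding X.scale_sum_right X.scale_scale by (rule sum.swap)
      also have "\<dots> = (\<Sum>l<n. sX (?\<phi> (m i l)) (p (m l j)))"
        using ij by (intro sum.cong refl) (simp add: B.tev_comatrix[OF m _ _ b\<phi>] X.scale_sum_left)
      also have "\<dots> = c ?\<phi> (m i j)"
        unfolding c_def[of ?\<phi>] B.tev_comatrix[OF m ij bil[OF L]] ..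
      finally show "tev sX (\<lambda>x y. sX (\<psi> y) x) (\<Delta>X (c \<phi> (m i j))) = c ?\<phi> (m i j)" .
    qed
  qed
  have slice_left: "tev sX (\<lambda>x y. sX (\<psi> x) y) (\<Delta>X z) = tev sX (\<lambda>x y. sX (\<psi> y) x) (\<Delta>X z)"
    if \<psi>: "Vector_Spaces.linear sX (*) \<psi>" for \<psi> z
    using tensor_eq_tev[OF X.cocommutative X.slice_bilinear(1)[OF \<psi>], of z]
    unfolding tev_tensor_flip[OF X.vector_space_axioms] .
  show ?thesis
    unfolding X.amenable_iff
  proof (intro allI impI, elim conjE)
    fix F and \<epsilon> :: real assume F: "fin_dim_subspace sX F" and \<epsilon>: "\<epsilon> > 0"
    obtain X0 where X0: "finite X0" "F = X.span X0" using F by (auto simp: fin_dim_subspace_def)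
    \<comment> \<open>Covering the unit as well yields D \<subseteq> D', so that D' bounds D + FD
      and not only FD.\<close>
    have "finite (insert 1 X0)" using X0(1) by simp
    from matrices[OF this] obtain n m g where mg: "B.comatrix n m \<and>
        insert 1 X0 \<subseteq> X.span {g i j | i j. i < n \<and> j < n} \<and> (\<forall>i<n. \<forall>j<n. \<forall>b. p (m i j * b) = g i j * p b)"
      by (elim exE)
    note m = mg[THEN conjunct1] and g = mg[THEN conjunct2, THEN conjunct1]
    have pm: "p (m i j * b) = g i j * p b" if "i < n" "j < n" for i j b
      using mg that by simp
    let ?G = "(\<lambda>(i, j). m i j) ` ({..<n} \<times> {..<n})"
    have "fin_dim_subspace sB (B.span ?G)" by (rule B.fin_dim_span) simp
    then obtain E where E: "fin_dim_subspace sB E"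
      and less: "real (B.dim {x + y | x y. x \<in> E \<and> y \<in> subspace_prod sB (B.span ?G) E}) < (1 + \<epsilon>) * real (B.dim E)"
      using amenable \<epsilon> unfolding B.amenable_iff by blast
    let ?P = "subspace_prod sB (B.span ?G) E"
    let ?E' = "{x + y | x y. x \<in> E \<and> y \<in> ?P}"
    have fP: "fin_dim_subspace sB ?P" by (rule B.fin_dim_subspace_prod[OF B.fin_dim_span E]) simp
    have E': "fin_dim_subspace sB ?E'" by (rule B.fin_dim_sums[OF E fP])
    obtain Y where Y: "finite Y" "E = B.span Y" using E by (auto simp: fin_dim_subspace_def)
    \<comment> \<open>The second legs of \<Delta> on generators of E capture every slice of E,
      whatever the functional.\<close>
    let ?Df = "X.span (p ` snd ` (\<Union>y\<in>Y. Poly_Mapping.keys (\<Delta>B y)))"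
    have Df: "fin_dim_subspace sX ?Df" by (rule X.fin_dim_span) (simp add: Y)
    have "f e \<in> ?Df" if f: "f \<in> \<C>" and e: "e \<in> E" for f e
    proof -
      obtain \<phi> where \<phi>: "?L \<phi>" "f = c \<phi>" using f by (auto simp: \<C>_def)
      have "c \<phi> y \<in> ?Df" if "y \<in> Y" for y
        unfolding c_def
      proof (rule X.lin_ext_in_subspace[OF X.subspace_span])
        fix z assume "z \<in> Poly_Mapping.keys (\<Delta>B y)"
        then have "p (snd z) \<in> p ` snd ` (\<Union>y\<in>Y. Poly_Mapping.keys (\<Delta>B y))" using that by blast
        then show "(case z of (x, y) \<Rightarrow> sX (\<phi> x) (p y)) \<in> ?Df"
          unfolding split_def by (intro X.span_scale X.span_base)
      qed
      then show ?thesis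
        using linear_span_into[OF lc[OF \<phi>(1)] X.subspace_span, of Y] e Y(2) \<phi>(2) by blast
    qed
    then have sDf: "slice E ?Df = E" by (auto simp: slice_def)
    obtain N j D D' where j: "1 \<le> j" and D: "max_optimal N j E D" and D': "max_optimal N j ?E' D'"
      and small: "real (X.dim D') < (1 + \<epsilon>) * real (X.dim D)"
      by (rule max_optimal_small_growth[OF E E' injective Df sDf _ less]) (use \<epsilon> in auto)
    have oD: "optimal N j E D" using D by (simp add: max_optimal_def)
    have fD: "fin_dim_subspace sX D" "fin_dim_subspace sX D'"
      using D D' by (simp_all add: max_optimal_def optimal_def)
    note sD = X.fin_dim_subspaceD[OF fD(1)] X.fin_dim_subspaceD[OF fD(2)]
    have gD: "g i l * d \<in> D'" if il: "i < n" "l < n" and d: "d \<in> D" for i l d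
    proof (rule matrix_max_optimal[of "{..<n}" E ?E' "\<lambda>i k b. m i k * b" "\<lambda>i k x. g i k * x"])
      show "finite {..<n}" "fin_dim_subspace sB E" "fin_dim_subspace sB ?E'"
        "optimal N j E D" "max_optimal N j ?E' D'" "i \<in> {..<n}" "l \<in> {..<n}" "d \<in> D"
        by (simp_all add: E E' oD D' il d)
      show "Vector_Spaces.linear sB sB (\<lambda>b. m i k * b)" for i k by (rule B.linear_mult)
      show "Vector_Spaces.linear sX sX (\<lambda>x. g i k * x)" for i k by (rule X.linear_mult)
      show "m i k * e \<in> ?E'" if "i \<in> {..<n}" "k \<in> {..<n}" "e \<in> E" for i k e
      proof -
        have "m i k \<in> B.span ?G" using that by (intro B.span_base) auto
        then have "m i k * e \<in> ?P" using that(3) by (rule B.subspace_prod_mult)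
        then show ?thesis
          using B.subspace_sums_upper(2)[OF B.fin_dim_subspaceD[OF E] B.fin_dim_subspaceD[OF fP]] by blast
      qed
    next
      fix f assume "f \<in> \<C>"
      then obtain \<phi> where \<phi>: "?L \<phi>" "f = c \<phi>" by (auto simp: \<C>_def)
      \<comment> \<open>Cocommutativity lets \<Delta> m_il be read as sum_k m_kl \<otimes> m_ik: the
        factor m_ik passes through p as g_ik, and m_kl is absorbed into the functional.\<close>
      let ?d = "\<lambda>k l. c (\<lambda>x. \<phi> (m k l * x))"
      have "c \<phi> (m i l * b) = (\<Sum>k<n. g i k * ?d k l b)" if "i < n" "l < n" for i l b
      proof -
        have "c \<phi> (m i l * b) = (\<Sum>k<n. tev sX (\<lambda>x y. sX (\<phi> (m k l * x)) (p (m i k * y))) (\<Delta>B b))"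
          unfolding c_def by (rule B.tev_comatrix_mult_flip[OF m that bil[OF \<phi>(1)]])
        also have "\<dots> = (\<Sum>k<n. g i k * ?d k l b)"
          unfolding c_def lin_ext_out[OF X.linear_mult(2)] using that
          by (intro sum.cong refl arg_cong2[where f = "lin_ext sX"] ext)
            (simp add: pm X.scale_mult_right split: prod.split)
        finally show ?thesis .
      qed
      then show "\<exists>d. (\<forall>k\<in>{..<n}. \<forall>l\<in>{..<n}. d k l \<in> \<C>) \<and>
          (\<forall>i\<in>{..<n}. \<forall>l\<in>{..<n}. \<forall>b. f (m i l * b) = (\<Sum>k<n. g i k * d k l b))"
        using lmul[OF \<phi>(1)] \<phi>(2) by (intro exI[of _ ?d]) (auto simp: \<C>_def)
    next
      fix f i assume "f \<in> \<C>" and "i \<in> {..<n}"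
      then obtain \<phi> where \<phi>: "?L \<phi>" "f = c \<phi>" and i: "i < n" by (auto simp: \<C>_def)
      \<comment> \<open>Putting the inverse matrix S(m) into the functional cancels the factor of m
        that \<Delta>(m b) contributes on the first leg; only p(m_il b_2) survives.\<close>
      let ?d = "\<lambda>k. c (\<lambda>x. \<phi> (SB (m i k) * x))"
      have "g i l * c \<phi> b = (\<Sum>k<n. ?d k (m k l * b))" if l: "l < n" for l b
      proof -
        have "(\<Sum>k<n. ?d k (m k l * b)) = (\<Sum>k<n. \<Sum>r<n. tev sX (\<lambda>x y. sX (\<phi> (SB (m i k) * (m k r * x))) (p (m r l * y))) (\<Delta>B b))"
          unfolding c_def using l
          by (intro sum.cong refl B.tev_comatrix_mult(1)[OF m _ _ bil[OF lmul[OF \<phi>(1)]]]) auto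
        also have "\<dots> = (\<Sum>r<n. \<Sum>k<n. tev sX (\<lambda>x y. sX (\<phi> (SB (m i k) * (m k r * x))) (p (m r l * y))) (\<Delta>B b))"
          by (rule sum.swap)
        also have "\<dots> = (\<Sum>r<n. tev sX (\<lambda>x y. sX (\<phi> ((\<Sum>k<n. SB (m i k) * m k r) * x)) (p (m r l * y))) (\<Delta>B b))"
          by (intro sum.cong refl)
            (simp add: sum_distrib_right mult.assoc lin_sum[OF \<phi>(1)] X.scale_sum_left X.lin_ext_fun_sum split_def)
        also have "\<dots> = (\<Sum>r<n. if i = r then tev sX (\<lambda>x y. sX (\<phi> x) (p (m i l * y))) (\<Delta>B b) else 0)"
          using i by (intro sum.cong refl)
            (auto simp: B.antipode_comatrix(1)[OF m] lin_zero[OF \<phi>(1)] lin_ext_def split_def)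
        also have "\<dots> = g i l * c \<phi> b"
          unfolding c_def lin_ext_out[OF X.linear_mult(2)] using i l
          by (auto intro!: arg_cong2[where f = "lin_ext sX"] simp: pm X.scale_mult_right split: prod.split)
        finally show ?thesis by simp
      qed
      then show "\<exists>d. (\<forall>k\<in>{..<n}. d k \<in> \<C>) \<and> (\<forall>l\<in>{..<n}. \<forall>b. g i l * f b = (\<Sum>k<n. d k (m k l * b)))"
        using lmul[OF \<phi>(1)] \<phi>(2) by (intro exI[of _ ?d]) (auto simp: \<C>_def)
    qed
    have FD: "x * d \<in> D'" if "x \<in> X.span (insert 1 X0)" "d \<in> D" for x d
    proof (rule linear_span_into[OF X.linear_mult(1) sD(2)])
      show "y * d \<in> D'" if "y \<in> {g i j | i j. i < n \<and> j < n}" for y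
        using gD \<open>d \<in> D\<close> that by auto
      show "x \<in> X.span {g i j | i j. i < n \<and> j < n}"
        using that(1) g X.span_minimal[OF g] by auto
    qed
    have "x \<in> D'" if "x \<in> D" for x using FD[of 1 x] that by (simp add: X.span_base)
    moreover have "subspace_prod sX F D \<subseteq> D'"
      unfolding subspace_prod_def
    proof (rule X.span_minimal[OF _ sD(2)], safe)
      fix f d assume "f \<in> F" "d \<in> D"
      then show "f * d \<in> D'" using FD[of f d] X0(2) X.span_mono[of X0 "insert 1 X0"] by blast
    qed
    ultimately have "{x + y | x y. x \<in> D \<and> y \<in> subspace_prod sX F D} \<subseteq> D'"
      using X.subspace_add[OF sD(2)] by blast
    then have "X.dim {x + y | x y. x \<in> D \<and> y \<in> subspace_prod sX F D} \<le> X.dim D'"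
      by (rule X.fin_dim_mono(2)[OF fD(2) X.subspace_sums[OF sD(1) X.fin_dim_subspaceD[OF X.fin_dim_subspace_prod[OF F fD(1)]]]])
    then have "real (X.dim {x + y | x y. x \<in> D \<and> y \<in> subspace_prod sX F D}) < (1 + \<epsilon>) * real (X.dim D)"
      using small by simp
    moreover have "subcoalgebra sX \<Delta>X D"
    proof -
      let ?S = "{f e | f e. f \<in> \<C> \<and> e \<in> slice E D}"
      \<comment> \<open>It suffices to slice generators f e, whose slices are again values at e of
        maps in \<C> and hence lie in D.\<close>
      have span: "D = X.span ?S" by (rule optimal_eq_span[OF E oD j])
      have right: "tev sX (\<lambda>x y. sX (\<psi> y) x) (\<Delta>X x) \<in> D"
        if x: "x \<in> D" and \<psi>: "Vector_Spaces.linear sX (*) \<psi>" for x \<psi>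
      proof (rule linear_span_into[OF X.linear_tev_comult[OF X.slice_bilinear(1)[OF \<psi>]] sD(1)])
        show "x \<in> X.span ?S" using x span by simp
        fix y assume "y \<in> ?S"
        then obtain f e where f: "f \<in> \<C>" "y = f e" and e: "e \<in> slice E D" by blast
        from f(1) obtain \<phi> where \<phi>: "?L \<phi>" "f = c \<phi>" by (auto simp: \<C>_def)
        have "c (\<lambda>b. tev (*) (\<lambda>u v. \<phi> u * \<psi> (p v)) (\<Delta>B b)) \<in> \<C>"
          using slice_form[OF \<phi>(1) \<psi>] unfolding \<C>_def by blast
        then show "tev sX (\<lambda>x y. sX (\<psi> y) x) (\<Delta>X y) \<in> D"
          using slice_right[OF \<phi>(1) \<psi>, of e] e f(2) \<phi>(2) by (simp add: slice_def)
      qed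
      show ?thesis
        by (rule X.subcoalgebraI[OF sD(1) right]) (simp_all only: slice_left right)
    qed
    ultimately show "\<exists>D. fin_dim_subspace sX D \<and> subcoalgebra sX \<Delta>X D \<and>
        real (X.dim {x + y | x y. x \<in> D \<and> y \<in> subspace_prod sX F D}) < (1 + \<epsilon>) * real (X.dim D)"
      using fD(1) by blast
  qed
qed

section \<open>Cleft extensions\<close>

text \<open>The matrix with entries sum_l s_il \<otimes> u_lr has as right inverse the one with
  entries sum_a y_aj \<otimes> w_ra: u and w contract first and then allow s and y to
  contract.\<close>

lemma bilinear_inverse_right:
  fixes n :: nat and \<beta> :: "'b::ring_1 \<Rightarrow> 'r::ring_1 \<Rightarrow> 'v::ab_group_add"
  assumes \<beta>: "bilinear_map sB sR t \<beta>"
    and s: "\<And>i j. i < n \<Longrightarrow> j < n \<Longrightarrow> (\<Sum>k<n. s i k * y k j) = (if i = j then 1 else 0)"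
    and u: "\<And>i j. i < n \<Longrightarrow> j < n \<Longrightarrow> (\<Sum>k<n. u i k * w k j) = (if i = j then 1 else 0)"
    and ij: "i < n" "j < n"
  shows "(\<Sum>a<n. \<Sum>r<n. \<Sum>l<n. \<beta> (c * (s i l * y a j)) (e * (u l r * w r a))) = (if i = j then \<beta> c e else 0)"
proof -
  note l1 = bilinear_mapD(1)[OF \<beta>] and l2 = bilinear_mapD(2)[OF \<beta>]
  have "(\<Sum>a<n. \<Sum>r<n. \<Sum>l<n. \<beta> (c * (s i l * y a j)) (e * (u l r * w r a)))
      = (\<Sum>a<n. \<Sum>l<n. \<Sum>r<n. \<beta> (c * (s i l * y a j)) (e * (u l r * w r a)))"
    by (intro sum.cong[OF refl] sum.swap)
  also have "\<dots> = (\<Sum>a<n. \<Sum>l<n. \<beta> (c * (s i l * y a j)) (e * (\<Sum>r<n. u l r * w r a)))"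
    by (simp add: sum_distrib_left lin_sum[OF l2])
  also have "\<dots> = (\<Sum>a<n. \<Sum>l<n. if l = a then \<beta> (c * (s i a * y a j)) e else 0)"
    by (intro sum.cong[OF refl]) (auto simp: u lin_zero[OF l2])
  also have "\<dots> = \<beta> (c * (\<Sum>a<n. s i a * y a j)) e"
    by (simp add: sum_distrib_left lin_sum[OF l1] cong: sum.cong_simp)
  finally show ?thesis by (simp add: s ij lin_zero[OF l1])
qed

text \<open>Here the matrix to be cancelled appears with its coproduct flipped, as sum_l s_lj
  \<otimes> u_rl, so that w and u are adjacent and contract first.\<close>

lemma bilinear_inverse_left:
  fixes n :: nat and \<beta> :: "'b::ring_1 \<Rightarrow> 'r::ring_1 \<Rightarrow> 'v::ab_group_add"
  assumes \<beta>: "bilinear_map sB sR t \<beta>"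
    and s: "\<And>i j. i < n \<Longrightarrow> j < n \<Longrightarrow> (\<Sum>k<n. y i k * s k j) = (if i = j then 1 else 0)"
    and u: "\<And>i j. i < n \<Longrightarrow> j < n \<Longrightarrow> (\<Sum>k<n. w i k * u k j) = (if i = j then 1 else 0)"
    and ij: "i < n" "j < n"
  shows "(\<Sum>a<n. \<Sum>r<n. \<Sum>l<n. \<beta> ((y i a * s l j) * c) ((w a r * u r l) * e)) = (if i = j then \<beta> c e else 0)"
proof -
  note l1 = bilinear_mapD(1)[OF \<beta>] and l2 = bilinear_mapD(2)[OF \<beta>]
  have "(\<Sum>a<n. \<Sum>r<n. \<Sum>l<n. \<beta> ((y i a * s l j) * c) ((w a r * u r l) * e))
      = (\<Sum>a<n. \<Sum>l<n. \<Sum>r<n. \<beta> ((y i a * s l j) * c) ((w a r * u r l) * e))"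
    by (intro sum.cong[OF refl] sum.swap)
  also have "\<dots> = (\<Sum>a<n. \<Sum>l<n. \<beta> ((y i a * s l j) * c) ((\<Sum>r<n. w a r * u r l) * e))"
    by (simp add: sum_distrib_right lin_sum[OF l2])
  also have "\<dots> = (\<Sum>a<n. \<Sum>l<n. if a = l then \<beta> ((y i a * s a j) * c) e else 0)"
    by (intro sum.cong[OF refl]) (auto simp: u lin_zero[OF l2])
  also have "\<dots> = \<beta> ((\<Sum>a<n. y i a * s a j) * c) e"
    by (simp add: sum_distrib_right lin_sum[OF l1] cong: sum.cong_simp)
  finally show ?thesis by (simp add: s ij lin_zero[OF l1])
qed

text \<open>In the language of matrices over \<open>B \<otimes> B\<close>: if \<open>s \<otimes> 1\<close> commutes with \<open>1 \<otimes> U\<close>, then so does its inverse.\<close>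

lemma commuting_inverse:
  fixes s y U :: "nat \<Rightarrow> nat \<Rightarrow> 'b::ring_1"
  assumes "k_algebra sB"
    and sy: "\<And>i j. i < n \<Longrightarrow> j < n \<Longrightarrow> (\<Sum>k<n. s i k * y k j) = (if i = j then 1 else 0)"
    and ys: "\<And>i j. i < n \<Longrightarrow> j < n \<Longrightarrow> (\<Sum>k<n. y i k * s k j) = (if i = j then 1 else 0)"
    and comm: "\<And>\<gamma> i j. bilinear_map sB sB t \<gamma> \<Longrightarrow> i < n \<Longrightarrow> j < n \<Longrightarrow>
        (\<Sum>k<n. \<gamma> (s i k) (U k j)) = (\<Sum>k<n. \<gamma> (s k j) (U i k))"
    and \<gamma>: "bilinear_map sB sB t \<gamma>" and ij: "i < n" "j < n"
  shows "(\<Sum>k<n. \<gamma> (y i k) (U k j)) = (\<Sum>k<n. \<gamma> (y k j) (U i k))"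
proof -
  interpret B: k_algebra sB by fact
  note l1 = bilinear_mapD(1)[OF \<gamma>]
  have \<gamma>': "bilinear_map sB sB t (\<lambda>x z. \<gamma> (a * (x * b)) z)" for a b
    by (rule bilinear_map_compose[OF \<gamma> lin_compose[OF B.linear_mult(1) B.linear_mult(2)] lin_ident[OF B.vector_space_axioms]])
  have "(\<Sum>k<n. \<gamma> (y i k) (U k j)) = (\<Sum>k<n. \<Sum>l<n. if l = j then \<gamma> (y i k) (U k l) else 0)"
    using ij by simp
  also have "\<dots> = (\<Sum>k<n. \<Sum>l<n. \<gamma> (y i k * (\<Sum>r<n. s l r * y r j)) (U k l))"
    by (intro sum.cong[OF refl]) (auto simp: sy ij lin_zero[OF l1])
  also have "\<dots> = (\<Sum>k<n. \<Sum>l<n. \<Sum>r<n. \<gamma> (y i k * (s l r * y r j)) (U k l))"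
    by (simp add: sum_distrib_left lin_sum[OF l1])
  also have "\<dots> = (\<Sum>k<n. \<Sum>r<n. \<Sum>l<n. \<gamma> (y i k * (s l r * y r j)) (U k l))"
    by (intro sum.cong[OF refl] sum.swap)
  also have "\<dots> = (\<Sum>k<n. \<Sum>r<n. \<Sum>l<n. \<gamma> (y i k * (s k l * y r j)) (U l r))"
    by (intro sum.cong[OF refl] comm[OF \<gamma>', symmetric]) auto
  also have "\<dots> = (\<Sum>r<n. \<Sum>k<n. \<Sum>l<n. \<gamma> (y i k * (s k l * y r j)) (U l r))"
    by (rule sum.swap)
  also have "\<dots> = (\<Sum>r<n. \<Sum>l<n. \<Sum>k<n. \<gamma> (y i k * (s k l * y r j)) (U l r))"
    by (intro sum.cong[OF refl] sum.swap)
  also have "\<dots> = (\<Sum>r<n. \<Sum>l<n. \<gamma> ((\<Sum>k<n. y i k * s k l) * y r j) (U l r))"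
    by (simp add: sum_distrib_right lin_sum[OF l1] mult.assoc)
  also have "\<dots> = (\<Sum>r<n. \<Sum>l<n. if i = l then \<gamma> (y r j) (U i r) else 0)"
    by (intro sum.cong[OF refl]) (auto simp: ys ij lin_zero[OF l1])
  also have "\<dots> = (\<Sum>r<n. \<gamma> (y r j) (U i r))" using ij by (simp cong: sum.cong_simp)
  finally show ?thesis .
qed

context hopf_algebra
begin

text \<open>If the matrix \<open>P s\<close> is known, then so is \<open>(id \<otimes> f) \<Delta> P\<close>, by cancelling \<open>(id \<otimes> f) \<Delta> s\<close> on the right.\<close>

lemma tev_cancel_right:
  assumes R: "k_algebra sR" and f: "Vector_Spaces.linear scale sR f" "\<And>x y. f (x * y) = f x * f y"
    and \<beta>: "bilinear_map scale sR t \<beta>" and s: "comatrix n s"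
    and sy: "\<And>i j. i < n \<Longrightarrow> j < n \<Longrightarrow> (\<Sum>k<n. s i k * y k j) = (if i = j then 1 else 0)"
    and sw: "\<And>i j. i < n \<Longrightarrow> j < n \<Longrightarrow> (\<Sum>k<n. f (s i k) * w k j) = (if i = j then 1 else 0)"
    and b: "b < n"
  shows "(\<Sum>a<n. \<Sum>j<n. tev t (\<lambda>c d. \<beta> (c * y a b) (f d * w j a)) (comult (\<Sum>k<n. P k * s k j)))
    = tev t (\<lambda>c d. \<beta> c (f d)) (comult (P b))"
proof -
  interpret R: k_algebra sR by fact
  interpret t: vector_space t by (rule linear_vector_space(2)[OF bilinear_mapD(1)[OF \<beta>]])
  have \<gamma>: "bilinear_map scale scale t (\<lambda>c d. \<beta> (c * u) (f d * v))" for u v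
    by (rule bilinear_map_compose[OF \<beta> linear_mult(1) lin_compose[OF f(1) R.linear_mult(1)]])
  have "(\<Sum>a<n. \<Sum>j<n. tev t (\<lambda>c d. \<beta> (c * y a b) (f d * w j a)) (comult (\<Sum>k<n. P k * s k j)))
      = (\<Sum>a<n. \<Sum>j<n. \<Sum>k<n. \<Sum>l<n. tev t (\<lambda>c d. \<beta> (c * s k l * y a b) (f (d * s l j) * w j a)) (comult (P k)))"
    unfolding lin_sum[OF linear_tev_comult[OF \<gamma>]]
    by (intro sum.cong[OF refl] tev_comatrix_mult(2)[OF s _ _ \<gamma>]) auto
  also have "\<dots> = (\<Sum>a<n. \<Sum>k<n. \<Sum>j<n. \<Sum>l<n. tev t (\<lambda>c d. \<beta> (c * s k l * y a b) (f (d * s l j) * w j a)) (comult (P k)))"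
    by (intro sum.cong[OF refl] sum.swap)
  also have "\<dots> = (\<Sum>k<n. \<Sum>a<n. \<Sum>j<n. \<Sum>l<n. tev t (\<lambda>c d. \<beta> (c * s k l * y a b) (f (d * s l j) * w j a)) (comult (P k)))"
    by (rule sum.swap)
  also have "\<dots> = (\<Sum>k<n. tev t (\<lambda>c d. \<Sum>a<n. \<Sum>j<n. \<Sum>l<n. \<beta> (c * (s k l * y a b)) (f d * (f (s l j) * w j a))) (comult (P k)))"
    by (simp add: t.lin_ext_fun_sum split_def f(2) mult.assoc)
  also have "\<dots> = (\<Sum>k<n. if k = b then tev t (\<lambda>c d. \<beta> c (f d)) (comult (P b)) else 0)"
    using b bilinear_inverse_right[OF \<beta> sy sw _ b]
    by (intro sum.cong[OF refl]) (auto simp: lin_ext_def)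
  also have "\<dots> = tev t (\<lambda>c d. \<beta> c (f d)) (comult (P b))" using b by simp
  finally show ?thesis .
qed

end

text \<open>Cancellation in the product s Q. Cocommutativity rewrites \<Delta> s_ik as sum_l s_lk
  \<otimes> s_il, the form in which the inverse built from y and w can contract.\<close>

lemma (in cocommutative_hopf_algebra) tev_cancel_left:
  assumes R: "k_algebra sR" and f: "Vector_Spaces.linear scale sR f" "\<And>x y. f (x * y) = f x * f y"
    and \<beta>: "bilinear_map scale sR t \<beta>" and s: "comatrix n s"
    and ys: "\<And>i j. i < n \<Longrightarrow> j < n \<Longrightarrow> (\<Sum>k<n. y i k * s k j) = (if i = j then 1 else 0)"
    and ws: "\<And>i j. i < n \<Longrightarrow> j < n \<Longrightarrow> (\<Sum>k<n. w i k * f (s k j)) = (if i = j then 1 else 0)"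
    and b: "b < n"
  shows "(\<Sum>a<n. \<Sum>i<n. tev t (\<lambda>c d. \<beta> (y b a * c) (w a i * f d)) (comult (\<Sum>k<n. s i k * Q k)))
    = tev t (\<lambda>c d. \<beta> c (f d)) (comult (Q b))"
proof -
  interpret R: k_algebra sR by fact
  interpret t: vector_space t by (rule linear_vector_space(2)[OF bilinear_mapD(1)[OF \<beta>]])
  have \<gamma>: "bilinear_map scale scale t (\<lambda>c d. \<beta> (u * c) (v * f d))" for u v
    by (rule bilinear_map_compose[OF \<beta> linear_mult(2) lin_compose[OF f(1) R.linear_mult(2)]])
  have "(\<Sum>a<n. \<Sum>i<n. tev t (\<lambda>c d. \<beta> (y b a * c) (w a i * f d)) (comult (\<Sum>k<n. s i k * Q k)))
      = (\<Sum>a<n. \<Sum>i<n. \<Sum>k<n. \<Sum>l<n. tev t (\<lambda>c d. \<beta> (y b a * (s l k * c)) (w a i * f (s i l * d))) (comult (Q k)))"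
    unfolding lin_sum[OF linear_tev_comult[OF \<gamma>]]
    by (intro sum.cong[OF refl] tev_comatrix_mult_flip[OF s _ _ \<gamma>]) auto
  also have "\<dots> = (\<Sum>a<n. \<Sum>k<n. \<Sum>i<n. \<Sum>l<n. tev t (\<lambda>c d. \<beta> (y b a * (s l k * c)) (w a i * f (s i l * d))) (comult (Q k)))"
    by (intro sum.cong[OF refl] sum.swap)
  also have "\<dots> = (\<Sum>k<n. \<Sum>a<n. \<Sum>i<n. \<Sum>l<n. tev t (\<lambda>c d. \<beta> (y b a * (s l k * c)) (w a i * f (s i l * d))) (comult (Q k)))"
    by (rule sum.swap)
  also have "\<dots> = (\<Sum>k<n. tev t (\<lambda>c d. \<Sum>a<n. \<Sum>i<n. \<Sum>l<n. \<beta> ((y b a * s l k) * c) ((w a i * f (s i l)) * f d)) (comult (Q k)))"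
    by (simp add: t.lin_ext_fun_sum split_def f(2) mult.assoc)
  also have "\<dots> = (\<Sum>k<n. if b = k then tev t (\<lambda>c d. \<beta> c (f d)) (comult (Q b)) else 0)"
    using b bilinear_inverse_left[OF \<beta> ys ws b]
    by (intro sum.cong[OF refl]) (auto simp: lin_ext_def)
  also have "\<dots> = tev t (\<lambda>c d. \<beta> c (f d)) (comult (Q b))" using b by simp
  finally show ?thesis .
qed

locale cleft_section =
  cleft_exact_sequence sA \<Delta>A \<epsilon>A SA sB \<Delta>B \<epsilon>B SB sC \<Delta>C \<epsilon>C SC \<iota> \<pi> +
  BC: cocommutative_hopf_algebra sB \<Delta>B \<epsilon>B SB
  for sA :: "'k::field \<Rightarrow> 'a::ring_1 \<Rightarrow> 'a" and \<Delta>A \<epsilon>A SA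
    and sB :: "'k \<Rightarrow> 'b::ring_1 \<Rightarrow> 'b" and \<Delta>B \<epsilon>B SB
    and sC :: "'k \<Rightarrow> 'c::ring_1 \<Rightarrow> 'c" and \<Delta>C \<epsilon>C SC
    and \<iota> :: "'a \<Rightarrow> 'b" and \<pi> :: "'b \<Rightarrow> 'c" +
  fixes \<sigma> :: "'c \<Rightarrow> 'b"
  assumes section_coalgebra: "coalgebra_map sC \<Delta>C \<epsilon>C sB \<Delta>B \<epsilon>B \<sigma>"
    and proj_section: "\<pi> (\<sigma> x) = x"
begin

lemma incl_coalgebra: "coalgebra_map sA \<Delta>A \<epsilon>A sB \<Delta>B \<epsilon>B \<iota>"
  and incl_mult: "\<iota> (a * a') = \<iota> a * \<iota> a'"
  using incl_hopf by (auto simp: hopf_map_def)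

lemma proj_coalgebra: "coalgebra_map sB \<Delta>B \<epsilon>B sC \<Delta>C \<epsilon>C \<pi>"
  and proj_mult: "\<pi> (b * b') = \<pi> b * \<pi> b'"
  using proj_hopf by (auto simp: hopf_map_def)

lemmas linear_incl = coalgebra_map_linear[OF incl_coalgebra]
  and linear_proj = coalgebra_map_linear[OF proj_coalgebra]
  and linear_section = coalgebra_map_linear[OF section_coalgebra]
  and linear_section_proj = lin_compose[OF coalgebra_map_linear[OF proj_coalgebra] coalgebra_map_linear[OF section_coalgebra]]

lemmas incl_comatrix = coalgebra_map_comatrix[OF A.coalgebra_axioms B.coalgebra_axioms incl_coalgebra]
  and proj_comatrix = coalgebra_map_comatrix[OF B.coalgebra_axioms C.coalgebra_axioms proj_coalgebra]
  and section_comatrix = coalgebra_map_comatrix[OF C.coalgebra_axioms B.coalgebra_axioms section_coalgebra]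

lemma coinvariantI:
  assumes "\<And>\<beta>. bilinear_map sB sC (*) \<beta> \<Longrightarrow> tev (*) (\<lambda>x y. \<beta> x (\<pi> y)) (\<Delta>B b) = \<beta> b 1"
  shows "b \<in> range \<iota>"
proof -
  have "tensor_eq sB sC (tensor_map id \<pi> (\<Delta>B b)) (basis_vec (b, 1))"
    by (rule tensor_eqI[OF B.vector_space_axioms C.vector_space_axioms])
      (simp add: tev_tensor_map[OF vector_space_self] field_lin_ext_single assms)
  then show ?thesis by (simp add: coinvariants)
qed

text \<open>Apply the counit to the first factor of the coinvariance equation.\<close>

lemma proj_incl: "\<pi> (\<iota> a) = sC (\<epsilon>A a) 1"
proof -
  have "tensor_eq sB sC (tensor_map id \<pi> (\<Delta>B (\<iota> a))) (basis_vec (\<iota> a, 1))"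
    using coinvariants by auto
  moreover have "bilinear_map sB sC sC (\<lambda>x y. sC (\<epsilon>B x) y)"
    by (rule bilinear_map_compose[OF C.bilinear_map_scale B.counit_linear lin_ident[OF C.vector_space_axioms]])
  ultimately have "tev sC (\<lambda>x y. sC (\<epsilon>B x) y) (tensor_map id \<pi> (\<Delta>B (\<iota> a))) = tev sC (\<lambda>x y. sC (\<epsilon>B x) y) (basis_vec (\<iota> a, 1))"
    by (rule tensor_eq_tev)
  also have "\<dots> = sC (\<epsilon>A a) 1"
    using incl_coalgebra by (simp add: C.lin_ext_single coalgebra_map_def)
  also have "tev sC (\<lambda>x y. sC (\<epsilon>B x) y) (tensor_map id \<pi> (\<Delta>B (\<iota> a))) = \<pi> (tev sB (\<lambda>x y. sB (\<epsilon>B x) y) (\<Delta>B (\<iota> a)))"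
    unfolding tev_tensor_map[OF C.vector_space_axioms] lin_ext_out[OF linear_proj]
    by (intro arg_cong2[where f = "lin_ext sC"] ext refl) (simp add: lin_scale[OF linear_proj] split: prod.split)
  finally show ?thesis by (simp add: B.counit_left)
qed

section \<open>The maps p and q attached to the section\<close>

text \<open>The map p of the overview with B as codomain; \<open>retr_coinvariant\<close> later
  places its values in the image of A.\<close>

definition retr :: "'b \<Rightarrow> 'b" where
  "retr b = tev sB (\<lambda>x y. x * SB (\<sigma> (\<pi> y))) (\<Delta>B b)"

text \<open>The map q of the overview, likewise valued in B until coinvariance is known.\<close>

definition corestr :: "'b \<Rightarrow> 'b" where
  "corestr b = tev sB (\<lambda>x y. SB (\<sigma> (\<pi> x)) * y) (\<Delta>B b)"

lemma linear_twist: "Vector_Spaces.linear sB sB (\<lambda>x. SB (\<sigma> (\<pi> x)))"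
  by (rule lin_compose[OF linear_section_proj B.antipode_linear])

lemma bilinear_retr: "bilinear_map sB sB sB (\<lambda>x y. x * SB (\<sigma> (\<pi> y)))"
  and bilinear_corestr: "bilinear_map sB sB sB (\<lambda>x y. SB (\<sigma> (\<pi> x)) * y)"
  using bilinear_map_compose[OF B.bilinear_map_mult lin_ident[OF B.vector_space_axioms] linear_twist]
    bilinear_map_compose[OF B.bilinear_map_mult linear_twist lin_ident[OF B.vector_space_axioms]] by auto

lemma linear_retr: "Vector_Spaces.linear sB sB retr"
  and linear_corestr: "Vector_Spaces.linear sB sB corestr"
  using B.linear_tev_comult[OF bilinear_retr] B.linear_tev_comult[OF bilinear_corestr]
  by (simp_all add: retr_def[abs_def] corestr_def[abs_def])

context
  fixes n :: nat and m :: "nat \<Rightarrow> nat \<Rightarrow> 'b"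
  assumes m: "B.comatrix n m"
begin

text \<open>s = \<sigma>(\<pi>(m)) is again a coefficient matrix and y = S(s) is its inverse, so the
  two maps send m to the matrix products m y and y m.\<close>

abbreviation (input) "sm \<equiv> \<lambda>i j. \<sigma> (\<pi> (m i j))"
abbreviation (input) "ym \<equiv> \<lambda>i j. SB (\<sigma> (\<pi> (m i j)))"

lemma s_comatrix: "B.comatrix n sm"
  by (rule section_comatrix[OF proj_comatrix[OF m]])

lemmas y_s = B.antipode_comatrix(1)[OF s_comatrix]
  and s_y = B.antipode_comatrix(2)[OF s_comatrix]
  and w_m = C.antipode_comatrix(1)[OF proj_comatrix[OF m]]
  and m_w = C.antipode_comatrix(2)[OF proj_comatrix[OF m]]

lemma retr_comatrix: "i < n \<Longrightarrow> j < n \<Longrightarrow> retr (m i j) = (\<Sum>k<n. m i k * ym k j)"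
  unfolding retr_def by (rule B.tev_comatrix[OF m _ _ bilinear_retr])

lemma corestr_comatrix: "i < n \<Longrightarrow> j < n \<Longrightarrow> corestr (m i j) = (\<Sum>k<n. ym i k * m k j)"
  unfolding corestr_def by (rule B.tev_comatrix[OF m _ _ bilinear_corestr])

lemma retr_s:
  assumes "i < n" "j < n"
  shows "(\<Sum>k<n. retr (m i k) * sm k j) = m i j"
proof -
  have "(\<Sum>k<n. retr (m i k) * sm k j) = (\<Sum>k<n. \<Sum>l<n. m i l * (ym l k * sm k j))"
    using assms by (intro sum.cong[OF refl]) (simp add: retr_comatrix sum_distrib_right mult.assoc)
  also have "\<dots> = (\<Sum>l<n. \<Sum>k<n. m i l * (ym l k * sm k j))" by (rule sum.swap)
  also have "\<dots> = (\<Sum>l<n. if l = j then m i j else 0)"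
    unfolding sum_distrib_left[symmetric] using assms by (intro sum.cong[OF refl]) (simp add: y_s)
  finally show ?thesis using assms by simp
qed

lemma s_corestr:
  assumes "i < n" "j < n"
  shows "(\<Sum>k<n. sm i k * corestr (m k j)) = m i j"
proof -
  have "(\<Sum>k<n. sm i k * corestr (m k j)) = (\<Sum>k<n. \<Sum>l<n. (sm i k * ym k l) * m l j)"
    using assms by (intro sum.cong[OF refl]) (simp add: corestr_comatrix sum_distrib_left mult.assoc)
  also have "\<dots> = (\<Sum>l<n. \<Sum>k<n. (sm i k * ym k l) * m l j)" by (rule sum.swap)
  also have "\<dots> = (\<Sum>l<n. if i = l then m i j else 0)"
    unfolding sum_distrib_right[symmetric] using assms by (intro sum.cong[OF refl]) (auto simp: s_y)
  finally show ?thesis using assms by simp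
qed

text \<open>Apply (id \<otimes> \<pi>) \<Delta> to retr(m) s = m. The result has m \<otimes>
  \<pi>(m) on the right-hand side and, since \<pi> \<sigma> = id, s \<otimes> \<pi>(m) as the image
  of s; cancelling the latter leaves retr(m) \<otimes> 1.\<close>

lemma retr_comatrix_coinvariant:
  assumes ib: "i < n" "b < n"
  shows "retr (m i b) \<in> range \<iota>"
proof (rule coinvariantI)
  fix \<beta> :: "'b \<Rightarrow> 'c \<Rightarrow> 'k" assume \<beta>: "bilinear_map sB sC (*) \<beta>"
  let ?w = "\<lambda>i j. SC (\<pi> (m i j))"
  note l1 = bilinear_mapD(1)[OF \<beta>] and l2 = bilinear_mapD(2)[OF \<beta>]
  have \<gamma>: "bilinear_map sB sB (*) (\<lambda>c d. \<beta> (c * u) (\<pi> d * v))" for u v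
    by (rule bilinear_map_compose[OF \<beta> B.linear_mult(1) lin_compose[OF linear_proj C.linear_mult(1)]])
  have "tev (*) (\<lambda>c d. \<beta> c (\<pi> d)) (\<Delta>B (retr (m i b)))
      = (\<Sum>a<n. \<Sum>j<n. tev (*) (\<lambda>c d. \<beta> (c * ym a b) (\<pi> d * ?w j a)) (\<Delta>B (\<Sum>k<n. retr (m i k) * sm k j)))"
    by (rule B.tev_cancel_right[OF C.k_algebra_axioms linear_proj proj_mult \<beta> s_comatrix s_y _ ib(2), symmetric])
      (simp_all add: proj_section m_w)
  also have "\<dots> = (\<Sum>a<n. \<Sum>j<n. \<Sum>l<n. \<beta> (m i l * ym a b) (\<pi> (m l j) * ?w j a))"
    using ib(1) by (intro sum.cong[OF refl]) (simp add: retr_s B.tev_comatrix[OF m _ _ \<gamma>])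
  also have "\<dots> = (\<Sum>a<n. \<Sum>l<n. \<Sum>j<n. \<beta> (m i l * ym a b) (\<pi> (m l j) * ?w j a))"
    by (intro sum.cong[OF refl] sum.swap)
  also have "\<dots> = (\<Sum>a<n. \<Sum>l<n. if l = a then \<beta> (m i a * ym a b) 1 else 0)"
    unfolding lin_sum[OF l2, symmetric] by (intro sum.cong[OF refl]) (auto simp: m_w lin_zero[OF l2])
  also have "\<dots> = \<beta> (retr (m i b)) 1"
    using ib by (simp add: retr_comatrix lin_sum[OF l1] cong: sum.cong_simp)
  finally show "tev (*) (\<lambda>c d. \<beta> c (\<pi> d)) (\<Delta>B (retr (m i b))) = \<beta> (retr (m i b)) 1" .
qed

text \<open>The mirror image: cancel s on the left of s corestr(m) = m, with cocommutativity
  reordering the legs of both s and m.\<close>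

lemma corestr_comatrix_coinvariant:
  assumes bj: "b < n" "j < n"
  shows "corestr (m b j) \<in> range \<iota>"
proof (rule coinvariantI)
  fix \<beta> :: "'b \<Rightarrow> 'c \<Rightarrow> 'k" assume \<beta>: "bilinear_map sB sC (*) \<beta>"
  let ?w = "\<lambda>i j. SC (\<pi> (m i j))"
  note l1 = bilinear_mapD(1)[OF \<beta>] and l2 = bilinear_mapD(2)[OF \<beta>]
  have \<gamma>: "bilinear_map sB sB (*) (\<lambda>c d. \<beta> (u * c) (v * \<pi> d))" for u v
    by (rule bilinear_map_compose[OF \<beta> B.linear_mult(2) lin_compose[OF linear_proj C.linear_mult(2)]])
  have "tev (*) (\<lambda>c d. \<beta> c (\<pi> d)) (\<Delta>B (corestr (m b j)))
      = (\<Sum>a<n. \<Sum>i<n. tev (*) (\<lambda>c d. \<beta> (ym b a * c) (?w a i * \<pi> d)) (\<Delta>B (\<Sum>k<n. sm i k * corestr (m k j))))"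
    by (rule BC.tev_cancel_left[OF C.k_algebra_axioms linear_proj proj_mult \<beta> s_comatrix y_s _ bj(1), symmetric])
      (simp_all add: proj_section w_m)
  also have "\<dots> = (\<Sum>a<n. \<Sum>i<n. \<Sum>l<n. \<beta> (ym b a * m l j) (?w a i * \<pi> (m i l)))"
    using bj(2) by (intro sum.cong[OF refl]) (simp add: s_corestr B.tev_comatrix[OF m _ _ \<gamma>] BC.comatrix_flip[OF m _ _ \<gamma>])
  also have "\<dots> = (\<Sum>a<n. \<Sum>l<n. \<Sum>i<n. \<beta> (ym b a * m l j) (?w a i * \<pi> (m i l)))"
    by (intro sum.cong[OF refl] sum.swap)
  also have "\<dots> = (\<Sum>a<n. \<Sum>l<n. if a = l then \<beta> (ym b a * m a j) 1 else 0)"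
    unfolding lin_sum[OF l2, symmetric] by (intro sum.cong[OF refl]) (auto simp: w_m lin_zero[OF l2])
  also have "\<dots> = \<beta> (corestr (m b j)) 1"
    using bj by (simp add: corestr_comatrix lin_sum[OF l1] cong: sum.cong_simp)
  finally show "tev (*) (\<lambda>c d. \<beta> c (\<pi> d)) (\<Delta>B (corestr (m b j))) = \<beta> (corestr (m b j)) 1" .
qed

text \<open>Cocommutativity, with \<sigma> \<pi> applied to one leg, says that s commutes with m
  across the tensor sign; inverting s on that side preserves this. For y against y the inversion is
  carried out on each side in turn.\<close>

lemma y_commutes:
  assumes \<gamma>: "bilinear_map sB sB (*) \<gamma>" and ij: "i < n" "j < n"
  shows "(\<Sum>k<n. \<gamma> (ym i k) (m k j)) = (\<Sum>k<n. \<gamma> (ym k j) (m i k))"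
    and "(\<Sum>k<n. \<gamma> (ym i k) (ym k j)) = (\<Sum>k<n. \<gamma> (ym k j) (ym i k))"
proof -
  note inv = commuting_inverse[where s = sm and y = ym, OF B.k_algebra_axioms s_y y_s _ \<gamma> ij]
  show "(\<Sum>k<n. \<gamma> (ym i k) (m k j)) = (\<Sum>k<n. \<gamma> (ym k j) (m i k))"
  proof (rule inv)
    fix \<delta> :: "'b \<Rightarrow> 'b \<Rightarrow> 'k" and i j assume \<delta>: "bilinear_map sB sB (*) \<delta>" and "i < n" "j < n"
    then show "(\<Sum>k<n. \<delta> (sm i k) (m k j)) = (\<Sum>k<n. \<delta> (sm k j) (m i k))"
      using BC.comatrix_flip[OF m _ _ bilinear_map_compose[OF \<delta> linear_section_proj lin_ident[OF B.vector_space_axioms]]]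
      by simp
  qed
  show "(\<Sum>k<n. \<gamma> (ym i k) (ym k j)) = (\<Sum>k<n. \<gamma> (ym k j) (ym i k))"
  proof (rule inv)
    fix \<delta> :: "'b \<Rightarrow> 'b \<Rightarrow> 'k" and i j assume \<delta>: "bilinear_map sB sB (*) \<delta>" and ij: "i < n" "j < n"
    have "(\<Sum>k<n. \<delta> (sm k j) (ym i k)) = (\<Sum>k<n. \<delta> (sm i k) (ym k j))"
      by (rule commuting_inverse[where s = sm and y = ym and U = sm and t = "(*)" and \<gamma> = "\<lambda>u v. \<delta> v u", OF B.k_algebra_axioms s_y y_s _ bilinear_map_flip[OF \<delta>] ij])
        (assumption | rule BC.comatrix_flip[OF s_comatrix])+
    then show "(\<Sum>k<n. \<delta> (sm i k) (ym k j)) = (\<Sum>k<n. \<delta> (sm k j) (ym i k))" by simp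
  qed
qed

text \<open>Cancelling s in retr(m) s = m gives terms m_il y_ab \<otimes> m_lj y_ja. Exchanging the
  two y's and then y with m across the tensor sign moves each y next to its own m, giving retr(m)
  \<otimes> retr(m).\<close>

lemma tev_retr_comatrix:
  assumes \<beta>: "bilinear_map sB sB (*) \<beta>" and ib: "i < n" "b < n"
  shows "tev (*) \<beta> (\<Delta>B (retr (m i b))) = (\<Sum>l<n. \<beta> (retr (m i l)) (retr (m l b)))"
proof -
  note l1 = bilinear_mapD(1)[OF \<beta>] and l2 = bilinear_mapD(2)[OF \<beta>]
  note id = lin_ident[OF B.vector_space_axioms]
  have \<gamma>: "bilinear_map sB sB (*) (\<lambda>c d. \<beta> (c * u) (d * v))" for u v
    by (rule bilinear_map_compose[OF \<beta> B.linear_mult(1) B.linear_mult(1)])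
  have \<gamma>': "bilinear_map sB sB (*) (\<lambda>c d. \<beta> (u * c) (d * v))" for u v
    by (rule bilinear_map_compose[OF \<beta> B.linear_mult(2) B.linear_mult(1)])
  have \<gamma>'': "bilinear_map sB sB (*) (\<lambda>c d. \<beta> (u * c) (v * d))" for u v
    by (rule bilinear_map_compose[OF \<beta> B.linear_mult(2) B.linear_mult(2)])
  have "tev (*) \<beta> (\<Delta>B (retr (m i b)))
      = (\<Sum>a<n. \<Sum>j<n. tev (*) (\<lambda>c d. \<beta> (c * ym a b) (d * ym j a)) (\<Delta>B (\<Sum>k<n. retr (m i k) * sm k j)))"
    by (rule B.tev_cancel_right[OF B.k_algebra_axioms id refl \<beta> s_comatrix s_y s_y ib(2), symmetric])
  also have "\<dots> = (\<Sum>a<n. \<Sum>j<n. \<Sum>l<n. \<beta> (m i l * ym a b) (m l j * ym j a))"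
    using ib(1) by (intro sum.cong[OF refl]) (simp add: retr_s B.tev_comatrix[OF m _ _ \<gamma>])
  also have "\<dots> = (\<Sum>a<n. \<Sum>l<n. \<Sum>j<n. \<beta> (m i l * ym a b) (m l j * ym j a))"
    by (intro sum.cong[OF refl] sum.swap)
  also have "\<dots> = (\<Sum>l<n. \<Sum>a<n. \<Sum>j<n. \<beta> (m i l * ym a b) (m l j * ym j a))"
    by (rule sum.swap)
  also have "\<dots> = (\<Sum>l<n. \<Sum>j<n. \<Sum>a<n. \<beta> (m i l * ym a b) (m l j * ym j a))"
    by (intro sum.cong[OF refl] sum.swap)
  \<comment> \<open>First exchange, over a: y_ab \<otimes> y_ja becomes y_ja \<otimes> y_ab.\<close>
  also have "\<dots> = (\<Sum>l<n. \<Sum>j<n. \<Sum>a<n. \<beta> (m i l * ym j a) (m l j * ym a b))"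
    using ib by (intro sum.cong[OF refl] y_commutes(2)[OF \<gamma>'', symmetric]) auto
  also have "\<dots> = (\<Sum>l<n. \<Sum>a<n. \<Sum>j<n. \<beta> (m i l * ym j a) (m l j * ym a b))"
    by (intro sum.cong[OF refl] sum.swap)
  \<comment> \<open>Second exchange, over j: y_ja \<otimes> m_lj becomes y_lj \<otimes>
    m_ja.\<close>
  also have "\<dots> = (\<Sum>l<n. \<Sum>a<n. \<Sum>j<n. \<beta> (m i l * ym l j) (m j a * ym a b))"
    by (intro sum.cong[OF refl] y_commutes(1)[OF \<gamma>', symmetric]) auto
  also have "\<dots> = (\<Sum>l<n. \<Sum>j<n. \<Sum>a<n. \<beta> (m i l * ym l j) (m j a * ym a b))"
    by (intro sum.cong[OF refl] sum.swap)
  also have "\<dots> = (\<Sum>j<n. \<Sum>l<n. \<Sum>a<n. \<beta> (m i l * ym l j) (m j a * ym a b))"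
    by (rule sum.swap)
  also have "\<dots> = (\<Sum>j<n. \<beta> (retr (m i j)) (retr (m j b)))"
    using ib by (intro sum.cong[OF refl]) (simp add: retr_comatrix lin_sum[OF l1] lin_sum[OF l2], rule sum.swap)
  finally show ?thesis .
qed

lemma counit_retr_comatrix:
  assumes ij: "i < n" "j < n"
  shows "\<epsilon>B (retr (m i j)) = \<epsilon>B (m i j)"
proof -
  have "\<epsilon>B (m i j) = (\<Sum>k<n. \<epsilon>B (retr (m i k)) * \<epsilon>B (sm k j))"
    unfolding B.counit_mult[symmetric] lin_sum[OF B.counit_linear, symmetric] retr_s[OF ij] ..
  also have "\<dots> = (\<Sum>k<n. if k = j then \<epsilon>B (retr (m i j)) else 0)"
    using ij by (intro sum.cong[OF refl]) (auto simp: B.counit_comatrix[OF s_comatrix])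
  finally show ?thesis using ij by simp
qed

end

lemma retr_coinvariant: "retr b \<in> range \<iota>"
  and corestr_coinvariant: "corestr b \<in> range \<iota>"
proof -
  obtain n m where m: "B.comatrix n m" "{b} \<subseteq> B.span {m i j | i j. i < n \<and> j < n}"
    using B.comatrix_exists[of "{b}"] by blast
  have sub: "B.subspace (range \<iota>)"
    using module_hom.subspace_image[of sA sB \<iota> UNIV] linear_incl by (simp add: linear_iff_module_hom)
  show "retr b \<in> range \<iota>"
    by (rule linear_span_into[OF linear_retr sub]) (use m retr_comatrix_coinvariant[OF m(1)] in auto)
  show "corestr b \<in> range \<iota>"
    by (rule linear_span_into[OF linear_corestr sub]) (use m corestr_comatrix_coinvariant[OF m(1)] in auto)
qed

text \<open>Since \<pi> \<iota> is the counit followed by the unit, a left factor from A never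
  reaches the antipode term.\<close>

lemma retr_incl_mult: "retr (\<iota> a * b) = \<iota> a * retr b"
proof (rule A.linear_eq_comatrix[of sB "\<lambda>a. retr (\<iota> a * b)" "\<lambda>a. \<iota> a * retr b"])
  show "Vector_Spaces.linear sA sB (\<lambda>a. retr (\<iota> a * b))"
    by (rule lin_compose[OF lin_compose[OF linear_incl B.linear_mult(1)] linear_retr])
  show "Vector_Spaces.linear sA sB (\<lambda>a. \<iota> a * retr b)"
    by (rule lin_compose[OF linear_incl B.linear_mult(1)])
  fix n m i j assume m: "A.comatrix n m" and ij: "i < n" "j < n"
  have "retr (\<iota> (m i j) * b) = (\<Sum>k<n. tev sB (\<lambda>c d. \<iota> (m i k) * c * SB (\<sigma> (\<pi> (\<iota> (m k j) * d)))) (\<Delta>B b))"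
    unfolding retr_def by (rule B.tev_comatrix_mult(1)[OF incl_comatrix[OF m] ij bilinear_retr])
  also have "\<dots> = (\<Sum>k<n. if k = j then \<iota> (m i j) * retr b else 0)"
    using ij unfolding retr_def lin_ext_out[OF B.linear_mult(2)]
    by (intro sum.cong[OF refl])
      (auto simp: proj_mult proj_incl A.counit_comatrix[OF m] mult.assoc split_def
        lin_zero[OF linear_section] lin_zero[OF B.antipode_linear] lin_ext_def)
  finally show "retr (\<iota> (m i j) * b) = \<iota> (m i j) * retr b" using ij by simp
qed

lemma corestr_mult_incl: "corestr (b * \<iota> a) = corestr b * \<iota> a"
proof (rule A.linear_eq_comatrix[of sB "\<lambda>a. corestr (b * \<iota> a)" "\<lambda>a. corestr b * \<iota> a"])
  show "Vector_Spaces.linear sA sB (\<lambda>a. corestr (b * \<iota> a))"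
    by (rule lin_compose[OF lin_compose[OF linear_incl B.linear_mult(2)] linear_corestr])
  show "Vector_Spaces.linear sA sB (\<lambda>a. corestr b * \<iota> a)"
    by (rule lin_compose[OF linear_incl B.linear_mult(2)])
  fix n m i j assume m: "A.comatrix n m" and ij: "i < n" "j < n"
  have "corestr (b * \<iota> (m i j)) = (\<Sum>k<n. tev sB (\<lambda>c d. SB (\<sigma> (\<pi> (c * \<iota> (m i k)))) * (d * \<iota> (m k j))) (\<Delta>B b))"
    unfolding corestr_def by (rule B.tev_comatrix_mult(2)[OF incl_comatrix[OF m] ij bilinear_corestr])
  also have "\<dots> = (\<Sum>k<n. if i = k then corestr b * \<iota> (m i j) else 0)"
    using ij unfolding corestr_def lin_ext_out[OF B.linear_mult(1)]
    by (intro sum.cong[OF refl])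
      (auto simp: proj_mult proj_incl A.counit_comatrix[OF m] mult.assoc split_def
        lin_zero[OF linear_section] lin_zero[OF B.antipode_linear] lin_ext_def)
  finally show "corestr (b * \<iota> (m i j)) = corestr b * \<iota> (m i j)" using ij by simp
qed

text \<open>As \<pi> \<sigma> = id, this is the antipode axiom for the coefficient matrix
  \<sigma>(m).\<close>

lemma corestr_section: "corestr (\<sigma> x) = sB (\<epsilon>C x) 1"
proof (rule C.linear_eq_comatrix[of sB "\<lambda>x. corestr (\<sigma> x)" "\<lambda>x. sB (\<epsilon>C x) 1"])
  show "Vector_Spaces.linear sC sB (\<lambda>x. corestr (\<sigma> x))"
    by (rule lin_compose[OF linear_section linear_corestr])
  show "Vector_Spaces.linear sC sB (\<lambda>x. sB (\<epsilon>C x) 1)"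
    by (rule lin_compose[OF C.counit_linear bilinear_mapD(1)[OF B.bilinear_map_scale]])
  fix n m i j assume m: "C.comatrix n m" and ij: "i < n" "j < n"
  note sm = section_comatrix[OF m]
  show "corestr (\<sigma> (m i j)) = sB (\<epsilon>C (m i j)) 1"
    using B.antipode_comatrix(1)[OF sm ij]
    by (simp add: corestr_comatrix[OF sm ij] proj_section C.counit_comatrix[OF m ij])
qed

lemma corestr_section_mult_incl: "corestr (\<sigma> x * \<iota> a) = sB (\<epsilon>C x) (\<iota> a)"
  by (simp add: corestr_mult_incl corestr_section B.scale_mult_left)

lemma bilinear_decomposition: "bilinear_map sB sB sB (\<lambda>x y. \<sigma> (\<pi> x) * corestr y)"
  by (rule bilinear_map_compose[OF B.bilinear_map_mult linear_section_proj linear_corestr])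

lemma decomposition: "b = tev sB (\<lambda>x y. \<sigma> (\<pi> x) * corestr y) (\<Delta>B b)"
proof (rule B.linear_eq_comatrix[OF lin_ident[OF B.vector_space_axioms] B.linear_tev_comult[OF bilinear_decomposition]])
  fix n m i j assume m: "B.comatrix n m" and ij: "i < n" "j < n"
  show "m i j = tev sB (\<lambda>x y. \<sigma> (\<pi> x) * corestr y) (\<Delta>B (m i j))"
    unfolding B.tev_comatrix[OF m ij bilinear_decomposition] using s_corestr[OF m ij] by simp
qed

lemma incl_left_inverse:
  obtains \<rho> where "Vector_Spaces.linear sB sA \<rho>" "\<And>a. \<rho> (\<iota> a) = a"
proof -
  interpret vector_space_pair sA sB ..
  obtain \<rho> where "Vector_Spaces.linear sB sA \<rho>" "\<rho> \<circ> \<iota> = id"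
    using linear_injective_left_inverse[OF linear_incl incl_inj] by blast
  then show thesis using that by (metis comp_apply id_apply)
qed

lemma retraction_exists:
  obtains p where "coalgebra_map sB \<Delta>B \<epsilon>B sA \<Delta>A \<epsilon>A p" "\<And>a b. p (\<iota> a * b) = a * p b"
proof -
  obtain \<rho> where \<rho>: "Vector_Spaces.linear sB sA \<rho>" "\<And>a. \<rho> (\<iota> a) = a" using incl_left_inverse by blast
  define p where "p b = \<rho> (retr b)" for b
  have ip: "\<iota> (p b) = retr b" for b
  proof -
    obtain a where "retr b = \<iota> a" using retr_coinvariant[of b] by (elim rangeE)
    then show ?thesis by (simp add: p_def \<rho>(2))
  qed
  have lp: "Vector_Spaces.linear sB sA p"
    unfolding p_def by (rule lin_compose[OF linear_retr \<rho>(1)])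
  have "coalgebra_map sB \<Delta>B \<epsilon>B sA \<Delta>A \<epsilon>A p"
  proof (rule coalgebra_mapI[OF B.coalgebra_axioms A.coalgebra_axioms lp])
    fix n m i j and \<beta> :: "'a \<Rightarrow> 'a \<Rightarrow> 'k"
    assume m: "B.comatrix n m" and ij: "i < n" "j < n" and \<beta>: "bilinear_map sA sA (*) \<beta>"
    \<comment> \<open>A form on A is pulled back to B along \<rho>, a linear left inverse of
      \<iota>; the coproduct of A is thereby tested inside B, where \<open>tev_retr_comatrix\<close>
      applies.\<close>
    let ?\<beta> = "\<lambda>u v. \<beta> (\<rho> u) (\<rho> v)"
    have \<beta>': "bilinear_map sB sB (*) ?\<beta>" by (rule bilinear_map_compose[OF \<beta> \<rho>(1) \<rho>(1)])
    have "tev (*) \<beta> (\<Delta>A (p (m i j))) = tev (*) ?\<beta> (tensor_map \<iota> \<iota> (\<Delta>A (p (m i j))))"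
      by (simp add: tev_tensor_map[OF vector_space_self] \<rho>(2))
    also have "\<dots> = tev (*) ?\<beta> (\<Delta>B (\<iota> (p (m i j))))"
      using incl_coalgebra by (intro tensor_eq_tev[OF _ \<beta>', symmetric]) (simp add: coalgebra_map_def)
    also have "\<dots> = (\<Sum>k<n. \<beta> (p (m i k)) (p (m k j)))"
      unfolding ip by (simp add: tev_retr_comatrix[OF m \<beta>' ij] p_def)
    finally show "tev (*) \<beta> (\<Delta>A (p (m i j))) = (\<Sum>k<n. \<beta> (p (m i k)) (p (m k j)))" .
  next
    fix n m i j assume m: "B.comatrix n m" and ij: "i < n" "j < n"
    have "\<epsilon>A (p (m i j)) = \<epsilon>B (\<iota> (p (m i j)))" using incl_coalgebra by (simp add: coalgebra_map_def)
    then show "\<epsilon>A (p (m i j)) = \<epsilon>B (m i j)" by (simp add: ip counit_retr_comatrix[OF m ij])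
  qed
  moreover have "p (\<iota> a * b) = a * p b" for a b
  proof -
    have "p (\<iota> a * b) = \<rho> (\<iota> (a * p b))" unfolding p_def[of "\<iota> a * b"] retr_incl_mult incl_mult ip ..
    then show ?thesis by (simp add: \<rho>(2))
  qed
  ultimately show thesis by (rule that)
qed

end

lemma (in vector_space) dim_span_dual_family:
  assumes I: "finite I" and L: "\<And>i. i \<in> I \<Longrightarrow> Vector_Spaces.linear scale (*) (L i)"
    and dual: "\<And>i j. i \<in> I \<Longrightarrow> j \<in> I \<Longrightarrow> L i (v j) = (if i = j then 1 else 0)"
  shows "dim (span (v ` I)) = card I"
proof -
  have inj: "inj_on v I"
    using dual by (intro inj_onI) (metis zero_neq_one)
  have "independent (v ` I)"
  proof (rule independent_if_scalars_zero)
    fix f x assume sum: "(\<Sum>x\<in>v ` I. scale (f x) x) = 0" and "x \<in> v ` I"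
    then obtain i where i: "i \<in> I" "x = v i" by blast
    have "0 = L i (\<Sum>x\<in>v ` I. scale (f x) x)" by (simp add: sum lin_zero[OF L[OF i(1)]])
    also have "\<dots> = (\<Sum>j\<in>I. f (v j) * L i (v j))"
      unfolding sum.reindex[OF inj] by (simp add: lin_sum[OF L[OF i(1)]] lin_scale[OF L[OF i(1)]])
    also have "\<dots> = (\<Sum>j\<in>I. if i = j then f (v i) else 0)"
      using dual i(1) by (intro sum.cong[OF refl]) auto
    also have "\<dots> = f x" using I i by simp
    finally show "f x = 0" by simp
  qed (use I in simp)
  then show ?thesis
    using dim_span_eq_card_independent card_image[OF inj] by simp
qed

lemma tev_coalgebra_map:
  assumes f: "coalgebra_map s \<Delta> \<epsilon> s' \<Delta>' \<epsilon>' f" and \<beta>: "bilinear_map s' s' t \<beta>"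
  shows "tev t \<beta> (\<Delta>' (f x)) = tev t (\<lambda>u v. \<beta> (f u) (f v)) (\<Delta> x)"
proof -
  have t: "vector_space t" by (rule linear_vector_space(2)[OF bilinear_mapD(1)[OF \<beta>]])
  have "tev t \<beta> (\<Delta>' (f x)) = tev t \<beta> (tensor_map f f (\<Delta> x))"
    using f by (intro tensor_eq_tev[OF _ \<beta>]) (simp add: coalgebra_map_def)
  then show ?thesis by (simp only: tev_tensor_map[OF t])
qed

section \<open>Products of subspaces of C and A inside B\<close>

context cleft_section
begin

text \<open>The factor from A stands on the right, in accordance with the right A-linearity of
  \<open>corestr\<close> and with the order in \<open>decomposition\<close>.\<close>

definition prodspace :: "'c set \<Rightarrow> 'a set \<Rightarrow> 'b set" where
  "prodspace U V = B.span {\<sigma> x * \<iota> a | x a. x \<in> U \<and> a \<in> V}"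

lemma prodspaceI: "x \<in> U \<Longrightarrow> a \<in> V \<Longrightarrow> \<sigma> x * \<iota> a \<in> prodspace U V"
  unfolding prodspace_def by (intro B.span_base) blast

lemma subspace_prodspace: "B.subspace (prodspace U V)"
  by (simp add: prodspace_def)

lemma linear_prod:
  "Vector_Spaces.linear sC sB (\<lambda>x. \<sigma> x * b)" "Vector_Spaces.linear sA sB (\<lambda>a. b * \<iota> a)"
  by (rule lin_compose[OF linear_section B.linear_mult(1)], rule lin_compose[OF linear_incl B.linear_mult(2)])

lemma prodspace_span: "prodspace (C.span X) (A.span Y) = B.span ((\<lambda>(x, a). \<sigma> x * \<iota> a) ` (X \<times> Y))" (is "_ = ?W")
proof
  have "\<sigma> x * \<iota> a \<in> ?W" if x: "x \<in> C.span X" and a: "a \<in> A.span Y" for x a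
  proof (rule linear_span_into[OF linear_prod(1) B.subspace_span _ x])
    fix x assume "x \<in> X"
    show "\<sigma> x * \<iota> a \<in> ?W"
    proof (rule linear_span_into[OF linear_prod(2) B.subspace_span _ a])
      fix a assume "a \<in> Y"
      then show "\<sigma> x * \<iota> a \<in> ?W" using \<open>x \<in> X\<close> by (intro B.span_base) auto
    qed
  qed
  then show "prodspace (C.span X) (A.span Y) \<subseteq> ?W"
    unfolding prodspace_def by (intro B.span_minimal) auto
  show "?W \<subseteq> prodspace (C.span X) (A.span Y)"
    by (intro B.span_minimal subspace_prodspace) (auto intro!: prodspaceI C.span_base A.span_base)
qed

text \<open>The map b -> \<pi>(b_1) \<otimes> q(b_2) inverts multiplication: on \<sigma>(x)
  \<iota>(a) the identities \<pi> \<iota> = \<epsilon> and q(\<sigma>(x) \<iota>(a)) = \<epsilon>(x)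
  \<iota>(a) leave x \<otimes> \<iota>(a). A functional \<psi> on the second factor reads off
  coordinates.\<close>

lemma section_coordinate:
  assumes \<psi>: "Vector_Spaces.linear sB (*) \<psi>"
  shows "tev sC (\<lambda>u v. sC (\<psi> (corestr v)) (\<pi> u)) (\<Delta>B (\<sigma> x * \<iota> a)) = sC (\<psi> (\<iota> a)) x"
    and "Vector_Spaces.linear sB sC (\<lambda>b. tev sC (\<lambda>u v. sC (\<psi> (corestr v)) (\<pi> u)) (\<Delta>B b))"
proof -
  let ?\<beta> = "\<lambda>u v. sC (\<psi> (corestr v)) (\<pi> u)"
  have \<beta>: "bilinear_map sB sB sC ?\<beta>"
    by (rule bilinear_map_flip[OF bilinear_map_compose[OF C.bilinear_map_scale lin_compose[OF linear_corestr \<psi>] linear_proj]])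
  show r: "Vector_Spaces.linear sB sC (\<lambda>b. tev sC ?\<beta> (\<Delta>B b))" by (rule B.linear_tev_comult[OF \<beta>])
  show "tev sC ?\<beta> (\<Delta>B (\<sigma> x * \<iota> a)) = sC (\<psi> (\<iota> a)) x"
  proof (rule C.linear_eq_comatrix[of sC "\<lambda>x. tev sC ?\<beta> (\<Delta>B (\<sigma> x * \<iota> a))" "\<lambda>x. sC (\<psi> (\<iota> a)) x"])
    show "Vector_Spaces.linear sC sC (\<lambda>x. tev sC ?\<beta> (\<Delta>B (\<sigma> x * \<iota> a)))"
      by (rule lin_compose[OF linear_prod(1) r])
    show "Vector_Spaces.linear sC sC (\<lambda>x. sC (\<psi> (\<iota> a)) x)"
      by (rule bilinear_mapD(3)[OF C.bilinear_map_scale])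
    fix n g i j assume g: "C.comatrix n g" and ij: "i < n" "j < n"
    show "tev sC ?\<beta> (\<Delta>B (\<sigma> (g i j) * \<iota> a)) = sC (\<psi> (\<iota> a)) (g i j)"
    proof (rule A.linear_eq_comatrix[of sC "\<lambda>a. tev sC ?\<beta> (\<Delta>B (\<sigma> (g i j) * \<iota> a))" "\<lambda>a. sC (\<psi> (\<iota> a)) (g i j)"])
      show "Vector_Spaces.linear sA sC (\<lambda>a. tev sC ?\<beta> (\<Delta>B (\<sigma> (g i j) * \<iota> a)))"
        by (rule lin_compose[OF linear_prod(2) r])
      show "Vector_Spaces.linear sA sC (\<lambda>a. sC (\<psi> (\<iota> a)) (g i j))"
        by (rule lin_compose[OF lin_compose[OF linear_incl \<psi>] bilinear_mapD(1)[OF C.bilinear_map_scale]])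
      fix N m k l assume m: "A.comatrix N m" and kl: "k < N" "l < N"
      have "tev sC ?\<beta> (\<Delta>B (\<sigma> (g i j) * \<iota> (m k l))) =
          (\<Sum>r<n. \<Sum>t<N. ?\<beta> (\<sigma> (g i r) * \<iota> (m k t)) (\<sigma> (g r j) * \<iota> (m t l)))"
        unfolding B.tev_comatrix_mult(1)[OF section_comatrix[OF g] ij \<beta>]
        by (intro sum.cong[OF refl] B.tev_comatrix[OF incl_comatrix[OF m] kl B.bilinear_map_mult_both(1)[OF \<beta>]])
      also have "\<dots> = (\<Sum>r<n. \<Sum>t<N. if t = k then if r = j then sC (\<psi> (\<iota> (m k l))) (g i j) else 0 else 0)"
        using ij kl by (intro sum.cong[OF refl])
          (auto simp: corestr_section_mult_incl proj_mult proj_section proj_incl C.counit_comatrix[OF g]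
            A.counit_comatrix[OF m] lin_zero[OF \<psi>])
      also have "\<dots> = sC (\<psi> (\<iota> (m k l))) (g i j)" using ij kl by (simp cong: sum.cong_simp)
      finally show "tev sC ?\<beta> (\<Delta>B (\<sigma> (g i j) * \<iota> (m k l))) = sC (\<psi> (\<iota> (m k l))) (g i j)" .
    qed
  qed
qed

lemma dim_prodspace:
  assumes U: "fin_dim_subspace sC U" and V: "fin_dim_subspace sA V"
  shows "fin_dim_subspace sB (prodspace U V)" "B.dim (prodspace U V) = C.dim U * A.dim V"
proof -
  obtain X where X: "finite X" "C.independent X" "C.span X = U" "card X = C.dim U"
    using C.fin_dim_basis[OF U] .
  obtain Y where Y: "finite Y" "A.independent Y" "A.span Y = V" "card Y = A.dim V"
    using A.fin_dim_basis[OF V] .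
  let ?v = "\<lambda>(x, a). \<sigma> x * \<iota> a"
  have span: "prodspace U V = B.span (?v ` (X \<times> Y))"
    using prodspace_span[of X Y] X(3) Y(3) by simp
  show "fin_dim_subspace sB (prodspace U V)"
    unfolding span by (rule B.fin_dim_span) (simp add: X Y)
  obtain h where h: "\<And>b. Vector_Spaces.linear sC (*) (h b)"
      "\<And>b b'. b' \<in> X \<Longrightarrow> h b b' = (if b = b' then 1 else 0)"
    using C.dual_basis[OF X(2)] by blast
  obtain k where k: "\<And>b. Vector_Spaces.linear sA (*) (k b)"
      "\<And>b b'. b' \<in> Y \<Longrightarrow> k b b' = (if b = b' then 1 else 0)"
    using A.dual_basis[OF Y(2)] by blast
  obtain \<rho> where \<rho>: "Vector_Spaces.linear sB sA \<rho>" "\<And>a. \<rho> (\<iota> a) = a" using incl_left_inverse by blast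
  \<comment> \<open>Coordinate functionals on B dual to the products \<sigma>(x) \<iota>(a) of basis
    vectors, so these products are independent.\<close>
  let ?L = "\<lambda>(x, a) b. h x (tev sC (\<lambda>u v. sC (k a (\<rho> (corestr v))) (\<pi> u)) (\<Delta>B b))"
  have "B.dim (B.span (?v ` (X \<times> Y))) = card (X \<times> Y)"
  proof (rule B.dim_span_dual_family[of _ ?L])
    show "finite (X \<times> Y)" using X Y by simp
    note coord = section_coordinate[OF lin_compose[OF \<rho>(1) k(1)]]
    show "Vector_Spaces.linear sB (*) (?L i)" for i
      using lin_compose[OF coord(2) h(1)] by (simp split: prod.split)
    show "?L i (?v j) = (if i = j then 1 else 0)" if "i \<in> X \<times> Y" "j \<in> X \<times> Y" for i j
      using that by (cases i; cases j) (auto simp: coord(1) lin_scale[OF h(1)] \<rho>(2) h(2) k(2))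
  qed
  then show "B.dim (prodspace U V) = C.dim U * A.dim V"
    unfolding span using X(4) Y(4) by (simp add: card_cartesian_product)
qed

lemma tev_section_mult_incl:
  assumes \<beta>: "bilinear_map sB sB t \<beta>"
    and p: "tensor_eq sC sC (\<Delta>C x) p" and q: "tensor_eq sA sA (\<Delta>A a) q"
  shows "tev t \<beta> (\<Delta>B (\<sigma> x * \<iota> a)) = tev t (\<lambda>u v. tev t (\<lambda>c d. \<beta> (\<sigma> u * \<iota> c) (\<sigma> v * \<iota> d)) q) p"
proof -
  have inner: "tev t (\<lambda>c d. \<beta> (u * c) (v * d)) (\<Delta>B (\<iota> a)) = tev t (\<lambda>c d. \<beta> (u * \<iota> c) (v * \<iota> d)) q" for u v
    unfolding tev_coalgebra_map[OF incl_coalgebra B.bilinear_map_mult_both(1)[OF \<beta>]]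
    by (rule tensor_eq_tev[OF q bilinear_map_compose[OF \<beta> linear_prod(2) linear_prod(2)]])
  have b: "bilinear_map sB sB t (\<lambda>u v. tev t (\<lambda>c d. \<beta> (u * \<iota> c) (v * \<iota> d)) q)"
    using B.bilinear_map_tev_mult[OF \<beta>, of "\<Delta>B (\<iota> a)"] unfolding inner .
  show ?thesis
    unfolding B.tev_comult_mult[OF \<beta>] inner tev_coalgebra_map[OF section_coalgebra b]
    by (rule tensor_eq_tev[OF p bilinear_map_compose[OF b linear_section linear_section]])
qed

lemma subcoalgebra_prodspace:
  assumes U: "subcoalgebra sC \<Delta>C U" and V: "subcoalgebra sA \<Delta>A V"
  shows "subcoalgebra sB \<Delta>B (prodspace U V)"
proof -
  let ?E = "prodspace U V"
  have slices: "tev sB \<beta> (\<Delta>B z) \<in> ?E"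
    if \<beta>: "bilinear_map sB sB sB \<beta>" and closed: "\<And>x y. x \<in> ?E \<Longrightarrow> y \<in> ?E \<Longrightarrow> \<beta> x y \<in> ?E" and z: "z \<in> ?E" for \<beta> z
  proof (rule linear_span_into[OF B.linear_tev_comult[OF \<beta>] subspace_prodspace _ z[unfolded prodspace_def]])
    fix z assume "z \<in> {\<sigma> x * \<iota> a | x a. x \<in> U \<and> a \<in> V}"
    then obtain x a where z: "z = \<sigma> x * \<iota> a" and "x \<in> U" "a \<in> V" by blast
    then obtain p q where p: "Poly_Mapping.keys p \<subseteq> U \<times> U" "tensor_eq sC sC (\<Delta>C x) p"
      and q: "Poly_Mapping.keys q \<subseteq> V \<times> V" "tensor_eq sA sA (\<Delta>A a) q"
      using U V unfolding subcoalgebra_def by blast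
    have "\<beta> (\<sigma> u * \<iota> c) (\<sigma> v * \<iota> d) \<in> ?E"
      if "(u, v) \<in> Poly_Mapping.keys p" "(c, d) \<in> Poly_Mapping.keys q" for u v c d
      using that p(1) q(1) by (intro closed prodspaceI) auto
    then show "tev sB \<beta> (\<Delta>B z) \<in> ?E"
      unfolding z tev_section_mult_incl[OF \<beta> p(2) q(2)]
      by (intro B.lin_ext_in_subspace[OF subspace_prodspace]) (auto intro!: B.lin_ext_in_subspace[OF subspace_prodspace])
  qed
  show ?thesis
  proof (rule B.subcoalgebraI[OF subspace_prodspace])
    fix x \<psi> assume x: "x \<in> ?E" and \<psi>: "Vector_Spaces.linear sB (*) \<psi>"
    show "tev sB (\<lambda>x y. sB (\<psi> y) x) (\<Delta>B x) \<in> ?E"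
      by (rule slices[OF B.slice_bilinear(1)[OF \<psi>] _ x]) (rule B.subspace_scale[OF subspace_prodspace])
    show "tev sB (\<lambda>x y. sB (\<psi> x) y) (\<Delta>B x) \<in> ?E"
      by (rule slices[OF B.slice_bilinear(2)[OF \<psi>] _ x]) (rule B.subspace_scale[OF subspace_prodspace])
  qed
qed

text \<open>The decomposition of f \<sigma>(c). An arbitrary representative p of \<Delta> c is
  allowed so that one supported on a subcoalgebra containing c can be inserted.\<close>

lemma mult_section:
  assumes "tensor_eq sC sC (\<Delta>C c) p"
  shows "f * \<sigma> c = tev sB (\<lambda>a b. tev sB (\<lambda>u v. \<sigma> (\<pi> a * u) * corestr (b * \<sigma> v)) p) (\<Delta>B f)"
proof -
  have "tev sB (\<lambda>u v. \<sigma> (\<pi> (a * u)) * corestr (b * v)) (\<Delta>B (\<sigma> c))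
      = tev sB (\<lambda>u v. \<sigma> (\<pi> a * u) * corestr (b * \<sigma> v)) p" for a b
  proof -
    note bil = B.bilinear_map_mult_both(1)[OF bilinear_decomposition]
    have "tev sB (\<lambda>u v. \<sigma> (\<pi> (a * u)) * corestr (b * v)) (\<Delta>B (\<sigma> c))
        = tev sB (\<lambda>u v. \<sigma> (\<pi> (a * \<sigma> u)) * corestr (b * \<sigma> v)) p"
      unfolding tev_coalgebra_map[OF section_coalgebra bil]
      by (rule tensor_eq_tev[OF assms bilinear_map_compose[OF bil linear_section linear_section]])
    then show ?thesis by (simp add: proj_mult proj_section)
  qed
  then show ?thesis
    using decomposition[of "f * \<sigma> c"] unfolding B.tev_comult_mult[OF bilinear_decomposition] by simp
qed

theorem amenable_extension:
  assumes "amenable sA \<Delta>A" and "amenable sC \<Delta>C"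
  shows "amenable sB \<Delta>B"
  unfolding B.amenable_iff
proof (intro allI impI, elim conjE)
  fix F and \<epsilon> :: real assume F: "fin_dim_subspace sB F" and \<epsilon>: "\<epsilon> > 0"
  obtain X where X: "finite X" "F = B.span X" using F by (auto simp: fin_dim_subspace_def)
  \<comment> \<open>As \<delta> \<le> 1, the product (1 + \<delta>)(1 + \<delta>) is at most 1 + 3
    \<delta>, hence at most 1 + \<epsilon>.\<close>
  define \<delta> where "\<delta> = min 1 (\<epsilon> / 3)"
  have \<delta>: "\<delta> > 0" "(1 + \<delta>) * (1 + \<delta>) \<le> 1 + \<epsilon>"
  proof -
    show "\<delta> > 0" using \<epsilon> by (simp add: \<delta>_def)
    then have "\<delta> * \<delta> \<le> \<delta> * 1" by (intro mult_left_mono) (simp_all add: \<delta>_def)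
    moreover have "3 * \<delta> \<le> \<epsilon>" by (simp add: \<delta>_def)
    ultimately show "(1 + \<delta>) * (1 + \<delta>) \<le> 1 + \<epsilon>" by (simp add: algebra_simps)
  qed
  let ?K = "\<Union>f\<in>X. Poly_Mapping.keys (\<Delta>B f)"
  \<comment> \<open>First legs of \<Delta> f act on C through \<pi>; the second legs reappear in the
    finite set \<open>?GA\<close> for A.\<close>
  let ?FC = "C.span (\<pi> ` fst ` ?K)"
  have FC: "fin_dim_subspace sC ?FC" by (rule C.fin_dim_span) (simp add: X)
  obtain EC where EC: "fin_dim_subspace sC EC" "subcoalgebra sC \<Delta>C EC"
    and lessC: "real (C.dim {x + y | x y. x \<in> EC \<and> y \<in> subspace_prod sC ?FC EC}) < (1 + \<delta>) * real (C.dim EC)"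
    using assms(2) FC \<delta>(1) unfolding C.amenable_iff by blast
  let ?C' = "{x + y | x y. x \<in> EC \<and> y \<in> subspace_prod sC ?FC EC}"
  note fCP = C.fin_dim_subspace_prod[OF FC EC(1)]
  note fC' = C.fin_dim_sums[OF EC(1) fCP]
  note C'sub = C.subspace_sums_upper[OF C.fin_dim_subspaceD[OF EC(1)] C.fin_dim_subspaceD[OF fCP]]
  obtain Y where Y: "finite Y" "EC = C.span Y" using EC by (auto simp: fin_dim_subspace_def)
  obtain P where P: "\<And>c. c \<in> EC \<Longrightarrow> Poly_Mapping.keys (P c) \<subseteq> EC \<times> EC"
    "\<And>c. c \<in> EC \<Longrightarrow> tensor_eq sC sC (\<Delta>C c) (P c)"
    using EC(2) unfolding subcoalgebra_def by metis
  obtain \<rho> where \<rho>: "Vector_Spaces.linear sB sA \<rho>" "\<And>a. \<rho> (\<iota> a) = a" using incl_left_inverse by blast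
  have \<iota>\<rho>: "\<iota> (\<rho> (corestr b)) = corestr b" for b
  proof -
    obtain a where "corestr b = \<iota> a" using corestr_coinvariant[of b] by (elim rangeE)
    then show ?thesis by (simp add: \<rho>(2))
  qed
  \<comment> \<open>The elements q(f_2 \<sigma>(c_2)) seen in A. They depend on EC through the legs
    of \<Delta> c, so EC must be fixed before EA is chosen.\<close>
  let ?GA = "(\<lambda>(b, v). \<rho> (corestr (b * \<sigma> v))) ` (snd ` ?K \<times> snd ` (\<Union>c\<in>Y. Poly_Mapping.keys (P c)))"
  have FA: "fin_dim_subspace sA (A.span ?GA)" by (rule A.fin_dim_span) (simp add: X Y)
  obtain EA where EA: "fin_dim_subspace sA EA" "subcoalgebra sA \<Delta>A EA"
    and lessA: "real (A.dim {x + y | x y. x \<in> EA \<and> y \<in> subspace_prod sA (A.span ?GA) EA}) < (1 + \<delta>) * real (A.dim EA)"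
    using assms(1) FA \<delta>(1) unfolding A.amenable_iff by blast
  let ?A' = "{x + y | x y. x \<in> EA \<and> y \<in> subspace_prod sA (A.span ?GA) EA}"
  note fAP = A.fin_dim_subspace_prod[OF FA EA(1)]
  note fA' = A.fin_dim_sums[OF EA(1) fAP]
  note A'sub = A.subspace_sums_upper[OF A.fin_dim_subspaceD[OF EA(1)] A.fin_dim_subspaceD[OF fAP]]
  \<comment> \<open>\<open>?W\<close> will contain E + FE, and its dimension is the product of the
    dimensions of the two slightly enlarged spaces.\<close>
  let ?E = "prodspace EC EA" and ?W = "prodspace ?C' ?A'"
  note sW = subspace_prodspace[of ?C' ?A']
  have EW: "?E \<subseteq> ?W"
    unfolding prodspace_def[of EC EA]
  proof (rule B.span_minimal[OF _ sW], safe)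
    fix x a assume "x \<in> EC" "a \<in> EA"
    then have "x \<in> ?C'" "a \<in> ?A'" using C'sub(1) A'sub(1) by auto
    then show "\<sigma> x * \<iota> a \<in> ?W" by (rule prodspaceI)
  qed
  have gen: "f * (\<sigma> c * \<iota> a) \<in> ?W" if f: "f \<in> X" and c: "c \<in> Y" and a: "a \<in> EA" for f c a
  proof -
    have cE: "c \<in> EC" using c Y(2) C.span_base by simp
    have "\<sigma> (\<pi> x * u) * corestr (y * \<sigma> v) * \<iota> a \<in> ?W"
      if xy: "(x, y) \<in> Poly_Mapping.keys (\<Delta>B f)" and uv: "(u, v) \<in> Poly_Mapping.keys (P c)" for x y u v
    proof -
      have "\<pi> x \<in> \<pi> ` fst ` ?K" using xy f by force
      then have "\<pi> x * u \<in> subspace_prod sC ?FC EC"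
        using uv P(1)[OF cE] by (intro C.subspace_prod_mult C.span_base) auto
      then have 1: "\<pi> x * u \<in> ?C'" using C'sub(2) by blast
      have "\<rho> (corestr (y * \<sigma> v)) \<in> ?GA"
        using xy uv f c by (intro image_eqI[of _ _ "(y, v)"]) force+
      then have "\<rho> (corestr (y * \<sigma> v)) * a \<in> subspace_prod sA (A.span ?GA) EA"
        using a by (intro A.subspace_prod_mult A.span_base)
      then have 2: "\<rho> (corestr (y * \<sigma> v)) * a \<in> ?A'" using A'sub(2) by blast
      have "\<sigma> (\<pi> x * u) * corestr (y * \<sigma> v) * \<iota> a = \<sigma> (\<pi> x * u) * \<iota> (\<rho> (corestr (y * \<sigma> v)) * a)"
        by (simp add: incl_mult \<iota>\<rho> mult.assoc)
      then show ?thesis using prodspaceI[OF 1 2] by simp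
    qed
    moreover have "f * (\<sigma> c * \<iota> a) = tev sB (\<lambda>x y. tev sB (\<lambda>u v. \<sigma> (\<pi> x * u) * corestr (y * \<sigma> v) * \<iota> a) (P c)) (\<Delta>B f)"
      unfolding mult.assoc[symmetric] mult_section[OF P(2)[OF cE], of f] lin_ext_out[OF B.linear_mult(1)[of "\<iota> a"]]
      by (simp add: split_def lin_ext_out[OF B.linear_mult(1)[of "\<iota> a"]])
    ultimately show ?thesis
      by (auto intro!: B.lin_ext_in_subspace[OF sW])
  qed
  have FE: "f * e \<in> ?W" if f: "f \<in> F" and e: "e \<in> ?E" for f e
  proof (rule linear_span_into[OF B.linear_mult(1) sW _ f[unfolded X(2)]])
    fix f assume f: "f \<in> X"
    show "f * e \<in> ?W"
    proof (rule linear_span_into[OF B.linear_mult(2) sW _ e[unfolded prodspace_def]])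
      fix z assume "z \<in> {\<sigma> x * \<iota> a | x a. x \<in> EC \<and> a \<in> EA}"
      then obtain x a where z: "z = \<sigma> x * \<iota> a" and x: "x \<in> EC" and a: "a \<in> EA" by blast
      show "f * z \<in> ?W"
        unfolding z
        by (rule linear_span_into[OF lin_compose[OF linear_prod(1) B.linear_mult(2)] sW gen[OF f _ a] x[unfolded Y(2)]])
    qed
  qed
  have fE: "fin_dim_subspace sB ?E" and fW: "fin_dim_subspace sB ?W"
    by (rule dim_prodspace(1)[OF EC(1) EA(1)], rule dim_prodspace(1)[OF fC' fA'])
  have "subspace_prod sB F ?E \<subseteq> ?W"
    unfolding subspace_prod_def[of sB] by (rule B.span_minimal[OF _ sW]) (use FE in blast)
  then have "{x + y | x y. x \<in> ?E \<and> y \<in> subspace_prod sB F ?E} \<subseteq> ?W"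
    using EW B.subspace_add[OF sW] by blast
  then have "B.dim {x + y | x y. x \<in> ?E \<and> y \<in> subspace_prod sB F ?E} \<le> C.dim ?C' * A.dim ?A'"
    using B.fin_dim_mono(2)[OF fW B.subspace_sums[OF subspace_prodspace B.fin_dim_subspaceD[OF B.fin_dim_subspace_prod[OF F fE]]]]
    unfolding dim_prodspace(2)[OF fC' fA'] by blast
  then have "real (B.dim {x + y | x y. x \<in> ?E \<and> y \<in> subspace_prod sB F ?E}) \<le> real (C.dim ?C') * real (A.dim ?A')"
    by (simp only: of_nat_le_iff flip: of_nat_mult)
  also have "\<dots> < ((1 + \<delta>) * real (C.dim EC)) * ((1 + \<delta>) * real (A.dim EA))"
    by (rule mult_strict_mono'[OF lessC lessA]) simp_all
  also have "\<dots> = ((1 + \<delta>) * (1 + \<delta>)) * real (B.dim ?E)"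
    by (simp add: dim_prodspace(2)[OF EC(1) EA(1)])
  also have "\<dots> \<le> (1 + \<epsilon>) * real (B.dim ?E)"
    using \<delta>(2) by (rule mult_right_mono) simp
  finally show "\<exists>E. fin_dim_subspace sB E \<and> subcoalgebra sB \<Delta>B E \<and>
      real (B.dim {x + y | x y. x \<in> E \<and> y \<in> subspace_prod sB F E}) < (1 + \<epsilon>) * real (B.dim E)"
    using fE subcoalgebra_prodspace[OF EC(2) EA(2)] by blast
qed

end

theorem theorem5:
  fixes sA :: "'k::field \<Rightarrow> 'a::ring_1 \<Rightarrow> 'a"
    and sB :: "'k \<Rightarrow> 'b::ring_1 \<Rightarrow> 'b"
    and sC :: "'k \<Rightarrow> 'c::ring_1 \<Rightarrow> 'c"
  assumes "cleft_exact_sequence sA \<Delta>A \<epsilon>A SA sB \<Delta>B \<epsilon>B SB sC \<Delta>C \<epsilon>C SC \<iota> \<pi>"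
    and "cocommutative_hopf_algebra sA \<Delta>A \<epsilon>A SA"
    and "cocommutative_hopf_algebra sB \<Delta>B \<epsilon>B SB"
    and "cocommutative_hopf_algebra sC \<Delta>C \<epsilon>C SC"
  shows "amenable sB \<Delta>B \<longleftrightarrow> amenable sA \<Delta>A \<and> amenable sC \<Delta>C"
proof -
  obtain \<sigma> where \<sigma>: "coalgebra_map sC \<Delta>C \<epsilon>C sB \<Delta>B \<epsilon>B \<sigma>" "\<pi> \<circ> \<sigma> = id"
    using cleft_exact_sequence.cleft[OF assms(1)] by blast
  interpret cleft_section sA \<Delta>A \<epsilon>A SA sB \<Delta>B \<epsilon>B SB sC \<Delta>C \<epsilon>C SC \<iota> \<pi> \<sigma>
    using assms(1,3) \<sigma> by (intro cleft_section.intro cleft_section_axioms.intro) (auto simp: fun_eq_iff)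
  show ?thesis
  proof (intro iffI conjI; (elim conjE)?)
    assume B: "amenable sB \<Delta>B"
    obtain p where p: "coalgebra_map sB \<Delta>B \<epsilon>B sA \<Delta>A \<epsilon>A p" "\<And>a b. p (\<iota> a * b) = a * p b"
      using retraction_exists by blast
    show "amenable sA \<Delta>A"
    proof (rule amenable_transfer[OF assms(3,2) p(1) _ B])
      \<comment> \<open>For the retraction, g is a coefficient matrix of A and m its image under
        \<iota>; left A-linearity of p is the required compatibility.\<close>
      fix F :: "'a set" assume "finite F"
      then obtain n m where "A.comatrix n m" "F \<subseteq> A.span {m i j | i j. i < n \<and> j < n}"
        using A.comatrix_exists by blast
      then show "\<exists>n m g. B.comatrix n m \<and> F \<subseteq> A.span {g i j | i j. i < n \<and> j < n} \<and>
          (\<forall>i<n. \<forall>j<n. \<forall>b. p (m i j * b) = g i j * p b)"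
        using incl_comatrix p(2) by (intro exI[of _ n] exI[of _ "\<lambda>i j. \<iota> (m i j)"] exI[of _ m]) simp
    qed
    show "amenable sC \<Delta>C"
    proof (rule amenable_transfer[OF assms(3,4) proj_coalgebra _ B])
      \<comment> \<open>For \<pi>, F is lifted by \<sigma>: a coefficient matrix of B covering
        \<sigma>(F) has an image under \<pi> that covers F.\<close>
      fix F :: "'c set" assume "finite F"
      then obtain n m where m: "B.comatrix n m" "\<sigma> ` F \<subseteq> B.span {m i j | i j. i < n \<and> j < n}"
        using B.comatrix_exists[of "\<sigma> ` F"] by blast
      have "\<pi> (\<sigma> x) \<in> C.span {\<pi> (m i j) | i j. i < n \<and> j < n}" if "x \<in> F" for x
        by (rule linear_span_into[OF linear_proj C.subspace_span, of "{m i j | i j. i < n \<and> j < n}"])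
          (use m(2) that in \<open>auto intro!: C.span_base\<close>)
      then show "\<exists>n m g. B.comatrix n m \<and> F \<subseteq> C.span {g i j | i j. i < n \<and> j < n} \<and>
          (\<forall>i<n. \<forall>j<n. \<forall>b. \<pi> (m i j * b) = g i j * \<pi> b)"
        using m(1) by (intro exI[of _ n] exI[of _ m] exI[of _ "\<lambda>i j. \<pi> (m i j)"]) (auto simp: proj_mult proj_section)
    qed
  next
    assume "amenable sA \<Delta>A" "amenable sC \<Delta>C"
    then show "amenable sB \<Delta>B" by (rule amenable_extension)
  qed
qed

end
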